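(* Let $u=(r,\sigma,s)\in\mathbb R_+^3$, let $X=N+P\in\mathcal O^3_u$ be real-analytic with $N=(0,v(\mathrm I,y),\omega(\mathrm I,y))$, and let $w=(\rho,\tau,t)\in\mathbb R_+^3$. Put $D:=\mathrm{diam}(\mathbb Y_\sigma)$ and $$Q:=3\,D\left\|\tfrac1v\right\|_{r,\sigma}.$$ Assume that for some $p\in\mathbb N$ and some $s_2\in\mathbb R_+$ the following inequalities hold: $$0<\rho<\frac r8,\qquad 0<\tau<e^{-s_2}\frac\sigma8,\qquad 0<t<\frac s{10},$$ $$\chi:=\frac{D}{s_2}\left\|\frac{\partial_yv}{v}\right\|_{r,\sigma}\le1,\qquad \theta_1:=2e^{s_2}D\left\|\frac{\partial_y\omega}{v}\right\|_{r,\sigma}\frac\tau t\le1,$$ $$\theta_2:=4D\left\|\frac{\partial_{\mathrm I}v}{v}\right\|_{r,\sigma}\frac\rho\tau\le1,\qquad \theta_3:=8D\left\|\frac{\partial_{\mathrm I}\omega}{v}\right\|_{r,\sigma}\frac\rho t\le1,$$ $$\eta^2:=\max\left\{\frac Dt\left\|\frac\omega v\right\|_{r,\sigma},\ 2^7e^{2s_2}Q^2\big(|\!|\!|P|\!|\!|^w_u\big)^2\right\}<\frac1p.$$ Then, with $$u_\star=(r_\star,\sigma_\star,s_\star),\qquad r_\star:=r-8\rho,\quad \sigma_\star:=\sigma-8e^{s_2}\tau,\quad s_\star:=s-10t,$$ there exists a real-analytic change of coordinates $\Phi_\star$ such that $X_\star:=\Phi_\star X$ (that is, $X$ expressed in the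 new coordinates) belongs to $\mathcal O^3_{u_\star}$ and $X_\star=N+P_\star$, with $$|\!|\!|P_\star|\!|\!|^w_{u_\star}<2^{-(p+1)}\,|\!|\!|P|\!|\!|^w_u.$$
   Context: $\mathbb I,\mathbb Y\subset\mathbb R$ are open and connected, $\mathbb T=\mathbb R/2\pi\mathbb Z$. For $A\subset\mathbb R$ and $r>0$, $A_r=\bigcup_{x\in A}B_r(x)$ where $B_r(x)\subset\mathbb C$ is the complex ball of radius $r$ centred at $x$; $\mathbb T_s=\{\psi_1+\mathrm i\psi_2:\psi_1\in\mathbb T,\ \psi_2\in\mathbb R,\ |\psi_2|<s\}$. For $u=(r,\sigma,s)$, $\mathcal O_u$ is the set of functions $f(\mathrm I,y,\psi)$ holomorphic on $\mathbb I_r\times\mathbb Y_\sigma\times\mathbb T_s$ with finite norm $$\|f\|_u=\sum_{k\in\mathbb Z}\ \sup_{\mathbb I_r\times\mathbb Y_\sigma}|f_k(\mathrm I,y)|\,e^{|k|s},\qquad f=\sum_{k\in\mathbb Z}f_k(\mathrm I,y)e^{\mathrm ik\psi}.$$ For $\psi$-independent functions the norm is written $\|\cdot\|_{r,\sigma}$ (the sup over $\mathbb I_r\times\mathbb Y_\sigma$). $\mathcal O^3_u$ is the set of vector fields $X=(X_1,X_2,X_3)$ with $X_i\in\mathcal O_u$ (the components are along $\mathrm I,y,\psi$), and for weights $w\in\mathbb R_+^3$ the weighted norm is $|\!|\!|X|\!|\!|^w_u=\sum_{i=1}^3w_i^{-1}\|X_i\|_u$. $\mathrm{diam}$ denotes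 the diameter of a set. The function $v$ is assumed suitably far from vanishing, so that the norms of the quotients by $v$ appearing in the statement are finite.
   Formalization: The strict bound on the norm of P_* is claimed only when the norm of P is nonzero; when P = 0 it would read "norm of P_* < 0", which is impossible, so there the conclusion is that the norm of P_* is 0. *)

theory Defs
  imports "HOL-Analysis.Analysis"
begin

(* Points and tangent vectors, with coordinates (I, y, psi). The angle psi lives in C / 2 pi Z;
   throughout it is lifted to C, and functions on the complexified torus are functions on the
   strip that are 2 pi-periodic in psi. *)
type_synonym point = "complex \<times> complex \<times> complex"
type_synonym vfield = "point \<Rightarrow> point"

definition cnbhd :: "real set \<Rightarrow> real \<Rightarrow> complex set" where
  "cnbhd A r = (\<Union>x\<in>A. ball (complex_of_real x) r)"

definition strip :: "real \<Rightarrow> complex set" where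
  "strip s = {\<psi>. \<bar>Im \<psi>\<bar> < s}"

definition dom2 :: "real set \<Rightarrow> real set \<Rightarrow> real \<Rightarrow> real \<Rightarrow> (complex \<times> complex) set" where
  "dom2 I Y r \<sigma> = cnbhd I r \<times> cnbhd Y \<sigma>"

fun dom3 :: "real set \<Rightarrow> real set \<Rightarrow> real \<times> real \<times> real \<Rightarrow> point set" where
  "dom3 I Y (r, \<sigma>, s) = cnbhd I r \<times> cnbhd Y \<sigma> \<times> strip s"

(* Complex Frechet differentiability: the real derivative exists and is complex linear. *)
definition holomorphic3_on :: "(point \<Rightarrow> complex) \<Rightarrow> point set \<Rightarrow> bool" where
  "holomorphic3_on f S \<longleftrightarrow>
     (\<forall>z\<in>S. \<exists>a b c. (f has_derivative (\<lambda>(h, k, l). a * h + b * k + c * l)) (at z))"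

definition periodic3_on :: "(point \<Rightarrow> complex) \<Rightarrow> point set \<Rightarrow> bool" where
  "periodic3_on f S \<longleftrightarrow> (\<forall>(x, y, \<psi>)\<in>S. f (x, y, \<psi> + 2 * of_real pi) = f (x, y, \<psi>))"

definition fourier_coeff :: "(point \<Rightarrow> complex) \<Rightarrow> int \<Rightarrow> complex \<times> complex \<Rightarrow> complex" where
  "fourier_coeff f k = (\<lambda>(x, y). 1 / (2 * of_real pi) *
     integral {0..2 * pi} (\<lambda>t. f (x, y, of_real t) * exp (- \<i> * of_int k * of_real t)))"

(* Real-valued suprema and infinite sums are junk when infinite: finiteness is part of the
   definition of O_space, and has to be assumed separately for sup_norm. *)
definition sup_norm :: "'a set \<Rightarrow> ('a \<Rightarrow> complex) \<Rightarrow> real" where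
  "sup_norm A g = (SUP z\<in>A. cmod (g z))"

fun norm_u :: "real set \<Rightarrow> real set \<Rightarrow> real \<times> real \<times> real \<Rightarrow> (point \<Rightarrow> complex) \<Rightarrow> real" where
  "norm_u I Y (r, \<sigma>, s) f =
     (\<Sum>\<^sub>\<infinity>k\<in>UNIV. sup_norm (dom2 I Y r \<sigma>) (fourier_coeff f k) * exp (\<bar>real_of_int k\<bar> * s))"

fun O_space :: "real set \<Rightarrow> real set \<Rightarrow> real \<times> real \<times> real \<Rightarrow> (point \<Rightarrow> complex) set" where
  "O_space I Y (r, \<sigma>, s) =
     {f. holomorphic3_on f (dom3 I Y (r, \<sigma>, s)) \<and> periodic3_on f (dom3 I Y (r, \<sigma>, s)) \<and>
         (\<forall>k. bounded (fourier_coeff f k ` dom2 I Y r \<sigma>)) \<and>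
         (\<lambda>k. sup_norm (dom2 I Y r \<sigma>) (fourier_coeff f k) * exp (\<bar>real_of_int k\<bar> * s))
           summable_on UNIV}"

abbreviation comp1 :: "vfield \<Rightarrow> point \<Rightarrow> complex" where "comp1 X \<equiv> \<lambda>z. fst (X z)"
abbreviation comp2 :: "vfield \<Rightarrow> point \<Rightarrow> complex" where "comp2 X \<equiv> \<lambda>z. fst (snd (X z))"
abbreviation comp3 :: "vfield \<Rightarrow> point \<Rightarrow> complex" where "comp3 X \<equiv> \<lambda>z. snd (snd (X z))"

definition O3_space :: "real set \<Rightarrow> real set \<Rightarrow> real \<times> real \<times> real \<Rightarrow> vfield set" where
  "O3_space I Y u =
     {X. comp1 X \<in> O_space I Y u \<and> comp2 X \<in> O_space I Y u \<and> comp3 X \<in> O_space I Y u}"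

fun wnorm :: "real set \<Rightarrow> real set \<Rightarrow> real \<times> real \<times> real \<Rightarrow> real \<times> real \<times> real \<Rightarrow> vfield \<Rightarrow> real" where
  "wnorm I Y (w1, w2, w3) u X =
     inverse w1 * norm_u I Y u (comp1 X) + inverse w2 * norm_u I Y u (comp2 X)
       + inverse w3 * norm_u I Y u (comp3 X)"

(* Together with holomorphy this is real-analyticity: real points go to real points. It is used
   both for vector fields and for maps. *)
definition real_on_reals :: "(point \<Rightarrow> point) \<Rightarrow> point set \<Rightarrow> bool" where
  "real_on_reals F S \<longleftrightarrow>
     (\<forall>z\<in>S \<inter> \<real> \<times> \<real> \<times> \<real>. F z \<in> \<real> \<times> \<real> \<times> \<real>)"

definition driven_field :: "(complex \<times> complex \<Rightarrow> complex) \<Rightarrow> (complex \<times> complex \<Rightarrow> complex) \<Rightarrow> vfield" where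
  "driven_field v \<omega> = (\<lambda>(x, y, \<psi>). (0, v (x, y), \<omega> (x, y)))"

definition dI :: "(complex \<times> complex \<Rightarrow> complex) \<Rightarrow> complex \<times> complex \<Rightarrow> complex" where
  "dI g = (\<lambda>(x, y). deriv (\<lambda>x'. g (x', y)) x)"

definition dy :: "(complex \<times> complex \<Rightarrow> complex) \<Rightarrow> complex \<times> complex \<Rightarrow> complex" where
  "dy g = (\<lambda>(x, y). deriv (\<lambda>y'. g (x, y')) y)"

(* F maps new coordinates (in S) to old ones (in S'); it is the lift of a map of the quotients
   by 2 pi Z. Because of the equivariance in psi, injectivity of the lift is the same as
   injectivity of the map of the quotients. *)
definition real_analytic_coord_change :: "(point \<Rightarrow> point) \<Rightarrow> point set \<Rightarrow> point set \<Rightarrow> bool" where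
  "real_analytic_coord_change F S S' \<longleftrightarrow>
     F ` S \<subseteq> S' \<and> inj_on F S \<and>
     holomorphic3_on (comp1 F) S \<and> holomorphic3_on (comp2 F) S \<and> holomorphic3_on (comp3 F) S \<and>
     (\<forall>z\<in>S. bij (frechet_derivative F (at z))) \<and>
     real_on_reals F S \<and>
     (\<forall>(x, y, \<psi>)\<in>S. F (x, y, \<psi> + 2 * of_real pi) = F (x, y, \<psi>) + (0, 0, 2 * of_real pi))"

(* If z' = F(z) solves the equation with field X, then z solves the one with this field. *)
definition in_coords :: "(point \<Rightarrow> point) \<Rightarrow> vfield \<Rightarrow> vfield" where
  "in_coords F X = (\<lambda>z. inv (frechet_derivative F (at z)) (X (F z)))"

end

(*
There is no obstruction to straightening X completely: a conjugacy of N to X exists with P_* = 0.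
Along a characteristic of N, parametrised by y, the conjugacy Phi solves
  d Phi / dy = X(Phi) / v(I, y),   Phi = identity at y = y0,
an ordinary differential equation over the convex set Y_sigma, whose diameter is D. In coordinates
(I, y, psi0), where psi0 = psi - int_{y0}^{y} omega / v labels the characteristic, Picard iteration
along segments issuing from y0 converges to a holomorphic solution Psi, and Phi is Psi composed with
the shear psi -> psi0. Since |P_i| <= w_i |||P||| on the complex domain (sum the Fourier series), the
smallness hypotheses keep Psi - id below (rho/32, tau/2, 3t/2): the bound on d_y v / v allows for a
growth of order exp(s2) of the displacement in y, and D |omega / v| < t bounds the drift in psi, so no small
divisors occur. Cauchy estimates on the smaller domain then make Psi - id a contraction, whence
injectivity and invertibility of the derivative.
*)
theory Submission
  imports Defs "HOL-Complex_Analysis.Complex_Analysis"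
begin

section \<open>Separately holomorphic functions\<close>

text \<open>Two obstacles shape the construction. As y is complex, the equation for Phi runs in
  complex time; it makes sense because neighbourhoods of intervals are convex, so that segment
  integrals from \<open>y0\<close> are primitives. And the Picard iterates must stay where X is
  defined, although the displacement in y feeds back into itself through the variation of v. A
  uniform bound on it need not survive one step when s2 is large; a bound growing with |y - y0| like
  the solution of b' = \<mu> b + \<nu>, b(0) = 0, does survive, and the smallness hypotheses keep
  this solution below \<tau> / 2 up to distance D. The conjugacy has two factors. Psi carries the
  field (0, v, 0) to X, since v times its y-derivative is X(Psi). The shear carries N to (0, v, 0),
  since psi - int omega / v is a first integral of N. In the estimates the Fourier norm enters only
  through the sup bounds that it implies; these require that the Fourier series represents the
  function on the whole complex strip.\<close>

lemma deriv_bound_ball: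
  assumes "g holomorphic_on ball x R" "\<And>z. z \<in> ball x R \<Longrightarrow> cmod (g z) \<le> B" "0 < R"
  shows "cmod (deriv g x) \<le> B / R"
proof -
  \<comment> \<open>Cauchy's inequality asks for continuity on a closed disc, whereas g is only
    controlled on the open ball; hence smaller radii first, and then \<rho> tends to R.\<close>
  have *: "cmod (deriv g x) * \<rho> \<le> B" if "0 < \<rho>" "\<rho> < R" for \<rho>
  proof -
    have "cmod ((deriv ^^ 1) g x) \<le> fact 1 * B / \<rho> ^ 1"
    proof (rule Cauchy_inequality)
      show "g holomorphic_on ball x \<rho>"
        by (rule holomorphic_on_subset[OF assms(1)]) (use that in \<open>auto simp: subset_ball\<close>)
      show "continuous_on (cball x \<rho>) g"
        by (rule holomorphic_on_imp_continuous_on[OF holomorphic_on_subset[OF assms(1)]]) (use that in auto)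
      show "\<And>z. cmod (x - z) = \<rho> \<Longrightarrow> cmod (g z) \<le> B"
        using assms(2) that by (auto simp: dist_norm)
    qed (use that in auto)
    then show ?thesis using that by (simp add: field_simps)
  qed
  have "cmod (deriv g x) * R \<le> B"
  proof (rule ccontr)
    assume neg: "\<not> ?thesis"
    have B: "B \<ge> 0" using order_trans[OF norm_ge_zero assms(2)[of x]] assms(3) by simp
    then have d: "cmod (deriv g x) > 0" using neg assms(3) by (smt (verit) mult_eq_0_iff norm_ge_zero)
    then have "B / cmod (deriv g x) < R" using neg by (simp add: field_simps)
    then obtain \<rho> where "B / cmod (deriv g x) < \<rho>" "\<rho> < R" using dense by blast
    moreover have "0 < \<rho>" using calculation B d by (smt (verit) divide_nonneg_pos)
    ultimately show False using *[of \<rho>] d by (simp add: field_simps)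
  qed
  then show ?thesis using assms(3) by (simp add: field_simps)
qed

text \<open>Cauchy's estimate is applied to the difference of translates f(z + a, p) - f(z, p0): it
  is uniformly small on a disc by compactness, so its derivative at the centre is small as
  well.\<close>

lemma continuous_on_deriv_param:
  fixes f :: "complex \<Rightarrow> 'b::metric_space \<Rightarrow> complex"
  assumes S: "open S" and cont: "continuous_on S (\<lambda>(x, p). f x p)"
    and hol: "\<And>x p. (x, p) \<in> S \<Longrightarrow> (\<lambda>x. f x p) field_differentiable (at x)"
  shows "continuous_on S (\<lambda>(x, p). deriv (\<lambda>x. f x p) x)"
  unfolding continuous_on_iff
proof (safe)
  fix x0 :: complex and p0 :: 'b and e :: real
  assume z0: "(x0, p0) \<in> S" and e: "e > 0"
  obtain U V where UV: "open U" "open V" "x0 \<in> U" "p0 \<in> V" "U \<times> V \<subseteq> S"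
    using S z0 by (metis mem_Sigma_iff open_prod_elim)
  obtain r where r: "r > 0" "cball x0 (2 * r) \<subseteq> U"
  proof -
    obtain r where "r > 0" "cball x0 r \<subseteq> U" using UV open_contains_cball by blast
    then show ?thesis using that[of "r / 2"] by auto
  qed
  have sub: "ball x0 (2 * r) \<times> V \<subseteq> S" using r UV by (auto simp: subset_eq)
  \<comment> \<open>The bound e * r / 2 becomes e / 2 after Cauchy's estimate with radius r.
    Uniformity in z comes from compactness of the closed disc; the margin between r and 2 * r
    absorbs the translation by a.\<close>
  have ev: "\<exists>d>0. d \<le> r \<and> ball p0 d \<subseteq> V \<and> (\<forall>z\<in>cball x0 r. \<forall>a p. cmod a < d \<longrightarrow> dist p p0 < d \<longrightarrow> cmod (f (z + a) p - f z p0) < e * r / 2)"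
  proof -
    define W where "W = ball (0::complex) r \<times> V"
    have W: "open W" "(0, p0) \<in> W" using UV r by (auto simp: W_def open_Times)
    have c: "continuous_on (W \<times> cball x0 r) (\<lambda>(w, z). cmod (f (z + fst w) (snd w) - f z p0))"
    proof -
      have 1: "continuous_on (W \<times> cball x0 r) (\<lambda>t. (\<lambda>(x,p). f x p) (snd t + fst (fst t), snd (fst t)))"
      proof (rule continuous_on_compose2[OF cont])
        show "(\<lambda>t. (snd t + fst (fst t), snd (fst t))) ` (W \<times> cball x0 r) \<subseteq> S"
        proof safe
          fix a p z assume w: "(a, p) \<in> W" and z: "z \<in> cball x0 r"
          have "dist x0 (z + a) \<le> dist x0 z + norm a" by (smt (verit) dist_norm dist_triangle norm_minus_commute add_diff_cancel_left')
          then have "z + a \<in> ball x0 (2*r)" using w z by (auto simp: W_def)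
          then show "(snd ((a,p), z) + fst (fst ((a,p),z)), snd (fst ((a,p),z))) \<in> S" using w sub by (auto simp: W_def)
        qed
      qed (intro continuous_intros)
      have 2: "continuous_on (W \<times> cball x0 r) (\<lambda>t. (\<lambda>(x,p). f x p) (snd t, p0))"
      proof (rule continuous_on_compose2[OF cont])
        show "(\<lambda>t. (snd t, p0)) ` (W \<times> cball x0 r) \<subseteq> S" using r UV by (auto simp: subset_eq)
      qed (intro continuous_intros)
      show ?thesis using continuous_on_norm[OF continuous_on_diff[OF 1 2]] by (simp add: case_prod_unfold)
    qed
    obtain X where X: "(0, p0) \<in> X" "open X" "\<forall>w\<in>X \<inter> W. \<forall>z\<in>cball x0 r. cmod (f (z + fst w) (snd w) - f z p0) \<le> e * r / 3"
    proof -
      have er: "e * r / 3 > 0" using e r by simp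
      from continuous_on_prod_compactE[OF c compact_cball W(2) er]
      obtain X where X: "(0, p0) \<in> X" "open X"
        "\<forall>w\<in>X \<inter> W. \<forall>z\<in>cball x0 r.
           dist (case (w, z) of (w, z) \<Rightarrow> cmod (f (z + fst w) (snd w) - f z p0))
            (case ((0, p0), z) of (w, z) \<Rightarrow> cmod (f (z + fst w) (snd w) - f z p0)) \<le> e * r / 3"
        by blast
      show ?thesis
      proof (rule that[OF X(1,2)], intro ballI)
        fix w z assume "w \<in> X \<inter> W" "z \<in> cball x0 r"
        then show "cmod (f (z + fst w) (snd w) - f z p0) \<le> e * r / 3" using bspec[OF bspec[OF X(3)], of w z]
          by (simp add: dist_real_def del: mem_cball)
      qed
    qed
    have lt: "e * r / 3 < e * r / 2" using e r by simp
    obtain d where d: "d > 0" "ball (0,p0) d \<subseteq> X \<inter> W" using X W open_contains_ball[of "X \<inter> W"] by (meson IntI open_Int)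
    obtain d1 where d1: "d1 > 0" "ball p0 d1 \<subseteq> V" using UV open_contains_ball by blast
    define d' where "d' = Min {d / 2, r, d1}"
    have d': "d' > 0" "d' \<le> r" "d' \<le> d / 2" "d' \<le> d1" using d d1 r by (auto simp: d'_def)
    have "(a, p) \<in> X \<inter> W" if "cmod a < d'" "dist p p0 < d'" for a p
    proof -
      have "dist (0, p0) (a, p) \<le> dist 0 a + dist p0 p" by (auto simp: dist_Pair_Pair sqrt_sum_squares_le_sum)
      also have "\<dots> < d" using that d' by (simp add: dist_commute)
      finally show ?thesis using d by auto
    qed
    then have "cmod (f (z + a) p - f z p0) < e * r / 2" if "z \<in> cball x0 r" "cmod a < d'" "dist p p0 < d'" for z a p
      using bspec[OF bspec[OF X(3)], of "(a, p)" z] that lt by (simp del: mem_cball)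
    moreover have "ball p0 d' \<subseteq> V" using d1 d' by (meson order_trans subset_ball)
    ultimately show ?thesis using d' by blast
  qed
  then obtain d where d: "d > 0" "d \<le> r" "ball p0 d \<subseteq> V"
    "\<And>z a p. z \<in> cball x0 r \<Longrightarrow> cmod a < d \<Longrightarrow> dist p p0 < d \<Longrightarrow> cmod (f (z + a) p - f z p0) < e * r / 2" by blast
  show "\<exists>d>0. \<forall>x'\<in>S. dist x' (x0, p0) < d \<longrightarrow> dist (case x' of (x, p) \<Rightarrow> deriv (\<lambda>x. f x p) x) (deriv (\<lambda>x. f x p0) x0) < e"
  proof (intro exI conjI ballI impI)
    show "d > 0" by fact
    fix w assume w: "w \<in> S" "dist w (x0, p0) < d"
    obtain x p where xp: "w = (x, p)" by force
    define a where "a = x - x0"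
    have ap: "cmod a < d" "dist p p0 < d"
      using w xp dist_fst_le[of w "(x0,p0)"] dist_snd_le[of w "(x0,p0)"] by (auto simp: a_def dist_norm)
    have in1: "(z + a, p) \<in> S" if "z \<in> ball x0 r" for z
    proof -
      have "dist x0 (z + a) \<le> dist x0 z + norm a" by (smt (verit) dist_norm dist_triangle norm_minus_commute add_diff_cancel_left')
      then have "z + a \<in> ball x0 (2*r)" using that ap d by auto
      then show ?thesis using sub ap d by (auto simp: dist_commute subset_eq)
    qed
    have in2: "(z, p0) \<in> S" if "z \<in> ball x0 r" for z
    proof -
      have "z \<in> ball x0 (2 * r)" using that r(1) by (auto simp del: subset_eq)
      then show ?thesis using sub UV(4) by blast
    qed
    have fd1: "(\<lambda>z. f (z + a) p) field_differentiable (at z)" if "z \<in> ball x0 r" for z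
    proof -
      have "((\<lambda>x. f x p) has_field_derivative deriv (\<lambda>x. f x p) (z + a)) (at (z + a))"
        using hol[OF in1[OF that]] by (simp add: DERIV_deriv_iff_field_differentiable)
      then have "((\<lambda>z. f (z + a) p) has_field_derivative deriv (\<lambda>x. f x p) (z + a)) (at z)"
        by (simp add: DERIV_shift)
      then show ?thesis by (auto simp: field_differentiable_def)
    qed
    have fd2: "(\<lambda>z. f z p0) field_differentiable (at z)" if "z \<in> ball x0 r" for z
      using hol in2 that by blast
    let ?g = "\<lambda>z. f (z + a) p - f z p0"
    have "?g holomorphic_on ball x0 r"
      unfolding holomorphic_on_def
      by (rule ballI, rule field_differentiable_at_within, intro field_differentiable_diff fd1 fd2)
    then have "cmod (deriv ?g x0) \<le> e * r / 2 / r"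
    proof (rule deriv_bound_ball)
      show "cmod (?g z) \<le> e * r / 2" if "z \<in> ball x0 r" for z
        using d(4)[of z a p] that ap by auto
    qed (use r in auto)
    also have "\<dots> = e / 2" using r by simp
    also have "deriv ?g x0 = deriv (\<lambda>z. f (z + a) p) x0 - deriv (\<lambda>z. f z p0) x0"
      using r by (intro deriv_diff fd1 fd2) auto
    also have "deriv (\<lambda>z. f (z + a) p) x0 = deriv (\<lambda>x. f x p) x"
    proof -
      have "((\<lambda>x. f x p) has_field_derivative deriv (\<lambda>x. f x p) x) (at (x0 + a))"
        using hol w xp by (auto simp: a_def DERIV_deriv_iff_field_differentiable)
      then have "((\<lambda>z. f (z + a) p) has_field_derivative deriv (\<lambda>x. f x p) x) (at x0)"
        by (simp add: DERIV_shift)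
      then show ?thesis by (rule DERIV_imp_deriv)
    qed
    finally have "cmod (deriv (\<lambda>x. f x p) x - deriv (\<lambda>z. f z p0) x0) \<le> e / 2" .
    then show "dist (case w of (x, p) \<Rightarrow> deriv (\<lambda>x. f x p) x) (deriv (\<lambda>x. f x p0) x0) < e"
      using e xp by (simp add: dist_norm)
  qed
qed

text \<open>Mean value inequality for f(-, p) minus its linear part frozen at (x0, p0), with the
  continuity of the partial derivative. The uniformity in p is the point: in a telescoped increment
  the other variables have already moved.\<close>

lemma partial_increment:
  fixes f :: "complex \<Rightarrow> 'b::metric_space \<Rightarrow> complex"
  assumes S: "open S" and cont: "continuous_on S (\<lambda>(x, p). f x p)"
    and hol: "\<And>x p. (x, p) \<in> S \<Longrightarrow> (\<lambda>x. f x p) field_differentiable (at x)"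
    and z0: "(x0, p0) \<in> S" and e: "e > 0"
  shows "\<exists>d>0. \<forall>x p. cmod (x - x0) < d \<longrightarrow> dist p p0 < d \<longrightarrow>
           cmod (f x p - f x0 p - deriv (\<lambda>x. f x p0) x0 * (x - x0)) \<le> e * cmod (x - x0)"
proof -
  let ?D = "\<lambda>(x, p). deriv (\<lambda>x. f x p) x"
  have "continuous_on S ?D" by (rule continuous_on_deriv_param[OF S cont hol])
  then obtain d0 where d0: "d0 > 0" "\<And>z. z \<in> S \<Longrightarrow> dist z (x0,p0) < d0 \<Longrightarrow> dist (?D z) (?D (x0,p0)) < e"
    using z0 e unfolding continuous_on_iff by meson
  obtain d1 where d1: "d1 > 0" "ball (x0,p0) d1 \<subseteq> S" using S z0 open_contains_ball by blast
  define d where "d = min d0 d1 / 2"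
  have d: "d > 0" using d0 d1 by (auto simp: d_def)
  have near: "(x,p) \<in> S \<and> cmod (?D (x,p) - ?D (x0,p0)) < e" if "cmod (x - x0) < d" "dist p p0 < d" for x p
  proof -
    have "dist (x,p) (x0, p0) \<le> dist x x0 + dist p p0" by (auto simp: dist_Pair_Pair sqrt_sum_squares_le_sum)
    then have "dist (x,p) (x0, p0) < min d0 d1" using that by (auto simp: d_def dist_norm)
    moreover from this have "(x,p) \<in> S" using d1 by (auto simp: dist_commute)
    ultimately show ?thesis using d0(2)[of "(x,p)"] by (simp add: dist_norm)
  qed
  show ?thesis
  proof (intro exI[of _ d] conjI allI impI d)
    fix x p assume xp: "cmod (x - x0) < d" "dist p p0 < d"
    let ?h = "\<lambda>x. f x p - deriv (\<lambda>x. f x p0) x0 * x"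
    have "cmod (?h x - ?h x0) \<le> e * cmod (x - x0)"
    proof (rule field_differentiable_bound[of "ball x0 d"])
      fix z assume z: "z \<in> ball x0 d"
      then have n: "(z,p) \<in> S" "cmod (?D (z,p) - ?D (x0,p0)) < e" using near[of z p] xp by (auto simp: dist_norm norm_minus_commute)
      show "(?h has_field_derivative (?D (z,p) - ?D (x0,p0))) (at z within ball x0 d)"
      proof (rule has_field_derivative_at_within)
        have "((\<lambda>x. f x p) has_field_derivative deriv (\<lambda>x. f x p) z) (at z)"
          using hol[OF n(1)] by (simp add: DERIV_deriv_iff_field_differentiable)
        from DERIV_diff[OF this DERIV_cmult[OF DERIV_ident, of "deriv (\<lambda>x. f x p0) x0"]]
        show "(?h has_field_derivative (?D (z,p) - ?D (x0,p0))) (at z)" by simp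
      qed
      show "cmod (?D (z,p) - ?D (x0,p0)) \<le> e" using n by simp
    qed (use d xp in \<open>auto simp: dist_norm norm_minus_commute\<close>)
    then show "cmod (f x p - f x0 p - deriv (\<lambda>x. f x p0) x0 * (x - x0)) \<le> e * cmod (x - x0)"
      by (simp add: algebra_simps)
  qed
qed

definition pd1 :: "(point \<Rightarrow> complex) \<Rightarrow> point \<Rightarrow> complex" where
  "pd1 f = (\<lambda>(x, y, q). deriv (\<lambda>x. f (x, y, q)) x)"
definition pd2 :: "(point \<Rightarrow> complex) \<Rightarrow> point \<Rightarrow> complex" where
  "pd2 f = (\<lambda>(x, y, q). deriv (\<lambda>y. f (x, y, q)) y)"
definition pd3 :: "(point \<Rightarrow> complex) \<Rightarrow> point \<Rightarrow> complex" where
  "pd3 f = (\<lambda>(x, y, q). deriv (\<lambda>q. f (x, y, q)) q)"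

text \<open>Permuting the coordinates brings y, and below q, into the first slot, where
  \<open>partial_increment\<close> applies to it.\<close>

lemma open_swap1: "open S \<Longrightarrow> open {(y, x, q). (x, y, q) \<in> (S :: point set)}"
proof -
  assume "open S"
  moreover have "continuous_on UNIV (\<lambda>t::point. (fst (snd t), fst t, snd (snd t)))" by (intro continuous_intros)
  ultimately have "open ((\<lambda>t::point. (fst (snd t), fst t, snd (snd t))) -` S)" by (simp add: open_vimage)
  then show ?thesis by (simp add: vimage_def case_prod_unfold)
qed

lemma open_swap2: "open S \<Longrightarrow> open {(q, x, y). (x, y, q) \<in> (S :: point set)}"
proof -
  assume "open S"
  moreover have "continuous_on UNIV (\<lambda>t::point. (fst (snd t), snd (snd t), fst t))" by (intro continuous_intros)
  ultimately have "open ((\<lambda>t::point. (fst (snd t), snd (snd t), fst t)) -` S)" by (simp add: open_vimage)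
  then show ?thesis by (simp add: vimage_def case_prod_unfold)
qed

lemma cont_swap1:
  assumes "continuous_on S (f :: point \<Rightarrow> complex)"
  shows "continuous_on {(y, x, q). (x, y, q) \<in> S} (\<lambda>(y, p). f (fst p, y, snd p))"
proof -
  have "continuous_on {(y, x, q). (x, y, q) \<in> S} (\<lambda>t. f (fst (snd t), fst t, snd (snd t)))"
    by (rule continuous_on_compose2[OF assms]) (auto intro!: continuous_intros)
  then show ?thesis by (simp add: case_prod_unfold)
qed

lemma cont_swap2:
  assumes "continuous_on S (f :: point \<Rightarrow> complex)"
  shows "continuous_on {(q, x, y). (x, y, q) \<in> S} (\<lambda>(q, p). f (fst p, snd p, q))"
proof -
  have "continuous_on {(q, x, y). (x, y, q) \<in> S} (\<lambda>t. f (fst (snd t), snd (snd t), fst t))"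
    by (rule continuous_on_compose2[OF assms]) (auto intro!: continuous_intros)
  then show ?thesis by (simp add: case_prod_unfold)
qed

definition sep_hol :: "(point \<Rightarrow> complex) \<Rightarrow> point set \<Rightarrow> bool" where
  "sep_hol f S \<longleftrightarrow> (\<forall>(x, y, q)\<in>S.
     (\<lambda>x. f (x, y, q)) field_differentiable (at x) \<and>
     (\<lambda>y. f (x, y, q)) field_differentiable (at y) \<and>
     (\<lambda>q. f (x, y, q)) field_differentiable (at q))"

text \<open>The increment is split into three legs parallel to the axes, each estimated by
  \<open>partial_increment\<close> uniformly in the remaining variables. Sums, quotients, primitives
  and uniform limits are later shown to be holomorphic through this criterion.\<close>

theorem Osgood:
  assumes S: "open S" and cont: "continuous_on S f" and sep: "sep_hol f S"
  shows "holomorphic3_on f S"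
  unfolding holomorphic3_on_def
proof safe
  fix x0 y0 q0 assume z0: "(x0, y0, q0) \<in> S"
  let ?a = "pd1 f (x0,y0,q0)" and ?b = "pd2 f (x0,y0,q0)" and ?c = "pd3 f (x0,y0,q0)"
  let ?D = "\<lambda>(h, k, l). ?a * h + ?b * k + ?c * l"
  have bl: "bounded_linear ?D"
    unfolding case_prod_unfold
    by (intro bounded_linear_add bounded_linear_const_mult bounded_linear_fst bounded_linear_fst_comp bounded_linear_snd_comp bounded_linear_ident)
  have "(f has_derivative ?D) (at (x0,y0,q0))"
    unfolding has_derivative_at_alt
  proof (intro conjI bl allI impI)
    fix e :: real assume e: "e > 0"
    then have e3: "e / 3 > 0" by simp
    obtain d1 where d1: "d1 > 0" "\<And>x p. cmod (x - x0) < d1 \<Longrightarrow> dist p (y0,q0) < d1 \<Longrightarrow>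
           cmod (f (x, p) - f (x0, p) - ?a * (x - x0)) \<le> e/3 * cmod (x - x0)"
      using partial_increment[of S "\<lambda>x p. f (x, p)" x0 "(y0,q0)" "e/3"] S cont sep z0 e3
      by (fastforce simp: sep_hol_def pd1_def)
    obtain d2 where d2: "d2 > 0" "\<And>y p. cmod (y - y0) < d2 \<Longrightarrow> dist p (x0,q0) < d2 \<Longrightarrow>
           cmod (f (fst p, y, snd p) - f (fst p, y0, snd p) - ?b * (y - y0)) \<le> e/3 * cmod (y - y0)"
      using partial_increment[of _ "\<lambda>y p. f (fst p, y, snd p)" y0 "(x0,q0)" "e/3", OF open_swap1[OF S] cont_swap1[OF cont]] sep z0 e3
      by (fastforce simp: sep_hol_def pd2_def)
    obtain d3 where d3: "d3 > 0" "\<And>q p. cmod (q - q0) < d3 \<Longrightarrow> dist p (x0,y0) < d3 \<Longrightarrow>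
           cmod (f (fst p, snd p, q) - f (fst p, snd p, q0) - ?c * (q - q0)) \<le> e/3 * cmod (q - q0)"
      using partial_increment[of _ "\<lambda>q p. f (fst p, snd p, q)" q0 "(x0,y0)" "e/3", OF open_swap2[OF S] cont_swap2[OF cont]] sep z0 e3
      by (fastforce simp: sep_hol_def pd3_def)
    define d where "d = min d1 (min d2 d3)"
    have d: "d > 0" "d \<le> d1" "d \<le> d2" "d \<le> d3" using d1 d2 d3 by (auto simp: d_def)
    show "\<exists>d>0. \<forall>w. norm (w - (x0,y0,q0)) < d \<longrightarrow> norm (f w - f (x0,y0,q0) - ?D (w - (x0,y0,q0))) \<le> e * norm (w - (x0,y0,q0))"
    proof (intro exI[of _ d] conjI allI impI d)
      fix w :: point assume w: "norm (w - (x0,y0,q0)) < d"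
      obtain x y q where xyq: "w = (x,y,q)" by (metis prod_cases3)
      let ?n = "norm (w - (x0,y0,q0))"
      have n: "?n = norm (x - x0, (y - y0, q - q0))" by (simp add: xyq)
      have n1: "cmod (x - x0) \<le> ?n" unfolding n by (rule norm_fst_le)
      have n23: "norm (y - y0, q - q0) \<le> ?n" unfolding n by (rule norm_snd_le)
      have n2: "cmod (y - y0) \<le> ?n" using n23 norm_fst_le[of "y - y0" "q - q0"] by simp
      have n3: "cmod (q - q0) \<le> ?n" using n23 norm_snd_le[of "q - q0" "y - y0"] by simp
      have i1: "cmod (f (x,y,q) - f (x0,y,q) - ?a * (x - x0)) \<le> e/3 * cmod (x - x0)"
        using d1(2)[of x "(y,q)"] n1 n23 w d by (auto simp: dist_norm)
      have i2: "cmod (f (x0,y,q) - f (x0,y0,q) - ?b * (y - y0)) \<le> e/3 * cmod (y - y0)"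
        using d2(2)[of y "(x0,q)"] n2 n3 w d by (auto simp: dist_norm dist_Pair_Pair norm_Pair norm_minus_commute)
      have i3: "cmod (f (x0,y0,q) - f (x0,y0,q0) - ?c * (q - q0)) \<le> e/3 * cmod (q - q0)"
        using d3(2)[of q "(x0,y0)"] n3 w d by (auto simp: dist_norm dist_Pair_Pair)
      have eq: "f w - f (x0,y0,q0) - ?D (w - (x0,y0,q0)) =
          (f (x,y,q) - f (x0,y,q) - ?a * (x - x0)) + (f (x0,y,q) - f (x0,y0,q) - ?b * (y - y0)) + (f (x0,y0,q) - f (x0,y0,q0) - ?c * (q - q0))"
        by (simp add: xyq)
      have "norm (f w - f (x0,y0,q0) - ?D (w - (x0,y0,q0))) \<le> e/3 * cmod (x - x0) + e/3 * cmod (y - y0) + e/3 * cmod (q - q0)"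
        unfolding eq by (intro norm_triangle_le add_mono i1 i2 i3)
      also have "\<dots> = e/3 * (cmod (x - x0) + cmod (y - y0) + cmod (q - q0))" by (simp add: algebra_simps)
      also have "\<dots> \<le> e/3 * (3 * ?n)" using e n1 n2 n3 by (intro mult_left_mono) auto
      finally show "norm (f w - f (x0,y0,q0) - ?D (w - (x0,y0,q0))) \<le> e * ?n" by simp
    qed
  qed
  then show "\<exists>a b c. (f has_derivative (\<lambda>(h, k, l). a * h + b * k + c * l)) (at (x0,y0,q0))" by blast
qed

section \<open>Calculus of holomorphic functions of three variables\<close>

lemma holomorphic_onI_DERIV:
  "(\<And>z. z \<in> S \<Longrightarrow> (f has_field_derivative f' z) (at z)) \<Longrightarrow> f holomorphic_on S"
  unfolding holomorphic_on_def by (meson field_differentiable_at_within field_differentiable_def)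

lemma has_derivative_complex_linear:
  assumes "(f has_derivative (\<lambda>(h, k, l). a * h + b * k + c * l)) (at (x, y, q))"
  shows "((\<lambda>x. f (x, y, q)) has_field_derivative a) (at x)"
    "((\<lambda>y. f (x, y, q)) has_field_derivative b) (at y)"
    "((\<lambda>q. f (x, y, q)) has_field_derivative c) (at q)"
proof -
  have "((\<lambda>x. f (x, y, q)) has_derivative (\<lambda>h. (\<lambda>(h, k, l). a * h + b * k + c * l) (h, 0, 0))) (at x)"
    by (rule has_derivative_compose[of "\<lambda>x. (x, y, q)", where g = f]) (use assms in \<open>auto intro!: derivative_eq_intros simp: zero_prod_def\<close>)
  then show "((\<lambda>x. f (x, y, q)) has_field_derivative a) (at x)"
    by (simp add: has_field_derivative_def)
  have "((\<lambda>y. f (x, y, q)) has_derivative (\<lambda>h. (\<lambda>(h, k, l). a * h + b * k + c * l) (0, h, 0))) (at y)"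
    by (rule has_derivative_compose[of "\<lambda>y. (x, y, q)", where g = f]) (use assms in \<open>auto intro!: derivative_eq_intros simp: zero_prod_def\<close>)
  then show "((\<lambda>y. f (x, y, q)) has_field_derivative b) (at y)"
    by (simp add: has_field_derivative_def)
  have "((\<lambda>q. f (x, y, q)) has_derivative (\<lambda>h. (\<lambda>(h, k, l). a * h + b * k + c * l) (0, 0, h))) (at q)"
    by (rule has_derivative_compose[of "\<lambda>q. (x, y, q)", where g = f]) (use assms in \<open>auto intro!: derivative_eq_intros simp: zero_prod_def\<close>)
  then show "((\<lambda>q. f (x, y, q)) has_field_derivative c) (at q)"
    by (simp add: has_field_derivative_def)
qed

lemma hol3_has_derivative:
  assumes "holomorphic3_on f S" "(x, y, q) \<in> S"
  shows "(f has_derivative (\<lambda>(h, k, l). pd1 f (x, y, q) * h + pd2 f (x, y, q) * k + pd3 f (x, y, q) * l)) (at (x, y, q))"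
proof -
  obtain a b c where *: "(f has_derivative (\<lambda>(h, k, l). a * h + b * k + c * l)) (at (x, y, q))"
    using assms unfolding holomorphic3_on_def by blast
  have "pd1 f (x, y, q) = a" "pd2 f (x, y, q) = b" "pd3 f (x, y, q) = c"
    using has_derivative_complex_linear[OF *, THEN DERIV_imp_deriv] by (simp_all add: pd1_def pd2_def pd3_def)
  then show ?thesis using * by simp
qed

lemmas hol3_partials = has_derivative_complex_linear[OF hol3_has_derivative]

lemma hol3_continuous: "holomorphic3_on f S \<Longrightarrow> continuous_on S f"
  unfolding holomorphic3_on_def
  by (meson continuous_at_imp_continuous_on has_derivative_continuous)

lemma hol3_sep: "holomorphic3_on f S \<Longrightarrow> sep_hol f S"
  unfolding sep_hol_def using hol3_partials by (fastforce simp: field_differentiable_def)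

lemma hol3_subset: "holomorphic3_on f S \<Longrightarrow> T \<subseteq> S \<Longrightarrow> holomorphic3_on f T"
  unfolding holomorphic3_on_def by blast

lemma hol3_cong:
  assumes "holomorphic3_on f S" "open S" "\<And>z. z \<in> S \<Longrightarrow> f z = g z"
  shows "holomorphic3_on g S"
  unfolding holomorphic3_on_def
proof
  fix z assume z: "z \<in> S"
  then obtain a b c where *: "(f has_derivative (\<lambda>(h, k, l). a * h + b * k + c * l)) (at z)"
    using assms unfolding holomorphic3_on_def by blast
  then have "(g has_derivative (\<lambda>(h, k, l). a * h + b * k + c * l)) (at z)"
    by (rule has_derivative_transform_within_open[OF _ assms(2) z assms(3)])
  then show "\<exists>a b c. (g has_derivative (\<lambda>(h, k, l). a * h + b * k + c * l)) (at z)" by blast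
qed

lemma hol3_const: "open S \<Longrightarrow> holomorphic3_on (\<lambda>_. c) S"
  by (rule Osgood) (auto simp: sep_hol_def)

lemma hol3_coords:
  assumes "open S"
  shows "holomorphic3_on (\<lambda>z. fst z) S" "holomorphic3_on (\<lambda>z. fst (snd z)) S" "holomorphic3_on (\<lambda>z. snd (snd z)) S"
  by (rule Osgood; use assms in \<open>auto simp: sep_hol_def intro!: continuous_intros\<close>)+

lemma hol3_add:
  assumes S: "open S" and fg: "holomorphic3_on f S" "holomorphic3_on g S"
  shows "holomorphic3_on (\<lambda>z. f z + g z) S"
proof (rule Osgood[OF S])
  show "continuous_on S (\<lambda>z. f z + g z)" by (intro continuous_intros fg[THEN hol3_continuous])
  show "sep_hol (\<lambda>z. f z + g z) S"
    using fg[THEN hol3_sep] unfolding sep_hol_def by (fast intro: field_differentiable_add)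
qed

lemma hol3_diff:
  assumes S: "open S" and fg: "holomorphic3_on f S" "holomorphic3_on g S"
  shows "holomorphic3_on (\<lambda>z. f z - g z) S"
proof (rule Osgood[OF S])
  show "continuous_on S (\<lambda>z. f z - g z)" by (intro continuous_intros fg[THEN hol3_continuous])
  show "sep_hol (\<lambda>z. f z - g z) S"
    using fg[THEN hol3_sep] unfolding sep_hol_def by (fast intro: field_differentiable_diff)
qed

lemma hol3_divide:
  assumes S: "open S" and fg: "holomorphic3_on f S" "holomorphic3_on g S" and nz: "\<And>z. z \<in> S \<Longrightarrow> g z \<noteq> 0"
  shows "holomorphic3_on (\<lambda>z. f z / g z) S"
proof (rule Osgood[OF S])
  show "continuous_on S (\<lambda>z. f z / g z)" by (intro continuous_intros fg[THEN hol3_continuous]) (use nz in auto)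
  show "sep_hol (\<lambda>z. f z / g z) S"
    using fg[THEN hol3_sep] nz unfolding sep_hol_def by (fast intro: field_differentiable_divide)
qed

lemma hol3_compose:
  assumes f: "holomorphic3_on f T" and g: "holomorphic3_on g1 S" "holomorphic3_on g2 S" "holomorphic3_on g3 S"
    and sub: "\<And>z. z \<in> S \<Longrightarrow> (g1 z, g2 z, g3 z) \<in> T"
  shows "holomorphic3_on (\<lambda>z. f (g1 z, g2 z, g3 z)) S"
  unfolding holomorphic3_on_def
proof
  fix z assume z: "z \<in> S"
  obtain a b c where f': "(f has_derivative (\<lambda>(h, k, l). a * h + b * k + c * l)) (at (g1 z, g2 z, g3 z))"
    using f sub[OF z] unfolding holomorphic3_on_def by blast
  obtain a1 b1 c1 where 1: "(g1 has_derivative (\<lambda>(h, k, l). a1 * h + b1 * k + c1 * l)) (at z)"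
    using g(1) z unfolding holomorphic3_on_def by blast
  obtain a2 b2 c2 where 2: "(g2 has_derivative (\<lambda>(h, k, l). a2 * h + b2 * k + c2 * l)) (at z)"
    using g(2) z unfolding holomorphic3_on_def by blast
  obtain a3 b3 c3 where 3: "(g3 has_derivative (\<lambda>(h, k, l). a3 * h + b3 * k + c3 * l)) (at z)"
    using g(3) z unfolding holomorphic3_on_def by blast
  have "((\<lambda>z. f (g1 z, g2 z, g3 z)) has_derivative (\<lambda>w. (\<lambda>(h, k, l). a * h + b * k + c * l)
      ((\<lambda>(h, k, l). a1 * h + b1 * k + c1 * l) w, (\<lambda>(h, k, l). a2 * h + b2 * k + c2 * l) w, (\<lambda>(h, k, l). a3 * h + b3 * k + c3 * l) w))) (at z)"
    by (rule has_derivative_compose[where g = f, OF has_derivative_Pair[OF 1 has_derivative_Pair[OF 2 3]] f'])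
  then have "((\<lambda>z. f (g1 z, g2 z, g3 z)) has_derivative
      (\<lambda>(h, k, l). (a * a1 + b * a2 + c * a3) * h + (a * b1 + b * b2 + c * b3) * k + (a * c1 + b * c2 + c * c3) * l)) (at z)"
    by (rule has_derivative_eq_rhs) (auto simp: fun_eq_iff algebra_simps)
  then show "\<exists>a b c. ((\<lambda>z. f (g1 z, g2 z, g3 z)) has_derivative (\<lambda>(h, k, l). a * h + b * k + c * l)) (at z)" by blast
qed

lemma cont_pd1:
  assumes "open S" "holomorphic3_on f S"
  shows "continuous_on S (pd1 f)"
proof -
  have "continuous_on S (\<lambda>(x, p). deriv (\<lambda>x. f (x, p)) x)"
    by (rule continuous_on_deriv_param[OF assms(1)])
      (use hol3_continuous[OF assms(2)] hol3_sep[OF assms(2)] in \<open>auto simp: sep_hol_def\<close>)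
  then show ?thesis by (simp add: pd1_def case_prod_unfold)
qed

lemma cont_pd3:
  assumes "open S" "holomorphic3_on f S"
  shows "continuous_on S (pd3 f)"
proof -
  have "continuous_on {(q, x, y). (x, y, q) \<in> S} (\<lambda>(q, p). deriv (\<lambda>q. f (fst p, snd p, q)) q)"
    by (rule continuous_on_deriv_param[OF open_swap2[OF assms(1)] cont_swap2[OF hol3_continuous[OF assms(2)]]])
      (use hol3_sep[OF assms(2)] in \<open>auto simp: sep_hol_def\<close>)
  then have "continuous_on S (\<lambda>t. (\<lambda>(q, p). deriv (\<lambda>q. f (fst p, snd p, q)) q) (snd (snd t), fst t, fst (snd t)))"
    by (rule continuous_on_compose2) (auto intro!: continuous_intros)
  then show ?thesis by (simp add: pd3_def case_prod_unfold)
qed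

section \<open>Neighbourhoods of intervals, strips, and Cauchy estimates between nested
  domains\<close>

lemma cnbhd_iff: "z \<in> cnbhd A r \<longleftrightarrow> (\<exists>x\<in>A. cmod (z - of_real x) < r)"
  by (auto simp: cnbhd_def dist_norm norm_minus_commute)

lemma open_cnbhd: "open (cnbhd A r)"
  unfolding cnbhd_def by auto

text \<open>The neighbourhood is the Minkowski sum of an interval and a disc. Convexity serves
  segment integrals as well as mean value inequalities.\<close>

lemma convex_cnbhd:
  assumes "connected A"
  shows "convex (cnbhd A r)"
proof (rule convexI)
  fix z w :: complex and a b :: real
  assume zw: "z \<in> cnbhd A r" "w \<in> cnbhd A r" and ab: "0 \<le> a" "0 \<le> b" "a + b = 1"
  obtain x y where x: "x \<in> A" "cmod (z - of_real x) < r" and y: "y \<in> A" "cmod (w - of_real y) < r"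
    using zw by (auto simp: cnbhd_iff)
  have "convex A" using assms by (simp add: is_interval_convex_1[symmetric] is_interval_connected_1)
  then have "a * x + b * y \<in> A" using convexD[OF _ x(1) y(1) ab] by simp
  moreover have "cmod (a *\<^sub>R z + b *\<^sub>R w - of_real (a * x + b * y)) < r"
  proof -
    have "a *\<^sub>R z + b *\<^sub>R w - of_real (a * x + b * y) = a *\<^sub>R (z - of_real x) + b *\<^sub>R (w - of_real y)"
      by (simp add: scaleR_conv_of_real algebra_simps)
    also have "a *\<^sub>R (z - of_real x) + b *\<^sub>R (w - of_real y) \<in> ball 0 r"
      by (rule convexD[OF convex_ball]) (use x y ab in auto)
    finally show ?thesis by simp
  qed
  ultimately show "a *\<^sub>R z + b *\<^sub>R w \<in> cnbhd A r" unfolding cnbhd_iff by blast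
qed

lemma cnbhd_shift:
  assumes "z \<in> cnbhd A r" "cmod (w - z) \<le> R" "r + R \<le> r'"
  shows "w \<in> cnbhd A r'"
proof -
  obtain x where x: "x \<in> A" "cmod (z - of_real x) < r" using assms by (auto simp: cnbhd_iff)
  have "cmod (w - of_real x) \<le> cmod (w - z) + cmod (z - of_real x)"
    by (metis diff_add_cancel norm_triangle_ineq add_diff_eq)
  then show ?thesis using x assms unfolding cnbhd_iff by (intro bexI[of _ x]) auto
qed

lemma cnbhd_mono: "r \<le> r' \<Longrightarrow> cnbhd A r \<subseteq> cnbhd A r'"
  by (auto intro: cnbhd_shift[where R = 0])

lemma of_real_in_cnbhd: "x \<in> A \<Longrightarrow> 0 < r \<Longrightarrow> of_real x \<in> cnbhd A r"
  unfolding cnbhd_iff by (intro bexI[of _ x]) auto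

lemma open_strip: "open (strip s)"
  unfolding strip_def by (intro open_Collect_less continuous_intros)

lemma convex_strip: "convex (strip s)"
proof -
  have "strip s = {z. Im z < s} \<inter> {z. - s < Im z}" by (auto simp: strip_def)
  then show ?thesis
    using convex_halfspace_Im_lt convex_halfspace_Im_gt by (simp add: convex_Int)
qed

lemma strip_shift:
  assumes "z \<in> strip r" "cmod (w - z) \<le> R" "r + R \<le> r'"
  shows "w \<in> strip r'"
proof -
  have "\<bar>Im w\<bar> \<le> \<bar>Im z\<bar> + \<bar>Im (w - z)\<bar>" by simp
  moreover have "\<bar>Im (w - z)\<bar> \<le> R" using abs_Im_le_cmod[of "w - z"] assms by linarith
  ultimately show ?thesis using assms by (simp add: strip_def)
qed

lemma strip_mono: "r \<le> r' \<Longrightarrow> strip r \<subseteq> strip r'"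
  by (auto simp: strip_def)

lemma open_dom3: "open (dom3 I Y (r, \<sigma>, s))"
  by (simp add: open_Times open_cnbhd open_strip)

lemma dom3_mono: "r \<le> r' \<Longrightarrow> \<sigma> \<le> \<sigma>' \<Longrightarrow> s \<le> s' \<Longrightarrow> dom3 I Y (r, \<sigma>, s) \<subseteq> dom3 I Y (r', \<sigma>', s')"
  unfolding dom3.simps by (intro Sigma_mono cnbhd_mono strip_mono)

text \<open>The Cauchy radii \<open>R1\<close>, \<open>R2\<close>, \<open>R3\<close> are bounded by
  the gaps between the two nested domains, so each coordinate disc about a point of the smaller one
  lies in the larger one.\<close>

lemma dom3_partial_bounds:
  assumes f: "holomorphic3_on f (dom3 I Y (r', \<sigma>', s'))"
    and B: "\<And>z. z \<in> dom3 I Y (r', \<sigma>', s') \<Longrightarrow> cmod (f z) \<le> B"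
    and R: "0 < R1" "0 < R2" "0 < R3" "r + R1 \<le> r'" "\<sigma> + R2 \<le> \<sigma>'" "s + R3 \<le> s'"
    and z: "z \<in> dom3 I Y (r, \<sigma>, s)"
  shows "cmod (pd1 f z) \<le> B / R1" "cmod (pd2 f z) \<le> B / R2" "cmod (pd3 f z) \<le> B / R3"
proof -
  obtain x y q where xyq: "z = (x, y, q)" by (metis prod_cases3)
  have in1: "(w, y, q) \<in> dom3 I Y (r', \<sigma>', s')" if "w \<in> ball x R1" for w
    using that z R cnbhd_shift[of x I r w R1 r'] cnbhd_shift[of y Y \<sigma> y 0 \<sigma>'] strip_shift[of q s q 0 s']
    by (auto simp: xyq dist_norm norm_minus_commute)
  have in2: "(x, w, q) \<in> dom3 I Y (r', \<sigma>', s')" if "w \<in> ball y R2" for w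
    using that z R cnbhd_shift[of y Y \<sigma> w R2 \<sigma>'] cnbhd_shift[of x I r x 0 r'] strip_shift[of q s q 0 s']
    by (auto simp: xyq dist_norm norm_minus_commute)
  have in3: "(x, y, w) \<in> dom3 I Y (r', \<sigma>', s')" if "w \<in> ball q R3" for w
    using that z R strip_shift[of q s w R3 s'] cnbhd_shift[of y Y \<sigma> y 0 \<sigma>'] cnbhd_shift[of x I r x 0 r']
    by (auto simp: xyq dist_norm norm_minus_commute)
  have "(\<lambda>w. f (w, y, q)) holomorphic_on ball x R1"
    by (rule holomorphic_onI_DERIV[OF hol3_partials(1)[OF f in1]])
  then show "cmod (pd1 f z) \<le> B / R1"
    unfolding xyq pd1_def using deriv_bound_ball[of "\<lambda>w. f (w, y, q)"] B[OF in1] R by auto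
  have "(\<lambda>w. f (x, w, q)) holomorphic_on ball y R2"
    by (rule holomorphic_onI_DERIV[OF hol3_partials(2)[OF f in2]])
  then show "cmod (pd2 f z) \<le> B / R2"
    unfolding xyq pd2_def using deriv_bound_ball[of "\<lambda>w. f (x, w, q)"] B[OF in2] R by auto
  have "(\<lambda>w. f (x, y, w)) holomorphic_on ball q R3"
    by (rule holomorphic_onI_DERIV[OF hol3_partials(3)[OF f in3]])
  then show "cmod (pd3 f z) \<le> B / R3"
    unfolding xyq pd3_def using deriv_bound_ball[of "\<lambda>w. f (x, y, w)"] B[OF in3] R by auto
qed

text \<open>One variable moves at a time: the intermediate points stay in the product domain, and
  convexity of each factor gives the mean value inequality with the Cauchy bounds.\<close>

lemma dom3_lipschitz:
  assumes conn: "connected I" "connected Y"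
    and f: "holomorphic3_on f (dom3 I Y (r', \<sigma>', s'))"
    and B: "\<And>z. z \<in> dom3 I Y (r', \<sigma>', s') \<Longrightarrow> cmod (f z) \<le> B"
    and R: "0 < R1" "0 < R2" "0 < R3" "r + R1 \<le> r'" "\<sigma> + R2 \<le> \<sigma>'" "s + R3 \<le> s'"
    and z: "(x, y, q) \<in> dom3 I Y (r, \<sigma>, s)" "(x', y', q') \<in> dom3 I Y (r, \<sigma>, s)"
  shows "cmod (f (x, y, q) - f (x', y', q')) \<le> B * (cmod (x - x') / R1 + cmod (y - y') / R2 + cmod (q - q') / R3)"
proof -
  have sub: "dom3 I Y (r, \<sigma>, s) \<subseteq> dom3 I Y (r', \<sigma>', s')" using R by (intro dom3_mono) auto
  note bounds = dom3_partial_bounds[OF f B R]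
  note parts = hol3_partials[OF hol3_subset[OF f sub]]
  have "cmod (f (x, y, q) - f (x', y, q)) \<le> B / R1 * cmod (x - x')"
  proof (rule field_differentiable_bound[OF convex_cnbhd[OF conn(1), of r]])
    fix w assume "w \<in> cnbhd I r"
    then have w: "(w, y, q) \<in> dom3 I Y (r, \<sigma>, s)" using z by auto
    show "((\<lambda>w. f (w, y, q)) has_field_derivative pd1 f (w, y, q)) (at w within cnbhd I r)"
      by (rule has_field_derivative_at_within[OF parts(1)[OF w]])
    show "cmod (pd1 f (w, y, q)) \<le> B / R1" by (rule bounds(1)[OF _ w])
  qed (use z in auto)
  moreover have "cmod (f (x', y, q) - f (x', y', q)) \<le> B / R2 * cmod (y - y')"
  proof (rule field_differentiable_bound[OF convex_cnbhd[OF conn(2), of \<sigma>]])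
    fix w assume "w \<in> cnbhd Y \<sigma>"
    then have w: "(x', w, q) \<in> dom3 I Y (r, \<sigma>, s)" using z by auto
    show "((\<lambda>w. f (x', w, q)) has_field_derivative pd2 f (x', w, q)) (at w within cnbhd Y \<sigma>)"
      by (rule has_field_derivative_at_within[OF parts(2)[OF w]])
    show "cmod (pd2 f (x', w, q)) \<le> B / R2" by (rule bounds(2)[OF _ w])
  qed (use z in auto)
  moreover have "cmod (f (x', y', q) - f (x', y', q')) \<le> B / R3 * cmod (q - q')"
  proof (rule field_differentiable_bound[OF convex_strip[of s]])
    fix w assume "w \<in> strip s"
    then have w: "(x', y', w) \<in> dom3 I Y (r, \<sigma>, s)" using z by auto
    show "((\<lambda>w. f (x', y', w)) has_field_derivative pd3 f (x', y', w)) (at w within strip s)"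
      by (rule has_field_derivative_at_within[OF parts(3)[OF w]])
    show "cmod (pd3 f (x', y', w)) \<le> B / R3" by (rule bounds(3)[OF _ w])
  qed (use z in auto)
  moreover have "f (x, y, q) - f (x', y', q') =
     (f (x, y, q) - f (x', y, q)) + (f (x', y, q) - f (x', y', q)) + (f (x', y', q) - f (x', y', q'))" by simp
  then have "cmod (f (x, y, q) - f (x', y', q')) \<le>
     cmod (f (x, y, q) - f (x', y, q)) + cmod (f (x', y, q) - f (x', y', q)) + cmod (f (x', y', q) - f (x', y', q'))"
    by (simp only:) (intro norm_triangle_le add_mono order_refl)
  ultimately show ?thesis by (simp add: algebra_simps)
qed

section \<open>Fourier series on a strip\<close>

lemma integral_exp_int:
  fixes n :: int and x :: complex
  shows "integral {0..2*pi} (\<lambda>t. exp (- \<i> * of_int n * (of_real t - x))) = (if n = 0 then 2 * of_real pi else 0)"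
proof (cases "n = 0")
  case True
  then show ?thesis by (simp add: scaleR_conv_of_real)
next
  case False
  let ?F = "\<lambda>z. exp (- \<i> * of_int n * (z - x)) / (- \<i> * of_int n)"
  have "((\<lambda>t. exp (- \<i> * of_int n * (of_real t - x))) has_integral (?F (of_real (2*pi)) - ?F (of_real 0))) {0..2*pi}"
  proof (rule fundamental_theorem_of_calculus)
    show "((\<lambda>t. ?F (of_real t)) has_vector_derivative exp (- \<i> * of_int n * (of_real t - x))) (at t within {0..2*pi})" for t
      by (rule has_vector_derivative_real_field) (use False in \<open>auto intro!: derivative_eq_intros\<close>)
  qed auto
  moreover have "exp (- \<i> * of_int n * (of_real (2*pi) - x)) = exp (- \<i> * of_int n * (of_real 0 - x))"
    unfolding exp_eq by (intro exI[of _ "-n"]) (simp add: algebra_simps)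
  ultimately show ?thesis using False by (auto dest: integral_unique)
qed

lemma sum_int_telescope:
  fixes K :: "int \<Rightarrow> complex"
  shows "(\<Sum>n\<in>{- int N..int N}. K (n - 1) - K n) = K (- int N - 1) - K (int N)"
proof (induction N)
  case (Suc N)
  have "{- int (Suc N)..int (Suc N)} = insert (- int N - 1) (insert (int N + 1) {- int N..int N})" by auto
  then show ?case using Suc by (simp add: algebra_simps)
qed simp

text \<open>Chernoff's argument: dividing \<open>h z - h x\<close> by \<open>exp (\<i> (z - x)) - 1\<close> leaves a holomorphic function
  \<open>k\<close>, so that the partial sums at \<open>x\<close> telescope to \<open>h x\<close> up to two Fourier coefficients of \<open>k\<close>.\<close>

lemma fourier_series_LIMSEQ:
  fixes h :: "complex \<Rightarrow> complex" and x :: real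
  assumes hol: "h holomorphic_on strip s" and s: "s > 0" and x: "0 < x" "x < 2 * pi"
  defines "c \<equiv> \<lambda>n::int. 1 / (2 * of_real pi) * integral {0..2*pi} (\<lambda>t. h (of_real t) * exp (- \<i> * of_int n * of_real t))"
  shows "(\<lambda>N. \<Sum>n\<in>{- int N..int N}. c n * exp (\<i> * of_int n * of_real x)) \<longlonglongrightarrow> h (of_real x)"
proof -
  define X :: complex where "X = of_real x"
  define E where "E = (\<lambda>z. exp (\<i> * (z - X)))"
  \<comment> \<open>Since 0 < x < 2 * pi, this window contains [0, 2 * pi], while its half-width 2 *
    pi leaves X as the only point where E equals 1.\<close>
  define U where "U = strip s \<inter> {z. \<bar>Re z - x\<bar> < 2 * pi}"
  have U: "open U" unfolding U_def by (intro open_Int open_strip open_Collect_less continuous_intros)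
  have XU: "X \<in> U" using s by (auto simp: U_def X_def strip_def)
  have tU: "of_real t \<in> U" if "t \<in> {0..2*pi}" for t
    using that x s by (auto simp: U_def strip_def)
  \<comment> \<open>Numerator and denominator of (h z - h X) / (E z - 1) are both divided by z - X
    and completed at X by the derivative. Both quotients are then holomorphic, and the second one
    has no zero in U.\<close>
  define d where "d = (\<lambda>z. if z = X then deriv h X else (h z - h X) / (z - X))"
  define e where "e = (\<lambda>z. if z = X then deriv E X else (E z - E X) / (z - X))"
  have "d holomorphic_on U" unfolding d_def
  proof (rule pole_lemma)
    show "h holomorphic_on U" by (rule holomorphic_on_subset[OF hol]) (simp add: U_def)
    show "X \<in> interior U" using U XU by (simp add: interior_open)
  qed
  moreover have "e holomorphic_on U" unfolding e_def
  proof (rule pole_lemma)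
    show "E holomorphic_on U" unfolding E_def by (intro holomorphic_intros)
    show "X \<in> interior U" using U XU by (simp add: interior_open)
  qed
  moreover have dE: "deriv E X = \<i>"
    by (rule DERIV_imp_deriv) (auto simp: E_def intro!: derivative_eq_intros)
  have E1: "E z \<noteq> 1" if "z \<in> U" "z \<noteq> X" for z
  proof
    assume "E z = 1"
    then obtain n :: int where n: "Im z = 0" "Re z - x = real_of_int (2 * n) * pi"
      unfolding E_def exp_eq_1 by (auto simp: X_def)
    then have "\<bar>real_of_int n\<bar> * (2 * pi) < 1 * (2 * pi)" using that(1) by (simp add: U_def abs_mult)
    then have "\<bar>real_of_int n\<bar> < 1" by (rule mult_right_less_imp_less) simp
    then have "n = 0" by linarith
    then have "z = X" using n by (auto simp: X_def complex_eq_iff)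
    then show False using that by simp
  qed
  have EX: "E X = 1" by (simp add: E_def)
  have e0: "e z \<noteq> 0" if "z \<in> U" for z using E1[OF that] dE EX by (auto simp: e_def)
  define k where "k = (\<lambda>z. d z / e z)"
  have kU: "k holomorphic_on U" unfolding k_def using calculation e0 by (intro holomorphic_intros) auto
  have hk: "h z = h X + (E z - 1) * k z" if "z \<in> U" for z
    using E1[OF that] by (cases "z = X") (auto simp: k_def d_def e_def EX)
  have cont: "continuous_on {0..2*pi} (\<lambda>t. f (of_real t))" if "f holomorphic_on U" for f :: "complex \<Rightarrow> complex"
    by (rule continuous_on_compose2[OF holomorphic_on_imp_continuous_on[OF that]]) (use tU in \<open>auto intro!: continuous_intros\<close>)
  have k'U: "deriv k holomorphic_on U" using kU U by (rule holomorphic_deriv)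
  define K where "K = (\<lambda>n::int. integral {0..2*pi} (\<lambda>t. k (of_real t) * exp (- \<i> * of_int n * (of_real t - X))))"
  \<comment> \<open>Multiplying by E lowers the frequency n by one, so the term (E - 1) * k
    contributes the difference K (n - 1) - K n.\<close>
  have coef: "c n * exp (\<i> * of_int n * X) = (if n = 0 then h X else 0) + (K (n - 1) - K n) / (2 * of_real pi)" for n :: int
  proof -
    have int: "(\<lambda>t. k (of_real t) * exp (- \<i> * of_int m * (of_real t - X))) integrable_on {0..2*pi}" for m :: int
      by (intro integrable_continuous_interval continuous_intros cont kU)
    have "integral {0..2*pi} (\<lambda>t. h (of_real t) * exp (- \<i> * of_int n * of_real t)) * exp (\<i> * of_int n * X) =
       integral {0..2*pi} (\<lambda>t. h (of_real t) * exp (- \<i> * of_int n * of_real t) * exp (\<i> * of_int n * X))"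
      by (rule integral_mult_left[symmetric])
    also have "\<dots> = integral {0..2*pi} (\<lambda>t. h X * exp (- \<i> * of_int n * (of_real t - X)) +
        (k (of_real t) * exp (- \<i> * of_int (n - 1) * (of_real t - X)) - k (of_real t) * exp (- \<i> * of_int n * (of_real t - X))))"
    proof (rule integral_cong)
      fix t assume t: "t \<in> {0..2*pi}"
      have "exp (- \<i> * of_int n * of_real t) * exp (\<i> * of_int n * X) = exp (- \<i> * of_int n * (of_real t - X))"
        by (simp add: exp_add[symmetric] algebra_simps)
      moreover have "E (of_real t) * exp (- \<i> * of_int n * (of_real t - X)) = exp (- \<i> * of_int (n - 1) * (of_real t - X))"
        by (simp add: E_def exp_add[symmetric] algebra_simps)
      ultimately show "h (of_real t) * exp (- \<i> * of_int n * of_real t) * exp (\<i> * of_int n * X) = h X * exp (- \<i> * of_int n * (of_real t - X)) +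
        (k (of_real t) * exp (- \<i> * of_int (n - 1) * (of_real t - X)) - k (of_real t) * exp (- \<i> * of_int n * (of_real t - X)))"
        by (simp only: hk[OF tU[OF t]] mult.assoc) (simp add: algebra_simps)
    qed
    also have "\<dots> = h X * integral {0..2*pi} (\<lambda>t. exp (- \<i> * of_int n * (of_real t - X))) + (K (n - 1) - K n)"
    proof (subst integral_add)
      show "(\<lambda>t. h X * exp (- \<i> * of_int n * (of_real t - X))) integrable_on {0..2*pi}"
        by (intro integrable_continuous_interval continuous_intros)
      show "(\<lambda>t. k (of_real t) * exp (- \<i> * of_int (n - 1) * (of_real t - X)) - k (of_real t) * exp (- \<i> * of_int n * (of_real t - X))) integrable_on {0..2*pi}"
        by (intro integrable_diff int)
    qed (simp only: K_def integral_diff[OF int int] integral_mult_right)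
    finally show ?thesis unfolding c_def integral_exp_int by (auto simp: field_simps)
  qed
  have bdd: "\<exists>C. \<forall>t\<in>{0..2*pi}. cmod (f (of_real t)) \<le> C" if "f holomorphic_on U" for f :: "complex \<Rightarrow> complex"
    using compact_imp_bounded[OF compact_continuous_image[OF cont[OF that] compact_Icc]]
    unfolding bounded_iff by auto
  obtain C0 where C0: "\<And>t. t \<in> {0..2*pi} \<Longrightarrow> cmod (k (of_real t)) \<le> C0" using bdd[OF kU] by blast
  obtain C1 where C1: "\<And>t. t \<in> {0..2*pi} \<Longrightarrow> cmod (deriv k (of_real t)) \<le> C1" using bdd[OF k'U] by blast
  \<comment> \<open>One integration by parts gives decay of order 1 / |n|. The function k is not
    assumed periodic, so the boundary terms remain; each is at most C0.\<close>
  have Kb: "cmod (K n) \<le> (2 * pi * C1 + 2 * C0) / \<bar>real_of_int n\<bar>" if "n \<noteq> 0" for n :: int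
  proof -
    let ?e = "\<lambda>z. exp (- \<i> * of_int n * (z - X))"
    have ne: "cmod (?e (of_real t)) = 1" for t :: real
    proof -
      have "- \<i> * of_int n * (of_real t - X) = \<i> * of_real (- of_int n * (t - x))" by (simp add: X_def)
      then show ?thesis by (simp only: norm_exp_i_times)
    qed
    have int0: "(\<lambda>t. deriv k (of_real t) * ?e (of_real t)) integrable_on {0..2*pi}"
      by (intro integrable_continuous_interval continuous_intros cont k'U)
    have int1: "(\<lambda>t. k (of_real t) * ?e (of_real t)) integrable_on {0..2*pi}"
      by (intro integrable_continuous_interval continuous_intros cont kU)
    have "((\<lambda>t. deriv k (of_real t) * ?e (of_real t) - \<i> * of_int n * (k (of_real t) * ?e (of_real t)))
       has_integral (k (of_real (2*pi)) * ?e (of_real (2*pi)) - k (of_real 0) * ?e (of_real 0))) {0..2*pi}"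
    proof (rule fundamental_theorem_of_calculus)
      fix t assume "t \<in> {0..2*pi}"
      then have "(k has_field_derivative deriv k (of_real t)) (at (of_real t))"
        using kU U tU by (simp add: holomorphic_derivI)
      then show "((\<lambda>t. k (of_real t) * ?e (of_real t)) has_vector_derivative
          (deriv k (of_real t) * ?e (of_real t) - \<i> * of_int n * (k (of_real t) * ?e (of_real t)))) (at t within {0..2*pi})"
        by (intro has_vector_derivative_real_field) (auto intro!: derivative_eq_intros simp: algebra_simps)
    qed auto
    from integral_unique[OF this]
    have "integral {0..2*pi} (\<lambda>t. deriv k (of_real t) * ?e (of_real t)) - \<i> * of_int n * K n =
        k (of_real (2*pi)) * ?e (of_real (2*pi)) - k (of_real 0) * ?e (of_real 0)"
      by (simp only: K_def integral_diff[OF int0 integrable_on_mult_right[OF int1]] integral_mult_right)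
    then have "\<i> * of_int n * K n = integral {0..2*pi} (\<lambda>t. deriv k (of_real t) * ?e (of_real t)) -
        (k (of_real (2*pi)) * ?e (of_real (2*pi)) - k (of_real 0) * ?e (of_real 0))" by (simp add: algebra_simps)
    then have "cmod (\<i> * of_int n * K n) \<le> cmod (integral {0..2*pi} (\<lambda>t. deriv k (of_real t) * ?e (of_real t))) +
        (cmod (k (of_real (2*pi)) * ?e (of_real (2*pi))) + cmod (k (of_real 0) * ?e (of_real 0)))"
      by (simp only:) (intro order_trans[OF norm_triangle_ineq4] add_mono order_refl)
    also have "cmod (k (of_real (2*pi)) * ?e (of_real (2*pi))) \<le> C0" unfolding norm_mult ne using C0[of "2*pi"] by simp
    also have "cmod (k (of_real 0) * ?e (of_real 0)) \<le> C0" unfolding norm_mult ne using C0[of 0] by simp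
    also have "cmod (integral {0..2*pi} (\<lambda>t. deriv k (of_real t) * ?e (of_real t))) \<le> C1 * (2 * pi - 0)"
    proof (rule integral_bound)
      show "continuous_on {0..2*pi} (\<lambda>t. deriv k (of_real t) * ?e (of_real t))"
        by (intro continuous_intros cont k'U)
      show "cmod (deriv k (of_real t) * ?e (of_real t)) \<le> C1" if "t \<in> {0..2*pi}" for t
        unfolding norm_mult ne using C1[OF that] by simp
    qed simp
    finally show ?thesis using that by (simp add: norm_mult field_simps)
  qed
  have K0: "(\<lambda>N. K (f N)) \<longlonglongrightarrow> 0" if f: "\<And>N. \<bar>real_of_int (f N)\<bar> \<ge> real N" for f
  proof (rule Lim_null_comparison)
    show "(\<lambda>N. \<bar>2 * pi * C1 + 2 * C0\<bar> / real N) \<longlonglongrightarrow> 0" by (rule lim_const_over_n)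
    show "\<forall>\<^sub>F N in sequentially. cmod (K (f N)) \<le> \<bar>2 * pi * C1 + 2 * C0\<bar> / real N"
      using eventually_gt_at_top[of 0]
    proof eventually_elim
      case (elim N)
      have n: "f N \<noteq> 0" using f[of N] elim by auto
      have "(2 * pi * C1 + 2 * C0) / \<bar>real_of_int (f N)\<bar> \<le> \<bar>2 * pi * C1 + 2 * C0\<bar> / real N"
        by (rule frac_le) (use f[of N] elim in auto)
      then show ?case using Kb[OF n] by linarith
    qed
  qed
  have sumeq: "(\<Sum>n\<in>{- int N..int N}. c n * exp (\<i> * of_int n * X)) = h X + (K (- int N - 1) - K (int N)) / (2 * of_real pi)" for N
    unfolding coef sum.distrib sum_divide_distrib[symmetric] sum_int_telescope by simp
  have "(\<lambda>N. h X + (K (- int N - 1) - K (int N)) / (2 * of_real pi)) \<longlonglongrightarrow> h X + (0 - 0) / (2 * of_real pi)"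
    by (intro tendsto_intros K0) auto
  then show ?thesis unfolding sumeq[unfolded X_def] by (simp add: X_def)
qed

text \<open>On the real interval (0, 2 pi) the series converges to h by
  \<open>fourier_series_LIMSEQ\<close>. The exponential weights make it converge uniformly on the
  strip to a holomorphic g, the identity theorem gives g = h there, and the bound is then
  termwise.\<close>

lemma fourier_strip_bound:
  fixes h :: "complex \<Rightarrow> complex" and a :: "int \<Rightarrow> real"
  assumes hol: "h holomorphic_on strip s" and s: "s > 0"
  defines "c \<equiv> \<lambda>n::int. 1 / (2 * of_real pi) * integral {0..2*pi} (\<lambda>t. h (of_real t) * exp (- \<i> * of_int n * of_real t))"
  assumes a: "\<And>n. cmod (c n) * exp (\<bar>real_of_int n\<bar> * s) \<le> a n" "a summable_on UNIV"
    and z: "z \<in> strip s"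
  shows "cmod (h z) \<le> infsum a UNIV"
proof -
  have a0: "a n \<ge> 0" for n by (rule order_trans[OF _ a(1)]) simp
  have tb: "cmod (c n * exp (\<i> * of_int n * w)) \<le> a n" if "w \<in> strip s" for n w
  proof -
    have "- (real_of_int n * Im w) \<le> \<bar>real_of_int n\<bar> * \<bar>Im w\<bar>" by (metis abs_ge_minus_self abs_mult)
    also have "\<dots> \<le> \<bar>real_of_int n\<bar> * s" using that by (intro mult_left_mono) (auto simp: strip_def)
    finally have "cmod (exp (\<i> * of_int n * w)) \<le> exp (\<bar>real_of_int n\<bar> * s)" by simp
    then have "cmod (c n * exp (\<i> * of_int n * w)) \<le> cmod (c n) * exp (\<bar>real_of_int n\<bar> * s)"
      unfolding norm_mult by (intro mult_left_mono) auto
    then show ?thesis using a(1)[of n] by linarith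
  qed
  define S where "S = (\<lambda>N w. \<Sum>n\<in>{- int N..int N}. c n * exp (\<i> * of_int n * w))"
  \<comment> \<open>Pairing the frequencies j and -j turns symmetric partial sums into ordinary
    ones; j = 0 is separate so that c 0 is not counted twice.\<close>
  define T where "T = (\<lambda>j w. if j = 0 then c 0 else c (int j) * exp (\<i> * of_int (int j) * w) + c (- int j) * exp (\<i> * of_int (- int j) * w))"
  define b where "b = (\<lambda>j::nat. if j = 0 then a 0 else a (int j) + a (- int j))"
  have split: "(\<Sum>n\<in>{- int N..int N}. f n) = (\<Sum>j<Suc N. if j = 0 then f 0 else f (int j) + f (- int j))" for N and f :: "int \<Rightarrow> 'b::comm_monoid_add"
  proof (induction N)
    case (Suc N)
    have "{- int (Suc N)..int (Suc N)} = insert (- int (Suc N)) (insert (int (Suc N)) {- int N..int N})" by auto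
    then show ?case using Suc by (simp add: add_ac)
  qed simp
  have ST: "S N w = (\<Sum>j<Suc N. T j w)" for N w unfolding S_def T_def split[of "\<lambda>n. c n * exp (\<i> * of_int n * w)"] by (intro sum.cong) auto
  have Sb: "(\<Sum>n\<in>{- int N..int N}. a n) \<le> infsum a UNIV" for N
    by (rule finite_sum_le_infsum) (use a a0 in auto)
  have "summable b"
  proof (rule summableI_nonneg_bounded)
    show "b j \<ge> 0" for j using a0 by (simp add: b_def)
    show "(\<Sum>j<N. b j) \<le> infsum a UNIV" for N
    proof (cases N)
      case 0 then show ?thesis by (simp add: infsum_nonneg a0)
    next
      case (Suc M) then show ?thesis using Sb[of M] split[of a M] by (simp add: b_def)
    qed
  qed
  then have ulim: "uniform_limit (strip s) (\<lambda>N w. \<Sum>j<N. T j w) (\<lambda>w. \<Sum>j. T j w) sequentially"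
  proof (rule Weierstrass_m_test[rotated])
    show "cmod (T j w) \<le> b j" if "w \<in> strip s" for j w
      using tb[OF that, of 0] tb[OF that, of "int j"] tb[OF that, of "- int j"]
      by (auto simp: T_def b_def intro!: norm_triangle_le)
  qed
  define g where "g = (\<lambda>w. \<Sum>j. T j w)"
  have "g holomorphic_on strip s"
  proof (rule holomorphic_uniform_sequence[OF open_strip])
    show "(\<lambda>w. \<Sum>j<N. T j w) holomorphic_on strip s" for N
    proof (rule holomorphic_on_sum)
      show "T j holomorphic_on strip s" for j
        by (cases "j = 0") (auto simp: T_def intro!: holomorphic_intros)
    qed
    fix w assume "w \<in> strip s"
    then obtain d where "d > 0" "cball w d \<subseteq> strip s" using open_strip open_contains_cball by blast
    then show "\<exists>d>0. cball w d \<subseteq> strip s \<and> uniform_limit (cball w d) (\<lambda>N w. \<Sum>j<N. T j w) g sequentially"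
      using uniform_limit_on_subset[OF ulim] unfolding g_def by blast
  qed
  have lim: "(\<lambda>N. S N w) \<longlonglongrightarrow> g w" if "w \<in> strip s" for w
    using LIMSEQ_Suc[OF tendsto_uniform_limitI[OF ulim that]] by (simp only: ST g_def)
  have eq: "h w - g w = 0" if w: "w \<in> of_real ` {0<..<2*pi}" for w
  proof -
    obtain x where x: "w = of_real x" "0 < x" "x < 2 * pi" using w by auto
    have "w \<in> strip s" using x s by (simp add: strip_def)
    from lim[OF this] fourier_series_LIMSEQ[OF hol s x(2,3)] show ?thesis
      using LIMSEQ_unique unfolding S_def c_def x(1) by force
  qed
  \<comment> \<open>Identity theorem: the difference vanishes on (0, 2 pi), which accumulates at the
    point pi of the connected strip.\<close>
  have "h z - g z = 0"
  proof (rule analytic_continuation[where f = "\<lambda>z. h z - g z" and w = z and U = "of_real ` {0<..<2*pi}" and S = "strip s" and \<xi> = "of_real pi"])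
    show "(\<lambda>z. h z - g z) holomorphic_on strip s" using hol \<open>g holomorphic_on strip s\<close> by (intro holomorphic_intros)
    show "connected (strip s)" by (simp add: convex_connected convex_strip)
    show "complex_of_real pi islimpt of_real ` {0<..<2*pi}"
      unfolding islimpt_approachable
    proof (intro allI impI)
      fix e :: real assume e: "e > 0"
      define x where "x = pi + min e pi / 2"
      have "x > 0" "x < 2 * pi" "x \<noteq> pi" "\<bar>x - pi\<bar> < e" using e pi_gt_zero by (auto simp: x_def min_def)
      then show "\<exists>x'\<in>of_real ` {0<..<2*pi}. x' \<noteq> complex_of_real pi \<and> dist x' (complex_of_real pi) < e"
        by (intro bexI[of _ "of_real x"]) (auto simp: dist_real_def simp flip: of_real_diff)
    qed
  qed (use s z eq open_strip in \<open>auto simp: strip_def\<close>)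
  then have "h z = g z" by simp
  also have "cmod (g z) \<le> infsum a UNIV"
  proof (rule LIMSEQ_le_const2[OF tendsto_norm[OF lim[OF z]]], intro exI allI impI)
    fix N
    have "cmod (S N z) \<le> (\<Sum>n\<in>{- int N..int N}. a n)" unfolding S_def by (intro sum_norm_le tb z)
    then show "cmod (S N z) \<le> infsum a UNIV" using Sb[of N] by linarith
  qed
  finally show ?thesis .
qed

text \<open>The bridge from Fourier norms to suprema: for each fixed (x, y), the strip bound is
  applied to the slice in the angle.\<close>

lemma norm_le_norm_u:
  assumes f: "f \<in> O_space I Y (r, \<sigma>, s)" and s: "s > 0" and z: "z \<in> dom3 I Y (r, \<sigma>, s)"
  shows "cmod (f z) \<le> norm_u I Y (r, \<sigma>, s) f"
proof -
  obtain x y q where xyq: "z = (x, y, q)" by (metis prod_cases3)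
  have "holomorphic3_on f (dom3 I Y (r, \<sigma>, s))" using f by simp
  note part = hol3_partials(3)[OF this]
  have "cmod ((\<lambda>q. f (x, y, q)) q) \<le> infsum (\<lambda>k. sup_norm (dom2 I Y r \<sigma>) (fourier_coeff f k) * exp (\<bar>real_of_int k\<bar> * s)) UNIV"
  proof (rule fourier_strip_bound[where h = "\<lambda>q. f (x, y, q)" and z = q])
    show "(\<lambda>q. f (x, y, q)) holomorphic_on strip s"
      by (rule holomorphic_onI_DERIV[OF part]) (use z xyq in auto)
    fix k :: int
    have "cmod (fourier_coeff f k (x, y)) \<le> sup_norm (dom2 I Y r \<sigma>) (fourier_coeff f k)"
      unfolding sup_norm_def
    proof (rule cSUP_upper)
      show "(x, y) \<in> dom2 I Y r \<sigma>" using z xyq by (simp add: dom2_def)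
      have "bounded (fourier_coeff f k ` dom2 I Y r \<sigma>)" using f by simp
      then show "bdd_above ((\<lambda>z. cmod (fourier_coeff f k z)) ` dom2 I Y r \<sigma>)"
        by (auto simp: bounded_iff bdd_above_def)
    qed
    then show "cmod (1 / (2 * of_real pi) * integral {0..2*pi} (\<lambda>t. f (x, y, of_real t) * exp (- \<i> * of_int k * of_real t))) * exp (\<bar>real_of_int k\<bar> * s)
        \<le> sup_norm (dom2 I Y r \<sigma>) (fourier_coeff f k) * exp (\<bar>real_of_int k\<bar> * s)"
      by (simp add: fourier_coeff_def)
  qed (use f s z xyq in auto)
  then show ?thesis by (simp add: xyq)
qed

section \<open>Primitives along the second variable\<close>

text \<open>The other two variables are mere parameters. On a convex domain in y, integration over
  the straight segment from \<open>y0\<close> is the primitive in y that vanishes at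
  \<open>y0\<close>.\<close>

definition yint :: "complex \<Rightarrow> (point \<Rightarrow> complex) \<Rightarrow> point \<Rightarrow> complex" where
  "yint y0 f = (\<lambda>(x, y, q). contour_integral (linepath y0 y) (\<lambda>\<eta>. f (x, \<eta>, q)))"

lemma yint_integral:
  "yint y0 f (x, y, q) = integral {0..1} (\<lambda>\<theta>. f (x, linepath y0 y \<theta>, q) * (y - y0))"
  by (simp add: yint_def contour_integral_integral)

text \<open>The primitive g comes from convexity for one fixed pair (x, q) and carries no
  information on how it depends on that pair; joint holomorphy is recovered from the integral
  formula in \<open>yint_hol3\<close>.\<close>

lemma yint_primitive:
  assumes B: "open B" "convex B" "y0 \<in> B" and f: "holomorphic3_on f (A \<times> B \<times> C)" and xq: "x \<in> A" "q \<in> C"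
  obtains g where "\<And>y. y \<in> B \<Longrightarrow> (g has_field_derivative f (x, y, q)) (at y)"
    "\<And>y. y \<in> B \<Longrightarrow> yint y0 f (x, y, q) = g y - g y0"
proof -
  have hol: "(\<lambda>y. f (x, y, q)) holomorphic_on B"
    by (rule holomorphic_onI_DERIV[OF hol3_partials(2)[OF f]]) (use xq in auto)
  then obtain g where g: "\<And>y. y \<in> B \<Longrightarrow> (g has_field_derivative f (x, y, q)) (at y)"
    using holomorphic_convex_primitive'[OF B(2,1) hol] at_within_open[OF _ B(1)] by metis
  show ?thesis
  proof (rule that[OF g])
    fix y assume y: "y \<in> B"
    have "((\<lambda>\<eta>. f (x, \<eta>, q)) has_contour_integral (g (pathfinish (linepath y0 y)) - g (pathstart (linepath y0 y)))) (linepath y0 y)"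
    proof (rule contour_integral_primitive[where S = B])
      show "(g has_field_derivative f (x, \<eta>, q)) (at \<eta> within B)" if "\<eta> \<in> B" for \<eta>
        by (rule has_field_derivative_at_within[OF g[OF that]])
      show "path_image (linepath y0 y) \<subseteq> B" using B y by (simp add: closed_segment_subset)
    qed auto
    then show "yint y0 f (x, y, q) = g y - g y0" by (simp add: yint_def contour_integral_unique)
  qed auto
qed

lemma yint_DERIV:
  assumes B: "open B" "convex B" "y0 \<in> B" and f: "holomorphic3_on f (A \<times> B \<times> C)" and z: "(x, y, q) \<in> A \<times> B \<times> C"
  shows "((\<lambda>y. yint y0 f (x, y, q)) has_field_derivative f (x, y, q)) (at y)"
proof -
  have xq: "x \<in> A" "q \<in> C" and y: "y \<in> B" using z by auto
  obtain g where g: "\<And>y. y \<in> B \<Longrightarrow> (g has_field_derivative f (x, y, q)) (at y)"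
    "\<And>y. y \<in> B \<Longrightarrow> yint y0 f (x, y, q) = g y - g y0" using yint_primitive[OF B f xq] by metis
  have "((\<lambda>y. g y - g y0) has_field_derivative f (x, y, q) - 0) (at y)"
    by (rule DERIV_diff[OF g(1)[OF y] DERIV_const])
  then have "((\<lambda>y. g y - g y0) has_field_derivative f (x, y, q)) (at y)" by simp
  then show ?thesis
    by (rule has_field_derivative_transform_within_open[OF _ B(1) y]) (use g(2) in auto)
qed

text \<open>Along the segment the distance to \<open>y0\<close> grows linearly, so a bound of the
  integrand by h' of the distance integrates exactly to h. This form lets exponential majorants pass
  through the integral without loss.\<close>

lemma yint_bound:
  fixes h h' :: "real \<Rightarrow> real"
  assumes B: "open B" "convex B" "y0 \<in> B" and f: "holomorphic3_on f (A \<times> B \<times> C)" and z: "(x, y, q) \<in> A \<times> B \<times> C"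
    and h: "\<And>\<xi>. (h has_real_derivative h' \<xi>) (at \<xi>)"
    and bd: "\<And>\<eta>. \<eta> \<in> B \<Longrightarrow> cmod (f (x, \<eta>, q)) \<le> h' (cmod (\<eta> - y0))"
  shows "cmod (yint y0 f (x, y, q)) \<le> h (cmod (y - y0)) - h 0"
proof -
  have xq: "x \<in> A" "q \<in> C" and y: "y \<in> B" using z by auto
  obtain g where g: "\<And>y. y \<in> B \<Longrightarrow> (g has_field_derivative f (x, y, q)) (at y)"
    "\<And>y. y \<in> B \<Longrightarrow> yint y0 f (x, y, q) = g y - g y0" using yint_primitive[OF B f xq] by metis
  let ?l = "\<lambda>\<theta>::real. y0 + of_real \<theta> * (y - y0)"
  have l: "?l \<theta> \<in> B" if "0 \<le> \<theta>" "\<theta> \<le> 1" for \<theta>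
  proof -
    have "?l \<theta> = (1 - \<theta>) *\<^sub>R y0 + \<theta> *\<^sub>R y" by (simp add: scaleR_conv_of_real algebra_simps)
    then show ?thesis using convexD_alt[OF B(2,3) y that] by simp
  qed
  let ?r = "cmod (y - y0)"
  have vd: "((\<lambda>\<theta>. g (?l \<theta>)) has_vector_derivative f (x, ?l \<theta>, q) * (y - y0)) (at \<theta>)" if "0 \<le> \<theta>" "\<theta> \<le> 1" for \<theta>
  proof -
    have "((\<lambda>w. g (y0 + w * (y - y0))) has_field_derivative f (x, ?l \<theta>, q) * (y - y0)) (at (of_real \<theta>))"
      by (rule DERIV_chain2[where f = g and g = "\<lambda>w. y0 + w * (y - y0)"]) (use g(1)[OF l[OF that]] in \<open>auto intro!: derivative_eq_intros\<close>)
    then show ?thesis by (rule has_vector_derivative_real_field)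
  qed
  have hd: "((\<lambda>\<theta>. h (\<theta> * ?r)) has_real_derivative h' (\<theta> * ?r) * ?r) (at \<theta>)" for \<theta>
    by (rule DERIV_chain2[where f = h and g = "\<lambda>\<theta>. \<theta> * ?r"]) (use h in \<open>auto intro!: derivative_eq_intros\<close>)
  have "norm (g (?l 1) - g (?l 0)) \<le> h (1 * ?r) - h (0 * ?r)"
  proof (rule differentiable_bound_general[where f = "\<lambda>\<theta>. g (?l \<theta>)" and \<phi> = "\<lambda>\<theta>. h (\<theta> * ?r)"])
    show "continuous_on {0..1} (\<lambda>\<theta>. g (?l \<theta>))"
      by (rule continuous_at_imp_continuous_on) (use vd has_vector_derivative_continuous in force)
    show "continuous_on {0..1} (\<lambda>\<theta>. h (\<theta> * ?r))"
      by (rule continuous_at_imp_continuous_on) (use hd DERIV_isCont in blast)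
    fix \<theta> :: real assume t: "0 < \<theta>" "\<theta> < 1"
    then show "((\<lambda>\<theta>. g (?l \<theta>)) has_vector_derivative f (x, ?l \<theta>, q) * (y - y0)) (at \<theta>)" by (intro vd) auto
    show "((\<lambda>\<theta>. h (\<theta> * ?r)) has_vector_derivative h' (\<theta> * ?r) * ?r) (at \<theta>)"
      using hd has_real_derivative_iff_has_vector_derivative by blast
    have "cmod (f (x, ?l \<theta>, q)) \<le> h' (\<theta> * ?r)" using bd[OF l[of \<theta>]] t by (simp add: norm_mult)
    then show "norm (f (x, ?l \<theta>, q) * (y - y0)) \<le> h' (\<theta> * ?r) * ?r" unfolding norm_mult by (rule mult_right_mono) simp
  qed simp
  then show ?thesis using g(2)[OF y] by simp
qed

lemma yint_diff:
  assumes B: "open B" "convex B" "y0 \<in> B" and f: "holomorphic3_on f (A \<times> B \<times> C)" and g: "holomorphic3_on g (A \<times> B \<times> C)"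
    and z: "(x, y, q) \<in> A \<times> B \<times> C"
  shows "yint y0 (\<lambda>z. f z - g z) (x, y, q) = yint y0 f (x, y, q) - yint y0 g (x, y, q)"
  unfolding yint_def prod.case
proof (rule contour_integral_diff)
  have sub: "closed_segment y0 y \<subseteq> B" using B z by (auto simp: closed_segment_subset)
  have "continuous_on (closed_segment y0 y) (\<lambda>\<eta>. u (x, \<eta>, q))" if "holomorphic3_on u (A \<times> B \<times> C)" for u
    by (rule continuous_on_compose2[OF hol3_continuous[OF that]]) (use sub z in \<open>auto intro!: continuous_intros\<close>)
  then show "(\<lambda>\<eta>. f (x, \<eta>, q)) contour_integrable_on linepath y0 y" "(\<lambda>\<eta>. g (x, \<eta>, q)) contour_integrable_on linepath y0 y"
    using f g contour_integrable_continuous_linepath by blast+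
qed

text \<open>By \<open>Osgood\<close>: in y it is a primitive, in x and q one differentiates under
  the integral sign, which uses the joint continuity of \<open>pd1 f\<close> and
  \<open>pd3 f\<close>.\<close>

lemma yint_hol3:
  assumes A: "open A" and B: "open B" "convex B" "y0 \<in> B" and C: "open C" and f: "holomorphic3_on f (A \<times> B \<times> C)"
  shows "holomorphic3_on (yint y0 f) (A \<times> B \<times> C)"
proof (rule Osgood)
  let ?S = "A \<times> B \<times> C"
  show S: "open ?S" using A B C by (simp add: open_Times)
  have l: "linepath y0 y \<theta> \<in> B" if "y \<in> B" "\<theta> \<in> {0..1}" for y \<theta>
    using convexD_alt[OF B(2,3) that(1)] that by (simp add: linepath_def)
  have cont: "continuous_on (?S \<times> {0..1}) (\<lambda>(z, \<theta>). g (fst z, linepath y0 (fst (snd z)) \<theta>, snd (snd z)) * (fst (snd z) - y0))"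
    if "continuous_on ?S g" for g :: "point \<Rightarrow> complex"
    unfolding case_prod_unfold
  proof (intro continuous_on_mult continuous_on_compose2[OF that] continuous_intros)
    show "continuous_on (?S \<times> {0..1}) (\<lambda>p. linepath y0 (fst (snd (fst p))) (snd p))"
      unfolding linepath_def by (intro continuous_intros)
    show "(\<lambda>p. (fst (fst p), linepath y0 (fst (snd (fst p))) (snd p), snd (snd (fst p)))) ` (?S \<times> {0..1}) \<subseteq> ?S"
      using l by auto
  qed
  have eq: "yint y0 f = (\<lambda>z. integral {0..1} (\<lambda>\<theta>. f (fst z, linepath y0 (fst (snd z)) \<theta>, snd (snd z)) * (fst (snd z) - y0)))"
    by (auto simp: yint_integral fun_eq_iff)
  have "continuous_on ?S (\<lambda>z. integral (cbox 0 1) (\<lambda>\<theta>. f (fst z, linepath y0 (fst (snd z)) \<theta>, snd (snd z)) * (fst (snd z) - y0)))"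
    by (rule integral_continuous_on_param) (use cont[OF hol3_continuous[OF f]] in simp)
  then show "continuous_on ?S (yint y0 f)" unfolding eq by simp
  show "sep_hol (yint y0 f) ?S" unfolding sep_hol_def
  proof (clarify, intro conjI)
    fix x y q assume xyq: "x \<in> A" "y \<in> B" "q \<in> C"
    have int: "(\<lambda>\<theta>. f (x, linepath y0 y \<theta>, q) * (y - y0)) integrable_on cbox 0 1" if "x \<in> A" "q \<in> C" for x q
    proof -
      have "continuous_on {0..1} (\<lambda>\<theta>. (\<lambda>(z, \<theta>). f (fst z, linepath y0 (fst (snd z)) \<theta>, snd (snd z)) * (fst (snd z) - y0)) ((x, y, q), \<theta>))"
        by (rule continuous_on_compose2[OF cont[OF hol3_continuous[OF f]]]) (use that xyq in \<open>auto intro!: continuous_intros\<close>)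
      then show ?thesis unfolding cbox_interval by (intro integrable_continuous_interval) simp
    qed
    show "(\<lambda>y. yint y0 f (x, y, q)) field_differentiable at y"
      using yint_DERIV[OF B f, of x y q] xyq by (auto simp: field_differentiable_def)
    obtain d where d: "d > 0" "ball x d \<subseteq> A" using A xyq open_contains_ball by blast
    have "(\<lambda>x. integral (cbox 0 1) (\<lambda>\<theta>. f (x, linepath y0 y \<theta>, q) * (y - y0))) holomorphic_on ball x d"
    proof (rule leibniz_rule_holomorphic[where fx = "\<lambda>x \<theta>. pd1 f (x, linepath y0 y \<theta>, q) * (y - y0)"])
      fix x' and \<theta> :: real assume x': "x' \<in> ball x d" "\<theta> \<in> cbox 0 1"
      have "((\<lambda>x. f (x, linepath y0 y \<theta>, q)) has_field_derivative pd1 f (x', linepath y0 y \<theta>, q)) (at x')"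
        by (rule hol3_partials(1)[OF f]) (use x' d l xyq in auto)
      then show "((\<lambda>x. f (x, linepath y0 y \<theta>, q) * (y - y0)) has_field_derivative pd1 f (x', linepath y0 y \<theta>, q) * (y - y0)) (at x' within ball x d)"
        by (rule DERIV_cmult_right[OF has_field_derivative_at_within])
    next
      have "continuous_on (ball x d \<times> cbox 0 1) (\<lambda>p. (\<lambda>(z, \<theta>). pd1 f (fst z, linepath y0 (fst (snd z)) \<theta>, snd (snd z)) * (fst (snd z) - y0)) ((fst p, y, q), snd p))"
        by (rule continuous_on_compose2[OF cont[OF cont_pd1[OF S f]]]) (use d xyq in \<open>auto intro!: continuous_intros\<close>)
      then show "continuous_on (ball x d \<times> cbox 0 1) (\<lambda>(x, \<theta>). pd1 f (x, linepath y0 y \<theta>, q) * (y - y0))"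
        by (simp add: case_prod_unfold)
    qed (use int d xyq in auto)
    then have "(\<lambda>x. yint y0 f (x, y, q)) holomorphic_on ball x d" by (simp add: yint_integral)
    then show "(\<lambda>x. yint y0 f (x, y, q)) field_differentiable at x"
      using d by (simp add: holomorphic_on_imp_differentiable_at)
    obtain e where e: "e > 0" "ball q e \<subseteq> C" using C xyq open_contains_ball by blast
    have "(\<lambda>q. integral (cbox 0 1) (\<lambda>\<theta>. f (x, linepath y0 y \<theta>, q) * (y - y0))) holomorphic_on ball q e"
    proof (rule leibniz_rule_holomorphic[where fx = "\<lambda>q \<theta>. pd3 f (x, linepath y0 y \<theta>, q) * (y - y0)"])
      fix q' and \<theta> :: real assume q': "q' \<in> ball q e" "\<theta> \<in> cbox 0 1"
      have "((\<lambda>q. f (x, linepath y0 y \<theta>, q)) has_field_derivative pd3 f (x, linepath y0 y \<theta>, q')) (at q')"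
        by (rule hol3_partials(3)[OF f]) (use q' e l xyq in auto)
      then show "((\<lambda>q. f (x, linepath y0 y \<theta>, q) * (y - y0)) has_field_derivative pd3 f (x, linepath y0 y \<theta>, q') * (y - y0)) (at q' within ball q e)"
        by (rule DERIV_cmult_right[OF has_field_derivative_at_within])
    next
      have "continuous_on (ball q e \<times> cbox 0 1) (\<lambda>p. (\<lambda>(z, \<theta>). pd3 f (fst z, linepath y0 (fst (snd z)) \<theta>, snd (snd z)) * (fst (snd z) - y0)) ((x, y, fst p), snd p))"
        by (rule continuous_on_compose2[OF cont[OF cont_pd3[OF S f]]]) (use e xyq in \<open>auto intro!: continuous_intros\<close>)
      then show "continuous_on (ball q e \<times> cbox 0 1) (\<lambda>(q, \<theta>). pd3 f (x, linepath y0 y \<theta>, q) * (y - y0))"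
        by (simp add: case_prod_unfold)
    qed (use int e xyq in auto)
    then have "(\<lambda>q. yint y0 f (x, y, q)) holomorphic_on ball q e" by (simp add: yint_integral)
    then show "(\<lambda>q. yint y0 f (x, y, q)) field_differentiable at q"
      using e by (simp add: holomorphic_on_imp_differentiable_at)
  qed
qed

text \<open>Weierstrass' theorem in one variable on each coordinate line, together with continuity
  of the uniform limit, feeds \<open>Osgood\<close>.\<close>

lemma hol3_uniform_limit:
  assumes S: "open S" and f: "\<And>n. holomorphic3_on (f n) S" and lim: "uniform_limit S f g sequentially"
  shows "holomorphic3_on g S"
proof (rule Osgood[OF S])
  show "continuous_on S g"
    by (rule uniform_limit_theorem[OF _ lim]) (use f hol3_continuous in auto)
  have slice: "(\<lambda>w. g (\<gamma> w)) field_differentiable at w0"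
    if \<gamma>: "continuous_on UNIV \<gamma>" "\<gamma> w0 \<in> S" "\<And>n w. \<gamma> w \<in> S \<Longrightarrow> (\<lambda>w. f n (\<gamma> w)) field_differentiable at w"
    for \<gamma> :: "complex \<Rightarrow> point" and w0
  proof -
    have op: "open (\<gamma> -` S)" using \<gamma>(1) S by (simp add: open_vimage)
    have "(\<lambda>w. g (\<gamma> w)) holomorphic_on \<gamma> -` S"
    proof (rule holomorphic_uniform_sequence[OF op])
      show "(\<lambda>w. f n (\<gamma> w)) holomorphic_on \<gamma> -` S" for n
        unfolding holomorphic_on_def by (rule ballI, rule field_differentiable_at_within, rule \<gamma>(3)) simp
      fix w assume "w \<in> \<gamma> -` S"
      then obtain d where d: "d > 0" "cball w d \<subseteq> \<gamma> -` S" using op open_contains_cball by blast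
      have "uniform_limit (cball w d) (\<lambda>n w. f n (\<gamma> w)) (\<lambda>w. g (\<gamma> w)) sequentially"
        by (rule uniform_limit_compose'[OF lim]) (use d in auto)
      then show "\<exists>d>0. cball w d \<subseteq> \<gamma> -` S \<and> uniform_limit (cball w d) (\<lambda>n w. f n (\<gamma> w)) (\<lambda>w. g (\<gamma> w)) sequentially"
        using d by blast
    qed
    then show ?thesis using op \<gamma>(2) by (simp add: holomorphic_on_imp_differentiable_at)
  qed
  show "sep_hol g S" unfolding sep_hol_def
  proof (clarify, intro conjI)
    fix x y q assume z: "(x, y, q) \<in> S"
    have s: "(\<lambda>x. f n (x, y, q)) field_differentiable at x \<and> (\<lambda>y. f n (x, y, q)) field_differentiable at y \<and>
        (\<lambda>q. f n (x, y, q)) field_differentiable at q" if "(x, y, q) \<in> S" for n x y q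
      using hol3_sep[OF f, of n] that by (auto simp: sep_hol_def)
    show "(\<lambda>x. g (x, y, q)) field_differentiable at x"
      by (rule slice[of "\<lambda>x. (x, y, q)"]) (use z s in \<open>auto intro!: continuous_intros\<close>)
    show "(\<lambda>y. g (x, y, q)) field_differentiable at y"
      by (rule slice[of "\<lambda>y. (x, y, q)"]) (use z s in \<open>auto intro!: continuous_intros\<close>)
    show "(\<lambda>q. g (x, y, q)) field_differentiable at q"
      by (rule slice[of "\<lambda>q. (x, y, q)"]) (use z s in \<open>auto intro!: continuous_intros\<close>)
  qed
qed

section \<open>Picard iteration\<close>

text \<open>Every index above 1 means the angle, so statements may quantify over all natural numbers
  and still amount to three cases.\<close>

definition crd :: "nat \<Rightarrow> point \<Rightarrow> complex" where
  "crd i z = (if i = 0 then fst z else if i = 1 then fst (snd z) else snd (snd z))"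

definition nrm1 :: "point \<Rightarrow> real" where
  "nrm1 z = cmod (crd 0 z) + cmod (crd 1 z) + cmod (crd 2 z)"

lemma crd_simps [simp]:
  "crd 0 z = fst z" "crd (Suc 0) z = fst (snd z)" "crd 2 z = snd (snd z)"
  by (simp_all add: crd_def)

lemma crd_cases: "crd i z = crd 0 z \<and> i = 0 \<or> crd i z = crd 1 z \<and> i = 1 \<or> crd i z = crd 2 z \<and> i > 1"
  by (auto simp: crd_def)

lemma crd_diff [simp]: "crd i (z - w) = crd i z - crd i w"
  by (simp add: crd_def)

lemma all_crd: "(\<And>i. i = 0 \<or> i = 1 \<or> i = 2 \<Longrightarrow> P (crd i)) \<Longrightarrow> P (crd j)"
proof -
  assume a: "\<And>i. i = 0 \<or> i = 1 \<or> i = 2 \<Longrightarrow> P (crd i)"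
  have "crd j = crd 0 \<or> crd j = crd 1 \<or> crd j = crd 2" by (auto simp: crd_def fun_eq_iff)
  then show ?thesis using a[of 0] a[of 1] a[of 2] by auto
qed

lemma crd_le_nrm1: "cmod (crd i z) \<le> nrm1 z"
  by (rule all_crd[of "\<lambda>c. cmod (c z) \<le> nrm1 z"]) (auto simp: nrm1_def)

lemma nrm1_le: "(\<And>i. cmod (crd i z) \<le> b) \<Longrightarrow> nrm1 z \<le> 3 * b"
  unfolding nrm1_def by (smt (verit, best))

lemma nrm1_triangle: "nrm1 (z - w) \<le> nrm1 (z - p) + nrm1 (w - p)"
proof -
  have "cmod (crd i z - crd i w) \<le> cmod (crd i z - crd i p) + cmod (crd i w - crd i p)" for i
    using norm_triangle_ineq4[of "crd i z - crd i p" "crd i w - crd i p"] by simp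
  from this[of 0] this[of 1] this[of 2] show ?thesis unfolding nrm1_def crd_diff by linarith
qed

lemma tendsto_pointI:
  assumes "\<And>i. (\<lambda>n. crd i (f n)) \<longlonglongrightarrow> crd i l"
  shows "f \<longlonglongrightarrow> (l :: point)"
proof -
  have "(\<lambda>n. (crd 0 (f n), crd 1 (f n), crd 2 (f n))) \<longlonglongrightarrow> (crd 0 l, crd 1 l, crd 2 l)"
    by (intro tendsto_Pair assms)
  then show ?thesis by simp
qed

text \<open>The invariant class \<open>adm\<close> separates the convergence argument from the a
  priori estimates. It contains the identity, is closed under pointwise limits on the domain and
  under the Picard step, and confines values to \<open>T\<close>, where X is Lipschitz.\<close>

locale picard =
  fixes A B C :: "complex set" and y0 :: complex and D M \<Lambda> C0 :: real and X :: vfield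
    and T :: "point set" and V :: "point \<Rightarrow> complex" and adm :: "(point \<Rightarrow> point) \<Rightarrow> bool"
  assumes A: "open A" and B: "open B" "convex B" "y0 \<in> B" and C: "open C"
    and D: "\<And>y. y \<in> B \<Longrightarrow> cmod (y - y0) \<le> D"
    and V: "holomorphic3_on V (A \<times> B \<times> C)" "\<And>z. z \<in> A \<times> B \<times> C \<Longrightarrow> V z \<noteq> 0"
    and M: "\<And>z. z \<in> A \<times> B \<times> C \<Longrightarrow> 1 / cmod (V z) \<le> M" "0 \<le> M"
    and X: "\<And>i. holomorphic3_on (\<lambda>z. crd i (X z)) T"
    and lip: "\<And>i z w. z \<in> T \<Longrightarrow> w \<in> T \<Longrightarrow> cmod (crd i (X z) - crd i (X w)) \<le> \<Lambda> * nrm1 (z - w)" "0 \<le> \<Lambda>"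
    and adm_id: "adm (\<lambda>z. z)"
    and adm_T: "\<And>\<Psi> z. adm \<Psi> \<Longrightarrow> z \<in> A \<times> B \<times> C \<Longrightarrow> \<Psi> z \<in> T"
    and adm_bound: "\<And>\<Psi> z. adm \<Psi> \<Longrightarrow> z \<in> A \<times> B \<times> C \<Longrightarrow> nrm1 (\<Psi> z - z) \<le> C0"
    and adm_lim: "\<And>F G. (\<And>n::nat. adm (F n)) \<Longrightarrow> (\<And>z. z \<in> A \<times> B \<times> C \<Longrightarrow> (\<lambda>n. F n z) \<longlonglongrightarrow> G z) \<Longrightarrow> adm G"
    and adm_step: "\<And>\<Psi> \<Psi>'. adm \<Psi> \<Longrightarrow> (\<And>i. holomorphic3_on (\<lambda>z. crd i (\<Psi> z)) (A \<times> B \<times> C)) \<Longrightarrow>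
        (\<And>i z. z \<in> A \<times> B \<times> C \<Longrightarrow> crd i (\<Psi>' z) = crd i (fst z, y0, snd (snd z)) + yint y0 (\<lambda>z. crd i (X (\<Psi> z)) / V z) z) \<Longrightarrow> adm \<Psi>'"
begin

abbreviation "S \<equiv> A \<times> B \<times> C"

lemma S: "open S" using A B C by (simp add: open_Times)

lemma D0: "0 \<le> D" using D[OF B(3)] by simp

definition hol :: "(point \<Rightarrow> point) \<Rightarrow> bool" where
  "hol \<Psi> \<longleftrightarrow> (\<forall>i. holomorphic3_on (\<lambda>z. crd i (\<Psi> z)) S)"

definition rhs :: "nat \<Rightarrow> (point \<Rightarrow> point) \<Rightarrow> point \<Rightarrow> complex" where
  "rhs i \<Psi> z = crd i (X (\<Psi> z)) / V z"

text \<open>The integral operator of dPsi/dy = X(Psi) / V with initial value (x, y0, q) at y = y0;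
  this is why the middle component starts from the constant \<open>y0\<close>.\<close>

definition step :: "(point \<Rightarrow> point) \<Rightarrow> point \<Rightarrow> point" where
  "step \<Psi> z = (fst z + yint y0 (rhs 0 \<Psi>) z, y0 + yint y0 (rhs 1 \<Psi>) z, snd (snd z) + yint y0 (rhs 2 \<Psi>) z)"

lemma crd_step: "crd i (step \<Psi> z) = crd i (fst z, y0, snd (snd z)) + yint y0 (rhs i \<Psi>) z"
proof -
  have "rhs i \<Psi> = rhs 0 \<Psi> \<and> i = 0 \<or> rhs i \<Psi> = rhs 1 \<Psi> \<and> i = 1 \<or> rhs i \<Psi> = rhs 2 \<Psi> \<and> i > 1"
    by (auto simp: rhs_def crd_def fun_eq_iff)
  then show ?thesis by (auto simp: step_def crd_def)
qed

lemma hol_rhs: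
  assumes "adm \<Psi>" "hol \<Psi>"
  shows "holomorphic3_on (rhs i \<Psi>) S"
proof -
  have h: "holomorphic3_on (\<lambda>z. crd j (\<Psi> z)) S" for j using assms by (simp add: hol_def)
  have "holomorphic3_on (\<lambda>z. (\<lambda>z. crd i (X z)) (crd 0 (\<Psi> z), crd 1 (\<Psi> z), crd 2 (\<Psi> z))) S"
    by (rule hol3_compose[OF X h h h]) (use adm_T[OF assms(1)] in simp)
  then have "holomorphic3_on (\<lambda>z. crd i (X (\<Psi> z))) S" by simp
  then show ?thesis unfolding rhs_def by (rule hol3_divide[OF S _ V])
qed

lemma adm_hol_step:
  assumes "adm \<Psi>" "hol \<Psi>"
  shows "adm (step \<Psi>)" "hol (step \<Psi>)"
proof -
  show "adm (step \<Psi>)"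
    by (rule adm_step[OF assms(1)]) (use assms(2) in \<open>auto simp: crd_step hol_def rhs_def[abs_def]\<close>)
  have base: "holomorphic3_on (\<lambda>z. crd i (fst z, y0, snd (snd z))) S" for i
    by (rule all_crd[of "\<lambda>c. holomorphic3_on (\<lambda>z. c (fst z, y0, snd (snd z))) S"])
      (auto simp: hol3_coords[OF S] hol3_const[OF S])
  show "hol (step \<Psi>)" unfolding hol_def crd_step
    by (intro allI hol3_add[OF S base] yint_hol3[OF A B C hol_rhs[OF assms]])
qed

lemma rhs_diff:
  assumes "adm \<Psi>" "adm \<Psi>'" "z \<in> S"
  shows "cmod (rhs i \<Psi> z - rhs i \<Psi>' z) \<le> \<Lambda> * M * nrm1 (\<Psi> z - \<Psi>' z)"
proof -
  have "cmod (rhs i \<Psi> z - rhs i \<Psi>' z) = cmod (crd i (X (\<Psi> z)) - crd i (X (\<Psi>' z))) * (1 / cmod (V z))"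
    by (simp add: rhs_def norm_divide flip: diff_divide_distrib)
  also have "\<dots> \<le> (\<Lambda> * nrm1 (\<Psi> z - \<Psi>' z)) * M"
    by (rule mult_mono) (use lip M assms adm_T in \<open>auto simp: nrm1_def\<close>)
  finally show ?thesis by (simp add: mult_ac)
qed

text \<open>The majorant is left open because two are needed: an exponential one for the
  contraction, and a linear one for passing to the limit in the fixed point equation.\<close>

lemma step_diff:
  fixes h h' :: "real \<Rightarrow> real"
  assumes \<Psi>: "adm \<Psi>" "hol \<Psi>" "adm \<Psi>'" "hol \<Psi>'"
    and h: "\<And>\<xi>. (h has_real_derivative h' \<xi>) (at \<xi>)"
    and bd: "\<And>x y q. (x, y, q) \<in> S \<Longrightarrow> \<Lambda> * M * nrm1 (\<Psi> (x, y, q) - \<Psi>' (x, y, q)) \<le> h' (cmod (y - y0))"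
    and z: "(x, y, q) \<in> S"
  shows "cmod (crd i (step \<Psi> (x, y, q)) - crd i (step \<Psi>' (x, y, q))) \<le> h (cmod (y - y0)) - h 0"
proof -
  note hr = hol_rhs[OF \<Psi>(1,2), of i] hol_rhs[OF \<Psi>(3,4), of i]
  have "crd i (step \<Psi> (x, y, q)) - crd i (step \<Psi>' (x, y, q)) = yint y0 (\<lambda>z. rhs i \<Psi> z - rhs i \<Psi>' z) (x, y, q)"
    unfolding crd_step using yint_diff[OF B hr z] by simp
  also have "cmod \<dots> \<le> h (cmod (y - y0)) - h 0"
  proof (rule yint_bound[OF B hol3_diff[OF S hr] z h])
    fix \<eta> assume "\<eta> \<in> B"
    then have z': "(x, \<eta>, q) \<in> S" using z by auto
    show "cmod (rhs i \<Psi> (x, \<eta>, q) - rhs i \<Psi>' (x, \<eta>, q)) \<le> h' (cmod (\<eta> - y0))"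
      using rhs_diff[OF \<Psi>(1,3) z', of i] bd[OF z'] by linarith
  qed
  finally show ?thesis .
qed

definition it :: "nat \<Rightarrow> point \<Rightarrow> point" where "it n = (step ^^ n) (\<lambda>z. z)"

lemma it_Suc: "it (Suc n) = step (it n)" by (simp add: it_def)

lemma adm_hol_it: "adm (it n) \<and> hol (it n)"
proof (induction n)
  case 0
  have "hol (\<lambda>z. z)" unfolding hol_def
  proof
    show "holomorphic3_on (\<lambda>z. crd i z) S" for i
      by (rule all_crd[of "\<lambda>c. holomorphic3_on c S"]) (use hol3_coords[OF S] in \<open>auto simp: crd_def[abs_def]\<close>)
  qed
  then show ?case using adm_id by (simp add: it_def)
qed (simp add: it_Suc adm_hol_step)

definition l where "l = 3 * \<Lambda> * M"

lemma l0: "0 \<le> l" using M(2) lip(2) by (simp add: l_def)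

text \<open>Bielecki's weight: integrating l * exp (2 * l * \<xi>) yields half of exp (2 * l *
  \<xi>), so each step gains a factor 1/2 whatever the size of l * D. The initial 2 * C0 arises
  because the first two iterates are both within C0 of the identity.\<close>

lemma it_diff:
  "(x, y, q) \<in> S \<Longrightarrow> nrm1 (it (Suc n) (x, y, q) - it n (x, y, q)) \<le> 2 * C0 * (1/2) ^ n * exp (2 * l * cmod (y - y0))"
proof (induction n arbitrary: x y q)
  case 0
  have "nrm1 (it (Suc 0) (x, y, q) - it 0 (x, y, q)) \<le> nrm1 (it (Suc 0) (x, y, q) - (x, y, q)) + nrm1 (it 0 (x, y, q) - (x, y, q))"
    by (rule nrm1_triangle)
  also have "\<dots> \<le> 2 * C0" using adm_bound[OF _ 0] adm_hol_it by (smt (verit, best))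
  also have "\<dots> \<le> 2 * C0 * exp (2 * l * cmod (y - y0))"
  proof -
    have "0 \<le> C0" using adm_bound[OF adm_id 0] by (simp add: nrm1_def)
    moreover have "1 \<le> exp (2 * l * cmod (y - y0))" using l0 by simp
    ultimately show ?thesis by (metis mult_left_mono mult.right_neutral mult_nonneg_nonneg zero_le_numeral)
  qed
  finally show ?case by simp
next
  case (Suc n)
  \<comment> \<open>A third of the target, since \<open>nrm1\<close> adds up three
    coordinates.\<close>
  define c where "c = 2 * C0 * (1/2) ^ Suc n / 3"
  have C0: "0 \<le> C0" using adm_bound[OF adm_id Suc.prems] by (simp add: nrm1_def)
  then have c0: "0 \<le> c" by (simp add: c_def)
  define h where "h = (\<lambda>\<xi>. c * exp (2 * l * \<xi>))"
  define h' where "h' = (\<lambda>\<xi>. c * (2 * l * exp (2 * l * \<xi>)))"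
  have hd: "(h has_real_derivative h' \<xi>) (at \<xi>)" for \<xi>
    unfolding h_def h'_def by (auto intro!: derivative_eq_intros)
  have "cmod (crd i (it (Suc (Suc n)) (x, y, q)) - crd i (it (Suc n) (x, y, q))) \<le> h (cmod (y - y0)) - h 0" for i
    unfolding it_Suc[of "Suc n"] it_Suc[of n]
  proof (rule step_diff[OF _ _ _ _ hd _ Suc.prems])
    fix x y q assume z: "(x, y, q) \<in> S"
    have "\<Lambda> * M * nrm1 (step (it n) (x, y, q) - it n (x, y, q)) \<le> \<Lambda> * M * (2 * C0 * (1/2) ^ n * exp (2 * l * cmod (y - y0)))"
      using Suc.IH[OF z] M(2) lip(2) by (intro mult_left_mono) (auto simp: it_Suc)
    also have "\<dots> = h' (cmod (y - y0))" by (simp add: h'_def c_def l_def)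
    finally show "\<Lambda> * M * nrm1 (step (it n) (x, y, q) - it n (x, y, q)) \<le> h' (cmod (y - y0))" .
  qed (use adm_hol_it[of n] adm_hol_step in auto)
  then have "cmod (crd i (it (Suc (Suc n)) (x, y, q) - it (Suc n) (x, y, q))) \<le> h (cmod (y - y0))" for i
    using c0 by (smt (verit, best) crd_diff h_def exp_gt_zero mult_nonneg_nonneg)
  from nrm1_le[OF this] show ?case by (simp add: h_def c_def)
qed

text \<open>The bound |y - y0| \<le> D makes the weights uniform, so the telescoping series of
  iterates converges uniformly and its sum is holomorphic and admissible. The estimate
  \<open>step_diff\<close> then shows that the step commutes with this limit.\<close>

theorem fixpoint:
  obtains \<Psi> where "adm \<Psi>" "\<And>i. holomorphic3_on (\<lambda>z. crd i (\<Psi> z)) S"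
    "\<And>i z. z \<in> S \<Longrightarrow> crd i (\<Psi> z) = crd i (fst z, y0, snd (snd z)) + yint y0 (\<lambda>z. crd i (X (\<Psi> z)) / V z) z"
proof -
  define b where "b = (\<lambda>n. 2 * C0 * exp (2 * l * D) * (1/2) ^ n)"
  have sb: "summable b" unfolding b_def by (intro summable_mult summable_geometric) simp
  have d: "cmod (crd i (it (Suc n) z) - crd i (it n z)) \<le> b n" if "z \<in> S" for i n z
  proof -
    obtain x y q where z: "z = (x, y, q)" by (metis prod_cases3)
    have C0: "0 \<le> C0" using adm_bound[OF adm_id that] by (simp add: nrm1_def)
    have "exp (2 * l * cmod (y - y0)) \<le> exp (2 * l * D)"
      using D[of y] that z l0 by (auto intro: mult_left_mono)
    then have "2 * C0 * (1/2) ^ n * exp (2 * l * cmod (y - y0)) \<le> 2 * C0 * (1/2) ^ n * exp (2 * l * D)"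
      using C0 by (intro mult_left_mono) auto
    then show ?thesis
      using it_diff[of x y q n] crd_le_nrm1[of i "it (Suc n) z - it n z"] that unfolding z b_def crd_diff by (simp add: mult_ac)
  qed
  define g where "g = (\<lambda>i z. crd i z + (\<Sum>n. crd i (it (Suc n) z) - crd i (it n z)))"
  have tel: "(\<Sum>n<N. crd i (it (Suc n) z) - crd i (it n z)) = crd i (it N z) - crd i z" for N i z
    by (induction N) (auto simp: it_def)
  have ul: "uniform_limit S (\<lambda>N z. crd i (it N z)) (g i) sequentially" for i
  proof -
    have "uniform_limit S (\<lambda>N z. \<Sum>n<N. crd i (it (Suc n) z) - crd i (it n z)) (\<lambda>z. \<Sum>n. crd i (it (Suc n) z) - crd i (it n z)) sequentially"
      by (rule Weierstrass_m_test[OF _ sb]) (rule d)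
    from uniform_limit_add[OF uniform_limit_const[where c = "crd i" and S = S] this]
    show ?thesis unfolding tel g_def by simp
  qed
  define \<Psi> where "\<Psi> = (\<lambda>z. (g 0 z, g 1 z, g 2 z))"
  have crd\<Psi>: "crd i (\<Psi> z) = g i z" for i z
  proof -
    have "g i = g 0 \<and> i = 0 \<or> g i = g 1 \<and> i = 1 \<or> g i = g 2 \<and> i > 1" by (auto simp: g_def crd_def fun_eq_iff)
    then show ?thesis by (auto simp: \<Psi>_def crd_def)
  qed
  have lim: "(\<lambda>N. crd i (it N z)) \<longlonglongrightarrow> crd i (\<Psi> z)" if "z \<in> S" for i z
    unfolding crd\<Psi> by (rule tendsto_uniform_limitI[OF ul that])
  have adm\<Psi>: "adm \<Psi>"
  proof (rule adm_lim)
    show "adm (it n)" for n using adm_hol_it by blast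
    show "(\<lambda>n. it n z) \<longlonglongrightarrow> \<Psi> z" if "z \<in> S" for z by (rule tendsto_pointI) (rule lim[OF that])
  qed
  have hol\<Psi>: "hol \<Psi>" unfolding hol_def
  proof
    show "holomorphic3_on (\<lambda>z. crd i (\<Psi> z)) S" for i
      unfolding crd\<Psi> using hol3_uniform_limit[OF S _ ul[of i]] adm_hol_it by (simp add: hol_def)
  qed
  have fixp: "crd i (\<Psi> z) = crd i (step \<Psi> z)" if z: "z \<in> S" for i z
  proof -
    obtain x y q where xyq: "z = (x, y, q)" by (metis prod_cases3)
    have "(\<lambda>N. crd i (it (Suc N) z)) \<longlonglongrightarrow> crd i (step \<Psi> z)"
    proof (rule LIMSEQ_I)
      fix r :: real assume r: "r > 0"
      \<comment> \<open>Chosen so that l * D * e is at most r / 2; the summand 1 keeps the quotient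
        meaningful when l * D = 0.\<close>
      define e where "e = r / (2 * (l * D + 1))"
      have lD: "0 \<le> l * D" using l0 D0 by simp
      then have e: "e > 0" using r by (simp add: e_def)
      have ev: "\<forall>\<^sub>F N in sequentially. \<forall>z\<in>S. cmod (crd j (it N z) - crd j (\<Psi> z)) < e" for j
        using uniform_limitD[OF ul[of j] e] by (simp add: dist_norm crd\<Psi>)
      have "\<forall>\<^sub>F N in sequentially. \<forall>z\<in>S. nrm1 (it N z - \<Psi> z) \<le> 3 * e"
        using ev[of 0] ev[of 1] ev[of 2]
        by eventually_elim (force simp: nrm1_def)
      then obtain N0 where N0: "\<And>N z. N \<ge> N0 \<Longrightarrow> z \<in> S \<Longrightarrow> nrm1 (it N z - \<Psi> z) \<le> 3 * e"
        unfolding eventually_sequentially by blast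
      show "\<exists>N0. \<forall>N\<ge>N0. norm (crd i (it (Suc N) z) - crd i (step \<Psi> z)) < r"
      proof (intro exI[of _ N0] allI impI)
        fix N assume N: "N \<ge> N0"
        have "cmod (crd i (step (it N) (x, y, q)) - crd i (step \<Psi> (x, y, q))) \<le> l * e * cmod (y - y0) - l * e * 0"
        proof (rule step_diff[where h = "\<lambda>\<xi>. l * e * \<xi>" and h' = "\<lambda>_. l * e"])
          show "((\<lambda>\<xi>. l * e * \<xi>) has_real_derivative l * e) (at \<xi>)" for \<xi> by (auto intro!: derivative_eq_intros)
          fix x y q assume "(x, y, q) \<in> S"
          from N0[OF N this] have "\<Lambda> * M * nrm1 (it N (x, y, q) - \<Psi> (x, y, q)) \<le> \<Lambda> * M * (3 * e)"
            using M(2) lip(2) by (intro mult_left_mono) auto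
          then show "\<Lambda> * M * nrm1 (it N (x, y, q) - \<Psi> (x, y, q)) \<le> l * e" by (simp add: l_def mult_ac)
        qed (use adm_hol_it adm\<Psi> hol\<Psi> z xyq in auto)
        also have "\<dots> \<le> l * e * D" using D[of y] z xyq l0 e by (auto intro: mult_left_mono)
        also have "\<dots> = (l * D) / (l * D + 1) * (r / 2)" by (simp add: e_def algebra_simps)
        also have "\<dots> \<le> 1 * (r / 2)" using lD r by (intro mult_right_mono) auto
        also have "\<dots> < r" using r by simp
        finally show "norm (crd i (it (Suc N) z) - crd i (step \<Psi> z)) < r" by (simp add: it_Suc xyq)
      qed
    qed
    moreover have "(\<lambda>N. crd i (it (Suc N) z)) \<longlonglongrightarrow> crd i (\<Psi> z)" by (rule LIMSEQ_Suc[OF lim[OF z]])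
    ultimately show ?thesis by (rule LIMSEQ_unique[OF _ _, symmetric])
  qed
  show ?thesis
    by (rule that[OF adm\<Psi>]) (use hol\<Psi> fixp in \<open>auto simp: hol_def crd_step rhs_def[abs_def]\<close>)
qed

end

section \<open>Relative variation of a non-vanishing function\<close>

lemma yint_real:
  assumes "y0 \<in> \<real>" "y \<in> \<real>" "\<And>\<eta>. \<eta> \<in> closed_segment y0 y \<Longrightarrow> \<eta> \<in> \<real> \<Longrightarrow> f (x, \<eta>, q) \<in> \<real>"
  shows "yint y0 f (x, y, q) \<in> \<real>"
proof -
  let ?g = "\<lambda>\<theta>. f (x, linepath y0 y \<theta>, q) * (y - y0)"
  have g: "?g \<theta> \<in> \<real>" if "\<theta> \<in> {0..1}" for \<theta>
  proof -
    have "linepath y0 y \<theta> \<in> \<real>" using assms(1,2) by (auto simp: linepath_def scaleR_conv_of_real)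
    moreover have "linepath y0 y \<theta> \<in> closed_segment y0 y" using that by (auto simp: linepath_in_path)
    ultimately show ?thesis using assms by (intro Reals_mult Reals_diff) auto
  qed
  show ?thesis
  proof (cases "?g integrable_on {0..1}")
    case True
    have "Im (integral {0..1} ?g) = integral {0..1} (Im \<circ> ?g)"
      by (rule integral_linear[OF True bounded_linear_Im, symmetric])
    also have "\<dots> = integral {0..1} (\<lambda>_::real. 0)"
      by (rule integral_cong) (use g in \<open>auto simp: complex_is_Real_iff\<close>)
    finally show ?thesis by (simp add: yint_integral complex_is_Real_iff)
  next
    case False
    \<comment> \<open>A non-integrable function has integral 0 by convention, which is real.\<close>
    then show ?thesis unfolding yint_integral by (metis not_integrable_integral Reals_0)
  qed
qed

lemma yint_cong:
  assumes "\<And>\<eta>. \<eta> \<in> closed_segment y0 y \<Longrightarrow> f (x, \<eta>, q) = g (x', \<eta>, q')"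
  shows "yint y0 f (x, y, q) = yint y0 g (x', y, q')"
  unfolding yint_def prod.case by (rule contour_integral_cong) (use assms in auto)

lemma yint_const: "yint y0 (\<lambda>_. 1) (x, y, q) = y - y0"
  by (simp add: yint_integral)

text \<open>Along the segment, f = v / v(x, y) satisfies f' = f * g, with g the logarithmic
  derivative and |g| \<le> \<kappa>. With K the maximum of |f| one gets |f - 1| \<le> \<kappa> K,
  hence K \<le> 1 / (1 - \<kappa>), and no branch of the logarithm has to be chosen.\<close>

lemma ratio_bound:
  fixes v :: "complex \<times> complex \<Rightarrow> complex"
  assumes conn: "connected I" "connected Y"
    and hol: "holomorphic3_on (\<lambda>(x, y, q). v (x, y)) (dom3 I Y (r, \<sigma>, s))" and s: "s > 0"
    and nz: "\<And>z. z \<in> dom2 I Y r \<sigma> \<Longrightarrow> v z \<noteq> 0"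
    and \<alpha>: "\<And>z. z \<in> dom2 I Y r \<sigma> \<Longrightarrow> cmod (dI v z / v z) \<le> \<alpha>"
    and \<beta>: "\<And>z. z \<in> dom2 I Y r \<sigma> \<Longrightarrow> cmod (dy v z / v z) \<le> \<beta>"
    and xy: "(x, y) \<in> dom2 I Y r \<sigma>" "(x', y') \<in> dom2 I Y r \<sigma>"
    and \<kappa>: "\<alpha> * cmod (x' - x) + \<beta> * cmod (y' - y) \<le> \<kappa>" "\<kappa> \<le> 1/2"
  shows "cmod (v (x', y') / v (x, y) - 1) \<le> (1 + 2 * \<kappa>) * \<kappa>"
proof -
  let ?V = "\<lambda>(x, y, q). v (x, y)" and ?a = "x' - x" and ?b = "y' - y"
  let ?l = "\<lambda>\<theta>::real. (x + of_real \<theta> * ?a, y + of_real \<theta> * ?b)"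
  have seg: "?l \<theta> \<in> dom2 I Y r \<sigma>" if "\<theta> \<in> {0..1}" for \<theta>
  proof -
    have "x + of_real \<theta> * ?a = (1 - \<theta>) *\<^sub>R x + \<theta> *\<^sub>R x'" "y + of_real \<theta> * ?b = (1 - \<theta>) *\<^sub>R y + \<theta> *\<^sub>R y'"
      by (simp_all add: scaleR_conv_of_real algebra_simps)
    then show ?thesis using convexD_alt[OF convex_cnbhd] conn xy that by (simp add: dom2_def)
  qed
  let ?f = "\<lambda>\<theta>. v (?l \<theta>) / v (x, y)"
  have der: "(?f has_vector_derivative ?f \<theta> * (dI v (?l \<theta>) / v (?l \<theta>) * ?a + dy v (?l \<theta>) / v (?l \<theta>) * ?b)) (at \<theta>)"
    if "\<theta> \<in> {0..1}" for \<theta>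
  proof -
    obtain X Y' where XY: "?l \<theta> = (X, Y')" by force
    then have in3: "(X, Y', 0) \<in> dom3 I Y (r, \<sigma>, s)" using seg[OF that] s by (auto simp: dom2_def strip_def)
    have pd: "pd1 ?V (X, Y', 0) = dI v (X, Y')" "pd2 ?V (X, Y', 0) = dy v (X, Y')"
      by (simp_all add: pd1_def pd2_def dI_def dy_def)
    have c: "((\<lambda>\<theta>. (x + of_real \<theta> * ?a, y + of_real \<theta> * ?b, 0)) has_derivative (\<lambda>h. (of_real h * ?a, of_real h * ?b, 0))) (at \<theta>)"
      by (auto intro!: derivative_eq_intros simp: zero_prod_def)
    have H: "(?V has_derivative (\<lambda>(h, k, l). pd1 ?V (X, Y', 0) * h + pd2 ?V (X, Y', 0) * k + pd3 ?V (X, Y', 0) * l))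
        (at (x + of_real \<theta> * ?a, y + of_real \<theta> * ?b, 0))"
      using hol3_has_derivative[OF hol in3] XY by simp
    note has_derivative_compose[OF c H]
    then have "((\<lambda>\<theta>. v (?l \<theta>)) has_vector_derivative dI v (X, Y') * ?a + dy v (X, Y') * ?b) (at \<theta>)"
      unfolding has_vector_derivative_def by (simp add: pd scaleR_conv_of_real algebra_simps)
    then have "(?f has_vector_derivative (dI v (X, Y') * ?a + dy v (X, Y') * ?b) / v (x, y)) (at \<theta>)"
      by (rule has_vector_derivative_divide)
    moreover have "v (X, Y') \<noteq> 0" using nz[OF seg[OF that]] XY by simp
    then have "(dI v (X, Y') * ?a + dy v (X, Y') * ?b) / v (x, y) =
        v (X, Y') / v (x, y) * (dI v (X, Y') / v (X, Y') * ?a + dy v (X, Y') / v (X, Y') * ?b)"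
      by (simp add: divide_simps)
    ultimately show ?thesis unfolding XY by simp
  qed
  have cont: "continuous_on {0..1} ?f"
    by (rule continuous_at_imp_continuous_on) (use der has_vector_derivative_continuous in blast)
  obtain m where m: "m \<in> {0..1}" "\<And>\<theta>. \<theta> \<in> {0..1} \<Longrightarrow> cmod (?f \<theta>) \<le> cmod (?f m)"
    using continuous_attains_sup[of "{0..1::real}" "\<lambda>\<theta>. cmod (?f \<theta>)"] continuous_on_norm[OF cont] by auto
  define K where "K = cmod (?f m)"
  have f0: "?f 0 = 1" using nz[OF xy(1)] by simp
  have k0: "0 \<le> \<kappa>"
  proof -
    have "0 \<le> \<alpha>" "0 \<le> \<beta>" using \<alpha>[OF xy(1)] \<beta>[OF xy(1)] order_trans[OF norm_ge_zero] by blast+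
    then have "0 \<le> \<alpha> * cmod ?a + \<beta> * cmod ?b" by simp
    then show ?thesis using \<kappa>(1) by linarith
  qed
  have near: "cmod (?f \<theta> - 1) \<le> \<kappa> * K" if "\<theta> \<in> {0..1}" for \<theta>
  proof (cases "\<theta> = 0")
    case True
    then show ?thesis using f0 k0 by (simp add: K_def)
  next
    case False
    have "norm (?f \<theta> - ?f 0) \<le> \<kappa> * K * \<theta> - \<kappa> * K * 0"
    proof (rule differentiable_bound_general[where \<phi>' = "\<lambda>_. \<kappa> * K"])
      show "continuous_on {0..\<theta>} ?f" by (rule continuous_on_subset[OF cont]) (use that in auto)
      fix \<zeta> assume z: "0 < \<zeta>" "\<zeta> < \<theta>"
      then have z1: "\<zeta> \<in> {0..1}" using that by auto
      show "(?f has_vector_derivative ?f \<zeta> * (dI v (?l \<zeta>) / v (?l \<zeta>) * ?a + dy v (?l \<zeta>) / v (?l \<zeta>) * ?b)) (at \<zeta>)" by (rule der[OF z1])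
      have "cmod (dI v (?l \<zeta>) / v (?l \<zeta>) * ?a + dy v (?l \<zeta>) / v (?l \<zeta>) * ?b) \<le> \<alpha> * cmod ?a + \<beta> * cmod ?b"
        by (intro norm_triangle_le add_mono) (simp_all only: norm_mult mult_right_mono[OF \<alpha>[OF seg[OF z1]]] mult_right_mono[OF \<beta>[OF seg[OF z1]]] norm_ge_zero)
      then have "cmod (dI v (?l \<zeta>) / v (?l \<zeta>) * ?a + dy v (?l \<zeta>) / v (?l \<zeta>) * ?b) \<le> \<kappa>" using \<kappa>(1) by linarith
      then have "cmod (?f \<zeta>) * cmod (dI v (?l \<zeta>) / v (?l \<zeta>) * ?a + dy v (?l \<zeta>) / v (?l \<zeta>) * ?b) \<le> K * \<kappa>"
        by (intro mult_mono) (use m(2)[OF z1] K_def in auto)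
      then show "cmod (?f \<zeta> * (dI v (?l \<zeta>) / v (?l \<zeta>) * ?a + dy v (?l \<zeta>) / v (?l \<zeta>) * ?b)) \<le> \<kappa> * K"
        unfolding norm_mult[of "?f \<zeta>"] by (simp only: mult.commute)
    qed (use that False in \<open>auto intro!: continuous_intros derivative_eq_intros simp: has_real_derivative_iff_has_vector_derivative[symmetric]\<close>)
    then have "cmod (?f \<theta> - 1) \<le> \<kappa> * K * \<theta>" unfolding f0 by simp
    also have "\<dots> \<le> \<kappa> * K" using that k0 by (intro mult_left_le) (auto simp: K_def)
    finally show ?thesis .
  qed
  have K: "K \<le> 1 + \<kappa> * K"
    using near[OF m(1)] norm_triangle_ineq[of 1 "?f m - 1"] by (simp add: K_def)
  have K0: "0 \<le> K" by (simp add: K_def)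
  have near1: "cmod (v (x', y') / v (x, y) - 1) \<le> \<kappa> * K" using near[of 1] by simp
  have "K * (1 - \<kappa>) \<le> 1" using K by (simp add: algebra_simps)
  \<comment> \<open>This is where \<kappa> \<le> 1/2 enters: it replaces 1 / (1 - \<kappa>) by the
    linear bound 1 + 2 * \<kappa>.\<close>
  moreover have "1 \<le> (1 + 2 * \<kappa>) * (1 - \<kappa>)"
  proof -
    have "0 \<le> \<kappa> * (1 - 2 * \<kappa>)" using k0 \<kappa>(2) by simp
    then show ?thesis by (simp add: algebra_simps)
  qed
  ultimately have "K * (1 - \<kappa>) \<le> (1 + 2 * \<kappa>) * (1 - \<kappa>)" by linarith
  then have "K \<le> 1 + 2 * \<kappa>" using \<kappa>(2) by (simp add: mult_le_cancel_right)
  then have "\<kappa> * K \<le> \<kappa> * (1 + 2 * \<kappa>)" using k0 by (intro mult_left_mono) auto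
  then show ?thesis using near1 by (simp add: mult.commute)
qed

section \<open>The characteristic equation of a driven system\<close>

abbreviation reals3 :: "point set" where "reals3 \<equiv> \<real> \<times> \<real> \<times> \<real>"

abbreviation shift :: "point \<Rightarrow> point" where "shift z \<equiv> z + (0, 0, 2 * of_real pi)"

lemma reals3_iff: "z \<in> reals3 \<longleftrightarrow> (\<forall>i. crd i z \<in> \<real>)"
proof
  show "z \<in> reals3 \<Longrightarrow> \<forall>i. crd i z \<in> \<real>" by (auto simp: crd_def)
  assume "\<forall>i. crd i z \<in> \<real>"
  then have "crd 0 z \<in> \<real>" "crd 1 z \<in> \<real>" "crd 2 z \<in> \<real>" by blast+
  then show "z \<in> reals3" by (cases z) auto
qed

text \<open>All norms have become suprema: \<open>W\<close> stands for |||P|||, \<open>M\<close> for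
  the norm of 1 / v, \<open>Bx\<close> for a common bound on the components of X. The bounds on
  \<open>dy v / v\<close>, \<open>dI v / v\<close> and \<open>\<omega> / v\<close> are chi \<le> 1,
  \<theta>2 \<le> 1 and the first entry of the maximum \<eta>^2, solved for the quotients;
  \<open>small\<close> comes from the second entry.\<close>

locale driven_system =
  fixes I Y :: "real set" and r \<sigma> s \<rho> \<tau> t s2 D M W y1 Bx :: real
    and v \<omega> :: "complex \<times> complex \<Rightarrow> complex" and X P :: vfield
  assumes conn: "connected I" "connected Y" and y1: "y1 \<in> Y"
    and pos: "\<rho> > 0" "\<tau> > 0" "t > 0" "s2 > 0" "M \<ge> 0" "W \<ge> 0"
    and room: "8 * \<rho> < r" "8 * exp s2 * \<tau> < \<sigma>" "10 * t < s"
    and holX: "\<And>i. holomorphic3_on (\<lambda>z. crd i (X z)) (dom3 I Y (r, \<sigma>, s))"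
    and holv: "holomorphic3_on (\<lambda>(x, y, q). v (x, y)) (dom3 I Y (r, \<sigma>, s))"
    and hol\<omega>: "holomorphic3_on (\<lambda>(x, y, q). \<omega> (x, y)) (dom3 I Y (r, \<sigma>, s))"
    and X: "X = (\<lambda>z. driven_field v \<omega> z + P z)"
    and P: "\<And>z. z \<in> dom3 I Y (r, \<sigma>, s) \<Longrightarrow> cmod (crd 0 (P z)) \<le> \<rho> * W"
      "\<And>z. z \<in> dom3 I Y (r, \<sigma>, s) \<Longrightarrow> cmod (crd 1 (P z)) \<le> \<tau> * W"
      "\<And>z. z \<in> dom3 I Y (r, \<sigma>, s) \<Longrightarrow> cmod (crd 2 (P z)) \<le> t * W"
    and XB: "\<And>i z. z \<in> dom3 I Y (r, \<sigma>, s) \<Longrightarrow> cmod (crd i (X z)) \<le> Bx"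
    and periodic: "\<And>z. z \<in> dom3 I Y (r, \<sigma>, s) \<Longrightarrow> X (shift z) = X z"
    and realX: "\<And>z. z \<in> dom3 I Y (r, \<sigma>, s) \<Longrightarrow> z \<in> reals3 \<Longrightarrow> X z \<in> reals3"
    and realN: "\<And>x y. (x, y) \<in> dom2 I Y r \<sigma> \<Longrightarrow> x \<in> \<real> \<Longrightarrow> y \<in> \<real> \<Longrightarrow> v (x, y) \<in> \<real> \<and> \<omega> (x, y) \<in> \<real>"
    and v0: "\<And>z. z \<in> dom2 I Y r \<sigma> \<Longrightarrow> v z \<noteq> 0"
    and M: "\<And>z. z \<in> dom2 I Y r \<sigma> \<Longrightarrow> 1 / cmod (v z) \<le> M"
    and D: "\<And>y y'. y \<in> cnbhd Y \<sigma> \<Longrightarrow> y' \<in> cnbhd Y \<sigma> \<Longrightarrow> cmod (y - y') \<le> D" "8 * exp s2 * \<tau> < D"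
    and dyv: "\<And>z. z \<in> dom2 I Y r \<sigma> \<Longrightarrow> cmod (dy v z / v z) \<le> s2 / D"
    and dIv: "\<And>z. z \<in> dom2 I Y r \<sigma> \<Longrightarrow> cmod (dI v z / v z) \<le> \<tau> / (4 * D * \<rho>)"
    and \<omega>v: "\<And>z. z \<in> dom2 I Y r \<sigma> \<Longrightarrow> cmod (\<omega> z / v z) \<le> t / D"
    and small: "exp s2 * (D * M * W) \<le> 1 / 32"
begin

text \<open>The relative variation of \<open>v\<close> between \<open>z\<close> and \<open>\<Psi> z\<close> is at most \<open>c0 * \<kappa>0\<close>; the displacement
  \<open>b\<close> in \<open>y\<close>, at distance \<open>\<xi>\<close> from \<open>y0\<close>, obeys \<open>b' \<le> \<mu> * b + \<nu>\<close>, an inequality whose extremal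
  solution is \<open>maj\<close>.\<close>

definition "\<epsilon> = D * M * W"
definition "\<kappa>0 = (s2 + 1) / (16 * exp s2)"
definition "c0 = 1 + 2 * \<kappa>0"
definition "\<mu> = c0 * (s2 / D)"
definition "\<nu> = (c0 / 4 + 1) * (\<tau> * \<epsilon> / D)"
definition "maj \<xi> = \<nu> / \<mu> * (exp (\<mu> * \<xi>) - 1)"

section \<open>The constants and the majorant of the displacement in y\<close>

lemma D0: "D > 0"
  using D(2) pos by (smt (verit) exp_gt_zero mult_pos_pos)

lemma E1: "1 \<le> exp s2" using pos by simp

lemma \<epsilon>: "0 \<le> \<epsilon>" "exp s2 * \<epsilon> \<le> 1/32" "\<epsilon> \<le> 1/32"
proof -
  show "0 \<le> \<epsilon>" using D0 pos by (simp add: \<epsilon>_def)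
  then have "1 * \<epsilon> \<le> exp s2 * \<epsilon>" using E1 by (intro mult_right_mono) auto
  then show "exp s2 * \<epsilon> \<le> 1/32" "\<epsilon> \<le> 1/32" using small by (auto simp: \<epsilon>_def)
qed

text \<open>The factor exp (- s2) in \<open>\<kappa>0\<close> keeps s2 * \<kappa>0 bounded for all
  s2. Consequently the exponent \<mu> * D = s2 + 2 * s2 * \<kappa>0 exceeds s2 by at most
  1/4.\<close>

lemma \<kappa>0: "0 \<le> \<kappa>0" "\<kappa>0 \<le> 1/16" "s2 * \<kappa>0 \<le> 1/8"
proof -
  show "0 \<le> \<kappa>0" using pos by (simp add: \<kappa>0_def)
  have "(s2 + 1) / (16 * exp s2) \<le> exp s2 / (16 * exp s2)"
    by (rule divide_right_mono) (auto simp: add.commute)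
  then show "\<kappa>0 \<le> 1/16" by (simp add: \<kappa>0_def)
  have "1 + s2 + s2\<^sup>2 / 2 \<le> exp s2" using pos by (intro exp_lower_Taylor_quadratic) auto
  then have "s2 * (s2 + 1) \<le> 2 * exp s2" using pos by (simp add: power2_eq_square algebra_simps)
  then show "s2 * \<kappa>0 \<le> 1/8" by (simp add: \<kappa>0_def field_simps)
qed

lemma c0: "1 \<le> c0" "c0 \<le> 9/8" using \<kappa>0 by (auto simp: c0_def)

lemma \<mu>0: "\<mu> > 0" using c0 pos D0 by (simp add: \<mu>_def)
lemma \<nu>0: "\<nu> \<ge> 0" using c0 pos D0 \<epsilon> by (simp add: \<nu>_def)

lemma maj0 [simp]: "maj 0 = 0" by (simp add: maj_def)

lemma maj_DERIV: "(maj has_real_derivative \<nu> * exp (\<mu> * \<xi>)) (at \<xi>)"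
  unfolding maj_def[abs_def] using \<mu>0 by (auto intro!: derivative_eq_intros)

text \<open>At distance D the majorant is at most \<nu> * D * exp (\<mu> * D), where \<nu> * D is of
  order \<tau> * \<epsilon> and the exponential is at most 3 * exp s2; the hypothesis exp s2 *
  \<epsilon> \<le> 1/32 absorbs the latter.\<close>

lemma maj_le: "maj \<xi> \<le> \<tau> / 2" if "\<xi> \<le> D" for \<xi>
proof -
  have "maj \<xi> \<le> maj D"
    unfolding maj_def using \<mu>0 \<nu>0 that by (intro mult_left_mono) auto
  \<comment> \<open>The inequality exp a - 1 \<le> a * exp a cancels the division by \<mu>, for
    which no lower bound is available.\<close>
  also have "\<dots> \<le> \<nu> / \<mu> * (\<mu> * D * exp (\<mu> * D))"
  proof -
    have "1 - \<mu> * D \<le> exp (- (\<mu> * D))" using exp_ge_add_one_self[of "- (\<mu> * D)"] by simp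
    then have "(1 - \<mu> * D) * exp (\<mu> * D) \<le> exp (- (\<mu> * D)) * exp (\<mu> * D)" by (intro mult_right_mono) auto
    then have "exp (\<mu> * D) - 1 \<le> \<mu> * D * exp (\<mu> * D)" by (simp add: algebra_simps flip: exp_add)
    then show ?thesis unfolding maj_def using \<mu>0 \<nu>0 by (intro mult_left_mono) auto
  qed
  also have "\<dots> = (c0 / 4 + 1) * \<tau> * \<epsilon> * exp (\<mu> * D)" using \<mu>0 D0 by (simp add: \<nu>_def)
  also have "\<dots> \<le> (c0 / 4 + 1) * \<tau> * \<epsilon> * (3 * exp s2)"
  proof (rule mult_left_mono)
    have "\<mu> * D = s2 + 2 * (s2 * \<kappa>0)" using D0 by (simp add: \<mu>_def c0_def algebra_simps)
    then have "exp (\<mu> * D) \<le> exp (1 + s2)" using \<kappa>0(3) by simp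
    also have "\<dots> = exp 1 * exp s2" by (simp add: exp_add)
    also have "\<dots> \<le> 3 * exp s2" using exp_le by (intro mult_right_mono) auto
    finally show "exp (\<mu> * D) \<le> 3 * exp s2" .
    show "0 \<le> (c0 / 4 + 1) * \<tau> * \<epsilon>" using c0 pos \<epsilon> by simp
  qed
  also have "\<dots> = \<tau> * (3 * (c0 / 4 + 1)) * (exp s2 * \<epsilon>)" by (simp add: mult_ac)
  also have "\<dots> \<le> \<tau> * (3 * (c0 / 4 + 1)) * (1/32)" using c0 pos \<epsilon> by (intro mult_left_mono) auto
  also have "\<dots> = \<tau> * (3 * (c0 / 4 + 1) * (1/32))" by (simp add: mult_ac)
  also have "\<dots> \<le> \<tau> * (1/2)" using c0 pos by (intro mult_left_mono) auto
  finally show ?thesis by simp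
qed

text \<open>The maps Psi live on \<open>S\<close> and take values in \<open>T\<close>. The margins
  between the two leave room for displacements \<rho> / 2, \<tau> / 2 and 3 * t / 2 (in y because
  exp s2 \<ge> 1); the margins \<rho> / 2, \<tau> / 2 and t / 2 around \<open>T\<close> are Cauchy
  radii for the Lipschitz bound on X.\<close>

definition "A = cnbhd I (r - \<rho>)"
definition "B = cnbhd Y (\<sigma> - exp s2 * \<tau>)"
definition "C = strip (s - 2 * t)"
definition "T = dom3 I Y (r - \<rho> / 2, \<sigma> - \<tau> / 2, s - t / 2)"
definition "y0 = complex_of_real y1"
abbreviation "S \<equiv> A \<times> B \<times> C"

lemma E\<tau>: "\<tau> \<le> exp s2 * \<tau>" using E1 pos by simp

lemma y0B: "y0 \<in> B" unfolding B_def y0_def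
  by (rule of_real_in_cnbhd[OF y1]) (use room E\<tau> pos in linarith)

lemma S_eq: "S = dom3 I Y (r - \<rho>, \<sigma> - exp s2 * \<tau>, s - 2 * t)"
  by (simp add: A_def B_def C_def)

lemma T_sub: "T \<subseteq> dom3 I Y (r, \<sigma>, s)"
  unfolding T_def by (rule dom3_mono) (use pos in auto)

lemma S_sub: "S \<subseteq> dom3 I Y (r, \<sigma>, s)"
  unfolding S_eq by (rule dom3_mono) (use pos in auto)

lemma S_dom2: "(x, y, q) \<in> S \<Longrightarrow> (x, y) \<in> dom2 I Y r \<sigma>"
  using S_sub by (auto simp: dom2_def)

lemma T_dom2: "z \<in> T \<Longrightarrow> (crd 0 z, crd 1 z) \<in> dom2 I Y r \<sigma>"
  using T_sub by (auto simp: dom2_def)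

lemma B_dist: "y \<in> B \<Longrightarrow> cmod (y - y0) \<le> D"
  by (rule D(1)) (use y0B cnbhd_mono[of "\<sigma> - exp s2 * \<tau>" \<sigma> Y] pos in \<open>auto simp: B_def\<close>)

lemma B_seg: "y \<in> B \<Longrightarrow> closed_segment y0 y \<subseteq> B"
  unfolding B_def using y0B[unfolded B_def] convex_cnbhd[OF conn(2)] by (simp add: closed_segment_subset)

text \<open>In y the bound depends on the distance to \<open>y0\<close>, the form that the Picard
  step reproduces. Reality and equivariance under the period are carried along because they also
  pass to pointwise limits.\<close>

definition adm :: "(point \<Rightarrow> point) \<Rightarrow> bool" where
  "adm \<Psi> \<longleftrightarrow> (\<forall>z\<in>S. cmod (crd 0 (\<Psi> z) - crd 0 z) \<le> \<rho> * \<epsilon> \<and>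
     cmod (crd 1 (\<Psi> z) - crd 1 z) \<le> maj (cmod (crd 1 z - y0)) \<and>
     cmod (crd 2 (\<Psi> z) - crd 2 z) \<le> 3 / 2 * t \<and>
     (z \<in> reals3 \<longrightarrow> \<Psi> z \<in> reals3) \<and> \<Psi> (shift z) = shift (\<Psi> z))"

lemma shift_S: "z \<in> S \<Longrightarrow> shift z \<in> S"
  by (auto simp: C_def strip_def)

lemma adm_crd1: "adm \<Psi> \<Longrightarrow> z \<in> S \<Longrightarrow> cmod (crd 1 (\<Psi> z) - crd 1 z) \<le> \<tau> / 2"
proof -
  assume a: "adm \<Psi>" "z \<in> S"
  then have "crd 1 z \<in> B" by auto
  then have "maj (cmod (crd 1 z - y0)) \<le> \<tau> / 2" using B_dist maj_le by blast
  then show ?thesis using a by (force simp: adm_def)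
qed

lemma adm_crd0: "adm \<Psi> \<Longrightarrow> z \<in> S \<Longrightarrow> cmod (crd 0 (\<Psi> z) - crd 0 z) \<le> \<rho> / 2"
proof -
  assume a: "adm \<Psi>" "z \<in> S"
  have "\<rho> * \<epsilon> \<le> \<rho> * (1/2)" using \<epsilon> pos by (intro mult_left_mono) auto
  then show ?thesis using a by (force simp: adm_def)
qed

lemma adm_T: 
  assumes "adm \<Psi>" "z \<in> S"
  shows "\<Psi> z \<in> T"
proof -
  obtain x y q where z: "z = (x, y, q)" by (metis prod_cases3)
  obtain x' y' q' where z': "\<Psi> z = (x', y', q')" by (metis prod_cases3)
  have "cmod (x' - x) \<le> \<rho> / 2" "cmod (y' - y) \<le> \<tau> / 2"
    using adm_crd0[OF assms] adm_crd1[OF assms] unfolding z' unfolding z by simp_all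
  moreover have "cmod (crd 2 (\<Psi> z) - crd 2 z) \<le> 3 / 2 * t" using assms unfolding adm_def by blast
  then have "cmod (q' - q) \<le> 3 / 2 * t" unfolding z' unfolding z by simp
  ultimately show ?thesis unfolding z' T_def
    using assms(2) E\<tau> cnbhd_shift[of x I "r - \<rho>" x' "\<rho> / 2" "r - \<rho> / 2"]
      cnbhd_shift[of y Y "\<sigma> - exp s2 * \<tau>" y' "\<tau> / 2" "\<sigma> - \<tau> / 2"]
      strip_shift[of q "s - 2 * t" q' "3 / 2 * t" "s - t / 2"]
    by (auto simp: z A_def B_def C_def)
qed

lemma adm_bound:
  assumes "adm \<Psi>" "z \<in> S"
  shows "nrm1 (\<Psi> z - z) \<le> \<rho> + \<tau> + 2 * t"
proof -
  have "cmod (crd 2 (\<Psi> z) - crd 2 z) \<le> 3 / 2 * t" using assms unfolding adm_def by auto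
  then show ?thesis unfolding nrm1_def crd_diff using adm_crd0[OF assms] adm_crd1[OF assms] pos by linarith
qed

lemma adm_id: "adm (\<lambda>z. z)"
  unfolding adm_def
proof (intro ballI conjI)
  fix z assume "z \<in> S"
  have "0 \<le> maj \<xi>" if "0 \<le> \<xi>" for \<xi> unfolding maj_def using \<mu>0 \<nu>0 that by simp
  then show "cmod (crd 1 z - crd 1 z) \<le> maj (cmod (crd 1 z - y0))" by simp
qed (use pos \<epsilon> in auto)

lemma adm_lim:
  assumes F: "\<And>n::nat. adm (F n)" and lim: "\<And>z. z \<in> S \<Longrightarrow> (\<lambda>n. F n z) \<longlonglongrightarrow> G z"
  shows "adm G"
  unfolding adm_def
proof
  fix z assume z: "z \<in> S"
  have l: "(\<lambda>n. crd i (F n z)) \<longlonglongrightarrow> crd i (G z)" for i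
  proof -
    have "(\<lambda>n. fst (F n z)) \<longlonglongrightarrow> fst (G z)" "(\<lambda>n. snd (F n z)) \<longlonglongrightarrow> snd (G z)"
      using lim[OF z] by (auto intro: tendsto_fst tendsto_snd)
    then show ?thesis unfolding crd_def by (auto intro: tendsto_fst tendsto_snd)
  qed
  have le: "cmod (crd i (G z) - crd i z) \<le> b" if "\<And>n. cmod (crd i (F n z) - crd i z) \<le> b" for i b
    by (rule LIMSEQ_le_const2[OF tendsto_norm[OF tendsto_diff[OF l tendsto_const]]]) (use that in auto)
  have "(\<lambda>n. shift (F n z)) \<longlonglongrightarrow> shift (G z)" by (intro tendsto_add lim[OF z] tendsto_const)
  moreover have "F n (shift z) = shift (F n z)" for n using F[of n] z unfolding adm_def by blast
  ultimately have sh: "G (shift z) = shift (G z)" using LIMSEQ_unique lim[OF shift_S[OF z]] by simp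
  have "G z \<in> reals3" if "z \<in> reals3"
    unfolding reals3_iff
  proof
    fix i
    have "crd i (F n z) \<in> \<real>" for n using F z that by (auto simp: adm_def reals3_iff)
    then show "crd i (G z) \<in> \<real>"
      by (intro Lim_in_closed_set[OF closed_complex_Reals _ _ l]) auto
  qed
  then show "cmod (crd 0 (G z) - crd 0 z) \<le> \<rho> * \<epsilon> \<and>
     cmod (crd 1 (G z) - crd 1 z) \<le> maj (cmod (crd 1 z - y0)) \<and>
     cmod (crd 2 (G z) - crd 2 z) \<le> 3 / 2 * t \<and>
     (z \<in> reals3 \<longrightarrow> G z \<in> reals3) \<and> G (shift z) = shift (G z)"
    using sh F z by (intro conjI le) (auto simp: adm_def)
qed

abbreviation V :: "point \<Rightarrow> complex" where "V \<equiv> \<lambda>(x, y, q). v (x, y)"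

lemma V_S: "holomorphic3_on V S" "z \<in> S \<Longrightarrow> V z \<noteq> 0" "z \<in> S \<Longrightarrow> 1 / cmod (V z) \<le> M"
  using hol3_subset[OF holv S_sub] v0 M S_dom2 by auto

lemma crd_X: "crd 0 (X z) = crd 0 (P z)" "crd 1 (X z) = v (crd 0 z, crd 1 z) + crd 1 (P z)"
  "crd 2 (X z) = \<omega> (crd 0 z, crd 1 z) + crd 2 (P z)"
  by (simp_all add: X driven_field_def case_prod_unfold)

text \<open>The displacements allowed by \<open>adm\<close> are inserted into
  \<open>ratio_bound\<close>: the bound on \<open>dI v / v\<close> times \<rho> * \<epsilon> gives
  \<tau> * \<epsilon> / (4 * D), the bound on \<open>dy v / v\<close> multiplies the majorant. The
  second estimate uses only that the total stays below \<open>\<kappa>0\<close>.\<close>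

lemma ratio:
  assumes "adm \<Psi>" "z \<in> S"
  shows "cmod (v (crd 0 (\<Psi> z), crd 1 (\<Psi> z)) / V z - 1) \<le> c0 * (\<tau> * \<epsilon> / (4 * D) + s2 / D * maj (cmod (crd 1 z - y0)))"
    "cmod (v (crd 0 (\<Psi> z), crd 1 (\<Psi> z)) / V z) \<le> 9/8"
proof -
  define \<kappa> where "\<kappa> = \<tau> * \<epsilon> / (4 * D) + s2 / D * maj (cmod (crd 1 z - y0))"
  obtain x y q where z: "z = (x, y, q)" by (metis prod_cases3)
  have yB: "y \<in> B" using assms z by auto
  have "\<kappa> \<le> \<tau> * \<epsilon> / (4 * D) + s2 / D * (\<tau> / 2)"
    unfolding \<kappa>_def by (intro add_left_mono mult_left_mono maj_le) (use pos D0 B_dist[OF yB] z in auto)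
  also have "\<dots> = (\<tau> / D) * (\<epsilon> / 4 + s2 / 2)" using D0 by (simp add: field_simps)
  \<comment> \<open>As 8 * exp s2 * \<tau> < D, the ratio \<tau> / D is below 1 / (8 * exp s2). This
    and \<epsilon> / 4 \<le> 1/2 are the origin of the formula for \<open>\<kappa>0\<close>.\<close>
  also have "\<dots> \<le> (1 / (8 * exp s2)) * (\<epsilon> / 4 + s2 / 2)"
    by (rule mult_right_mono) (use D(2) D0 pos \<epsilon> in \<open>auto simp: field_simps\<close>)
  also have "\<dots> \<le> (1 / (8 * exp s2)) * (1 / 2 + s2 / 2)"
    by (rule mult_left_mono) (use \<epsilon> in auto)
  also have "\<dots> = \<kappa>0" by (simp add: \<kappa>0_def field_simps)
  finally have \<kappa>: "\<kappa> \<le> \<kappa>0" .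
  have ab: "\<tau> / (4 * D * \<rho>) * cmod (crd 0 (\<Psi> z) - x) + s2 / D * cmod (crd 1 (\<Psi> z) - y) \<le> \<kappa>"
  proof -
    have "\<tau> / (4 * D * \<rho>) * cmod (crd 0 (\<Psi> z) - x) \<le> \<tau> / (4 * D * \<rho>) * (\<rho> * \<epsilon>)"
      by (rule mult_left_mono) (use assms pos D0 in \<open>auto simp: adm_def z\<close>)
    moreover have "s2 / D * cmod (crd 1 (\<Psi> z) - y) \<le> s2 / D * maj (cmod (y - y0))"
      by (rule mult_left_mono) (use assms pos D0 in \<open>auto simp: adm_def z\<close>)
    ultimately show ?thesis using pos by (simp add: \<kappa>_def z)
  qed
  have \<kappa>_nonneg: "0 \<le> \<kappa>" by (rule order_trans[OF _ ab]) (use pos D0 in simp)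
  have "cmod (v (crd 0 (\<Psi> z), crd 1 (\<Psi> z)) / v (x, y) - 1) \<le> (1 + 2 * \<kappa>) * \<kappa>"
    by (rule ratio_bound[OF conn holv _ v0 dIv dyv _ _ ab])
      (use room pos \<kappa> \<kappa>0 assms S_dom2[of x y q] T_dom2[OF adm_T[OF assms]] in \<open>auto simp: z\<close>)
  also have "\<dots> \<le> c0 * \<kappa>" unfolding c0_def using \<kappa> \<kappa>_nonneg by (intro mult_right_mono) auto
  finally have *: "cmod (v (crd 0 (\<Psi> z), crd 1 (\<Psi> z)) / V z - 1) \<le> c0 * \<kappa>" by (simp add: z)
  then show "cmod (v (crd 0 (\<Psi> z), crd 1 (\<Psi> z)) / V z - 1) \<le> c0 * (\<tau> * \<epsilon> / (4 * D) + s2 / D * maj (cmod (crd 1 z - y0)))"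
    by (simp add: \<kappa>_def)
  have "c0 * \<kappa> \<le> (9/8) * (1/16)" using c0 \<kappa> \<kappa>0 \<kappa>_nonneg by (intro mult_mono) auto
  then have "cmod (v (crd 0 (\<Psi> z), crd 1 (\<Psi> z)) / V z - 1) \<le> 1/8" using * by linarith
  then show "cmod (v (crd 0 (\<Psi> z), crd 1 (\<Psi> z)) / V z) \<le> 9/8"
    using norm_triangle_ineq[of "v (crd 0 (\<Psi> z), crd 1 (\<Psi> z)) / V z - 1" 1] by simp
qed

lemma P_over_v:
  assumes "adm \<Psi>" "z \<in> S"
  shows "cmod (crd 0 (P (\<Psi> z)) / V z) \<le> \<rho> * \<epsilon> / D" "cmod (crd 1 (P (\<Psi> z)) / V z) \<le> \<tau> * \<epsilon> / D"
    "cmod (crd 2 (P (\<Psi> z)) / V z) \<le> t * \<epsilon> / D"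
proof -
  have d: "\<Psi> z \<in> dom3 I Y (r, \<sigma>, s)" using adm_T[OF assms] T_sub by blast
  have *: "cmod (a / V z) \<le> b * \<epsilon> / D" if "cmod a \<le> b * W" for a b
  proof -
    have "cmod (a / V z) = cmod a * (1 / cmod (V z))" by (simp add: norm_divide)
    also have "\<dots> \<le> (b * W) * M"
      by (rule mult_mono) (use that V_S(3)[OF assms(2)] order_trans[OF norm_ge_zero that] in auto)
    also have "\<dots> = b * \<epsilon> / D" using D0 by (simp add: \<epsilon>_def)
    finally show ?thesis .
  qed
  show "cmod (crd 0 (P (\<Psi> z)) / V z) \<le> \<rho> * \<epsilon> / D" "cmod (crd 1 (P (\<Psi> z)) / V z) \<le> \<tau> * \<epsilon> / D"
    "cmod (crd 2 (P (\<Psi> z)) / V z) \<le> t * \<epsilon> / D"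
    by (rule *[OF P(1)[OF d]], rule *[OF P(2)[OF d]], rule *[OF P(3)[OF d]])
qed

lemma Bprops: "open A" "open B" "convex B" "y0 \<in> B" "open C"
  using y0B by (simp_all add: A_def B_def C_def open_cnbhd open_strip convex_cnbhd[OF conn(2)])

lemma openS: "open S" using Bprops by (simp add: open_Times)

lemma hol_rhs:
  assumes "adm \<Psi>" "\<And>i. holomorphic3_on (\<lambda>z. crd i (\<Psi> z)) S"
  shows "holomorphic3_on (\<lambda>z. crd i (X (\<Psi> z)) / V z) S"
proof -
  have "holomorphic3_on (\<lambda>z. (\<lambda>z. crd i (X z)) (crd 0 (\<Psi> z), crd 1 (\<Psi> z), crd 2 (\<Psi> z))) S"
    by (rule hol3_compose[OF holX assms(2) assms(2) assms(2)]) (use adm_T[OF assms(1)] T_sub in auto)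
  then show ?thesis using hol3_divide[OF openS _ V_S(1,2)] by simp
qed

text \<open>The invariance of the a priori bounds. The x and angle components integrate constant
  bounds over a distance at most D; the y component closes up because the majorant solves its own
  differential inequality with equality.\<close>

lemma adm_step:
  assumes \<Psi>: "adm \<Psi>" "\<And>i. holomorphic3_on (\<lambda>z. crd i (\<Psi> z)) S"
    and \<Psi>': "\<And>i z. z \<in> S \<Longrightarrow> crd i (\<Psi>' z) = crd i (fst z, y0, snd (snd z)) + yint y0 (\<lambda>z. crd i (X (\<Psi> z)) / V z) z"
  shows "adm \<Psi>'"
  unfolding adm_def
proof
  fix z assume zS: "z \<in> S"
  obtain x y q where z: "z = (x, y, q)" by (metis prod_cases3)
  have yB: "y \<in> B" using zS z by auto
  have in1: "(x, \<eta>, q) \<in> S" if "\<eta> \<in> B" for \<eta> using zS z that by auto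
  note hr = hol_rhs[OF \<Psi>]
  note bnd = yint_bound[OF Bprops(2-4) _ zS[unfolded z]]
  have yD: "cmod (y - y0) \<le> D" by (rule B_dist[OF yB])
  have 0: "cmod (crd 0 (\<Psi>' z) - crd 0 z) \<le> \<rho> * \<epsilon>"
  proof -
    have "cmod (yint y0 (\<lambda>z. crd 0 (X (\<Psi> z)) / V z) (x, y, q)) \<le> \<rho> * \<epsilon> / D * cmod (y - y0) - \<rho> * \<epsilon> / D * 0"
    proof (rule bnd[OF hr])
      show "((\<lambda>\<xi>. \<rho> * \<epsilon> / D * \<xi>) has_real_derivative \<rho> * \<epsilon> / D) (at \<xi>)" for \<xi> using D0 by (auto intro!: derivative_eq_intros)
      show "cmod (crd 0 (X (\<Psi> (x, \<eta>, q))) / V (x, \<eta>, q)) \<le> \<rho> * \<epsilon> / D" if "\<eta> \<in> B" for \<eta>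
        unfolding crd_X(1) by (rule P_over_v(1)[OF \<Psi>(1) in1[OF that]])
    qed
    also have "\<dots> \<le> \<rho> * \<epsilon> / D * D" using yD pos \<epsilon> D0 by (simp add: mult_left_mono divide_right_mono del: times_divide_eq_left)
    finally show ?thesis using \<Psi>'[OF zS, of 0] D0 by (simp add: z)
  qed
  have 1: "cmod (crd 1 (\<Psi>' z) - crd 1 z) \<le> maj (cmod (crd 1 z - y0))"
  proof -
    \<comment> \<open>The coordinate y itself is \<open>y0\<close> plus the primitive of 1, so the
      displacement is the primitive of the relative error of the y-speed.\<close>
    have "crd 1 (\<Psi>' z) - crd 1 z = yint y0 (\<lambda>z. crd 1 (X (\<Psi> z)) / V z) (x, y, q) - yint y0 (\<lambda>_. 1) (x, y, q)"
      using \<Psi>'[OF zS, of 1] by (simp add: z yint_const)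
    also have "\<dots> = yint y0 (\<lambda>z. crd 1 (X (\<Psi> z)) / V z - 1) (x, y, q)"
      by (rule yint_diff[OF Bprops(2-4) hr hol3_const[OF openS] zS[unfolded z], symmetric])
    also have "cmod \<dots> \<le> maj (cmod (y - y0)) - maj 0"
    proof (rule bnd[OF hol3_diff[OF openS hr hol3_const[OF openS]] maj_DERIV])
      fix \<eta> assume \<eta>: "\<eta> \<in> B"
      let ?z = "(x, \<eta>, q)" and ?m = "maj (cmod (\<eta> - y0))"
      have "crd 1 (X (\<Psi> ?z)) / V ?z - 1 = (v (crd 0 (\<Psi> ?z), crd 1 (\<Psi> ?z)) / V ?z - 1) + crd 1 (P (\<Psi> ?z)) / V ?z"
        unfolding crd_X by (simp add: add_divide_distrib)
      also have "cmod \<dots> \<le> c0 * (\<tau> * \<epsilon> / (4 * D) + s2 / D * ?m) + \<tau> * \<epsilon> / D"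
        by (intro norm_triangle_le add_mono order_trans[OF ratio(1)[OF \<Psi>(1) in1[OF \<eta>]]] P_over_v(2)[OF \<Psi>(1) in1[OF \<eta>]]) simp
      \<comment> \<open>This is the right-hand side of the majorant equation; by the explicit
        solution it equals the derivative of \<open>maj\<close>.\<close>
      also have "\<dots> = \<nu> + \<mu> * ?m" using D0 by (simp add: \<nu>_def \<mu>_def field_simps)
      also have "\<dots> = \<nu> * exp (\<mu> * cmod (\<eta> - y0))" using \<mu>0 by (simp add: maj_def field_simps)
      finally show "cmod (crd 1 (X (\<Psi> ?z)) / V ?z - 1) \<le> \<nu> * exp (\<mu> * cmod (\<eta> - y0))" .
    qed
    finally show ?thesis by (simp add: z)
  qed
  have 2: "cmod (crd 2 (\<Psi>' z) - crd 2 z) \<le> 3 / 2 * t"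
  proof -
    have "cmod (yint y0 (\<lambda>z. crd 2 (X (\<Psi> z)) / V z) (x, y, q)) \<le> 3 / 2 * t / D * cmod (y - y0) - 3 / 2 * t / D * 0"
    proof (rule bnd[OF hr])
      show "((\<lambda>\<xi>. 3 / 2 * t / D * \<xi>) has_real_derivative 3 / 2 * t / D) (at \<xi>)" for \<xi> using D0 by (auto intro!: derivative_eq_intros)
      fix \<eta> assume \<eta>: "\<eta> \<in> B"
      let ?z = "(x, \<eta>, q)"
      let ?p = "(crd 0 (\<Psi> ?z), crd 1 (\<Psi> ?z))"
      have p: "?p \<in> dom2 I Y r \<sigma>" by (rule T_dom2[OF adm_T[OF \<Psi>(1) in1[OF \<eta>]]])
      have m: "cmod (\<omega> ?p / v ?p * (v ?p / V ?z)) \<le> t / D * (9/8)"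
        unfolding norm_mult by (rule mult_mono[OF \<omega>v[OF p] ratio(2)[OF \<Psi>(1) in1[OF \<eta>]]]) (use pos D0 in auto)
      \<comment> \<open>The frequency is taken at the displaced point but v at the original one.
        Inserting v at the displaced point leaves \<omega> / v, bounded by t / D, and the ratio of
        two values of v, bounded by 9/8.\<close>
      have "crd 2 (X (\<Psi> ?z)) / V ?z = \<omega> ?p / v ?p * (v ?p / V ?z) + crd 2 (P (\<Psi> ?z)) / V ?z"
        unfolding crd_X using v0[OF p] by (simp add: add_divide_distrib)
      also have "cmod \<dots> \<le> t / D * (9/8) + t * \<epsilon> / D"
        by (intro norm_triangle_le add_mono m P_over_v(3)[OF \<Psi>(1) in1[OF \<eta>]])
      also have "\<dots> = t / D * (9/8 + \<epsilon>)" using D0 by (simp add: field_simps)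
      also have "\<dots> \<le> t / D * (3/2)" using pos D0 \<epsilon> by (intro mult_left_mono) auto
      finally show "cmod (crd 2 (X (\<Psi> ?z)) / V ?z) \<le> 3 / 2 * t / D" by simp
    qed
    also have "\<dots> \<le> 3 / 2 * t / D * D" using yD pos D0 by (simp add: mult_left_mono divide_right_mono del: times_divide_eq_left)
    finally show ?thesis using \<Psi>'[OF zS, of 2] D0 by (simp add: z)
  qed
  have re: "\<Psi>' z \<in> reals3" if "z \<in> reals3"
    unfolding reals3_iff
  proof
    fix i
    have r: "x \<in> \<real>" "y \<in> \<real>" "q \<in> \<real>" using that by (auto simp: z)
    have "yint y0 (\<lambda>z. crd i (X (\<Psi> z)) / V z) (x, y, q) \<in> \<real>"
    proof (rule yint_real)
      show "y0 \<in> \<real>" by (simp add: y0_def)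
      fix \<eta> assume \<eta>: "\<eta> \<in> closed_segment y0 y" "\<eta> \<in> \<real>"
      then have zS': "(x, \<eta>, q) \<in> S" using in1 B_seg[OF yB] by blast
      have "\<Psi> (x, \<eta>, q) \<in> reals3" using \<Psi>(1) zS' r \<eta> by (simp add: adm_def)
      from realX[OF subsetD[OF T_sub adm_T[OF \<Psi>(1) zS']] this] have "X (\<Psi> (x, \<eta>, q)) \<in> reals3" .
      then have "crd i (X (\<Psi> (x, \<eta>, q))) \<in> \<real>" by (simp add: reals3_iff)
      moreover have "V (x, \<eta>, q) \<in> \<real>" using realN[OF S_dom2[OF zS']] r \<eta> by simp
      ultimately show "crd i (X (\<Psi> (x, \<eta>, q))) / V (x, \<eta>, q) \<in> \<real>" by (rule Reals_divide)
    qed (rule r)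
    moreover have "crd i (x, y0, q) \<in> \<real>" using r by (simp add: crd_def y0_def)
    ultimately show "crd i (\<Psi>' z) \<in> \<real>" unfolding \<Psi>'[OF zS] by (simp add: z)
  qed
  have sh: "\<Psi>' (shift z) = shift (\<Psi>' z)"
  proof -
    have "yint y0 (\<lambda>z. crd i (X (\<Psi> z)) / V z) (x, y, q + 2 * of_real pi) = yint y0 (\<lambda>z. crd i (X (\<Psi> z)) / V z) (x, y, q)" for i
    proof (rule yint_cong)
      fix \<eta> assume \<eta>: "\<eta> \<in> closed_segment y0 y"
      then have zS': "(x, \<eta>, q) \<in> S" using in1 B_seg[OF yB] by blast
      have "\<Psi> (shift (x, \<eta>, q)) = shift (\<Psi> (x, \<eta>, q))" using \<Psi>(1) zS' unfolding adm_def by blast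
      moreover have "X (shift (\<Psi> (x, \<eta>, q))) = X (\<Psi> (x, \<eta>, q))"
        by (rule periodic[OF subsetD[OF T_sub adm_T[OF \<Psi>(1) zS']]])
      ultimately show "crd i (X (\<Psi> (x, \<eta>, q + 2 * of_real pi))) / V (x, \<eta>, q + 2 * of_real pi) = crd i (X (\<Psi> (x, \<eta>, q))) / V (x, \<eta>, q)"
        by simp
    qed
    moreover have cs: "crd i (shift w) = crd i w + crd i (0, 0, 2 * of_real pi)" for i w by (simp add: crd_def)
    moreover from cs[of _ "(x, y0, q)"] have "crd i (x, y0, q + 2 * of_real pi) = crd i (x, y0, q) + crd i (0, 0, 2 * of_real pi)" for i
      by simp
    ultimately have "crd i (\<Psi>' (shift z)) = crd i (shift (\<Psi>' z))" for i
      using \<Psi>'[OF shift_S[OF zS], of i] \<Psi>'[OF zS, of i] unfolding cs by (simp add: z del: crd_simps)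
    from this[of 0] this[of 1] this[of 2] show ?thesis by (simp add: prod_eq_iff)
  qed
  show "cmod (crd 0 (\<Psi>' z) - crd 0 z) \<le> \<rho> * \<epsilon> \<and>
     cmod (crd 1 (\<Psi>' z) - crd 1 z) \<le> maj (cmod (crd 1 z - y0)) \<and>
     cmod (crd 2 (\<Psi>' z) - crd 2 z) \<le> 3 / 2 * t \<and>
     (z \<in> reals3 \<longrightarrow> \<Psi>' z \<in> reals3) \<and> \<Psi>' (shift z) = shift (\<Psi>' z)"
    using 0 1 2 re sh by blast
qed

end

section \<open>The coordinate change\<close>

context driven_system
begin

text \<open>The shear costs at most \<open>t\<close> in the angle and so maps \<open>S10\<close> into \<open>S9\<close>; between \<open>S9\<close> and \<open>S\<close> there is
  room for Cauchy estimates with radii \<open>7 * \<rho>\<close>, \<open>7 * \<tau>\<close> and \<open>7 * t\<close>.\<close>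

abbreviation "S9 \<equiv> dom3 I Y (r - 8 * \<rho>, \<sigma> - 8 * exp s2 * \<tau>, s - 9 * t)"
abbreviation "S10 \<equiv> dom3 I Y (r - 8 * \<rho>, \<sigma> - 8 * exp s2 * \<tau>, s - 10 * t)"

lemma S9_sub: "S9 \<subseteq> S"
  unfolding S_eq by (rule dom3_mono) (use pos in auto)

lemma S10_sub: "S10 \<subseteq> S9"
  by (rule dom3_mono) (use pos in auto)

definition wt :: "nat \<Rightarrow> real" where "wt i = (if i = 0 then \<rho> else if i = 1 then \<tau> else t)"

text \<open>The l1-norm in units of \<rho>, \<tau>, t, matched to Cauchy radii proportional to these
  weights.\<close>

definition wn :: "point \<Rightarrow> real" where
  "wn h = cmod (crd 0 h) / \<rho> + cmod (crd 1 h) / \<tau> + cmod (crd 2 h) / t"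

lemma wn_nonneg: "0 \<le> wn h" using pos by (simp add: wn_def)

lemma wn_eq_0: "wn h = 0 \<Longrightarrow> h = 0"
proof -
  assume "wn h = 0"
  moreover have "0 \<le> cmod (crd 0 h) / \<rho>" "0 \<le> cmod (crd 1 h) / \<tau>" "0 \<le> cmod (crd 2 h) / t" using pos by auto
  ultimately have "cmod (crd 0 h) / \<rho> = 0" "cmod (crd 1 h) / \<tau> = 0" "cmod (crd 2 h) / t = 0"
    unfolding wn_def by linarith+
  then show "h = 0" using pos by (simp add: prod_eq_iff)
qed

text \<open>In weighted units each coordinate is at most 3/14 of the norm, and the three of them sum
  to 9/14 < 1.\<close>

lemma wn_contraction: "h = 0" if "\<And>i. cmod (crd i h) \<le> 3 / 2 * wt i * (wn h / 7)"
proof -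
  have "cmod (crd i h) / wt i \<le> 3 / 14 * wn h" for i
    using that[of i] pos by (simp add: wt_def field_simps)
  from this[of 0] this[of 1] this[of 2] have "wn h \<le> 9 / 14 * wn h" by (simp add: wn_def wt_def)
  then have "wn h = 0" using wn_nonneg[of h] by linarith
  then show ?thesis by (rule wn_eq_0)
qed

text \<open>The integral equation for the Picard fixed point is differentiated in y. The Lipschitz
  constant of X comes from Cauchy estimates with the margins around \<open>T\<close>; it may be
  large compared with 1 / D, since the iteration is weighted.\<close>

theorem straightening:
  assumes Bx: "0 \<le> Bx"
  obtains \<Psi> where "adm \<Psi>" "\<And>i. holomorphic3_on (\<lambda>z. crd i (\<Psi> z)) S"
    "\<And>i z. z \<in> S \<Longrightarrow> pd2 (\<lambda>z. crd i (\<Psi> z)) z = crd i (X (\<Psi> z)) / V z"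
proof -
  define \<Lambda> where "\<Lambda> = Bx * (2 / \<rho> + 2 / \<tau> + 2 / t)"
  have lip: "cmod (crd i (X z) - crd i (X w)) \<le> \<Lambda> * nrm1 (z - w)" if zw: "z \<in> T" "w \<in> T" for i z w
  proof -
    obtain x y q where z: "z = (x, y, q)" by (metis prod_cases3)
    obtain x' y' q' where w: "w = (x', y', q')" by (metis prod_cases3)
    have "cmod (crd i (X (x, y, q)) - crd i (X (x', y', q'))) \<le> Bx * (cmod (x - x') / (\<rho> / 2) + cmod (y - y') / (\<tau> / 2) + cmod (q - q') / (t / 2))"
      by (rule dom3_lipschitz[OF conn holX XB]) (use pos zw in \<open>simp_all add: T_def z w del: dom3.simps\<close>)
    also have "\<dots> \<le> Bx * (nrm1 (z - w) / (\<rho> / 2) + nrm1 (z - w) / (\<tau> / 2) + nrm1 (z - w) / (t / 2))"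
      using pos Bx by (intro mult_left_mono add_mono divide_right_mono) (auto simp: nrm1_def z w)
    also have "\<dots> = \<Lambda> * nrm1 (z - w)" by (simp add: \<Lambda>_def algebra_simps)
    finally show ?thesis by (simp add: z w)
  qed
  interpret pic: picard A B C y0 D M \<Lambda> "\<rho> + \<tau> + 2 * t" X T V adm
  proof
    show "0 \<le> M" "0 \<le> \<Lambda>" using pos Bx by (auto simp: \<Lambda>_def)
    show "holomorphic3_on (\<lambda>z. crd i (X z)) T" for i by (rule hol3_subset[OF holX T_sub])
    show "adm (\<lambda>z. z)" by (rule adm_id)
    show "\<And>\<Psi> z. adm \<Psi> \<Longrightarrow> z \<in> S \<Longrightarrow> \<Psi> z \<in> T" by (rule adm_T)
    show "\<And>\<Psi> z. adm \<Psi> \<Longrightarrow> z \<in> S \<Longrightarrow> nrm1 (\<Psi> z - z) \<le> \<rho> + \<tau> + 2 * t" by (rule adm_bound)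
    show "\<And>F G. (\<And>n::nat. adm (F n)) \<Longrightarrow> (\<And>z. z \<in> S \<Longrightarrow> (\<lambda>n. F n z) \<longlonglongrightarrow> G z) \<Longrightarrow> adm G" by (rule adm_lim)
    show "\<And>\<Psi> \<Psi>'. adm \<Psi> \<Longrightarrow> (\<And>i. holomorphic3_on (\<lambda>z. crd i (\<Psi> z)) S) \<Longrightarrow>
        (\<And>i z. z \<in> S \<Longrightarrow> crd i (\<Psi>' z) = crd i (fst z, y0, snd (snd z)) + yint y0 (\<lambda>z. crd i (X (\<Psi> z)) / V z) z) \<Longrightarrow> adm \<Psi>'"
      by (rule adm_step)
    show "\<And>y. y \<in> B \<Longrightarrow> cmod (y - y0) \<le> D" by (rule B_dist)
    show "holomorphic3_on V S" by (rule V_S(1))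
    show "\<And>z. z \<in> S \<Longrightarrow> V z \<noteq> 0" by (rule V_S(2))
    show "\<And>z. z \<in> S \<Longrightarrow> 1 / cmod (V z) \<le> M" by (rule V_S(3))
    show "open A" "open B" "convex B" "y0 \<in> B" "open C" by (rule Bprops)+
    show "\<And>i z w. z \<in> T \<Longrightarrow> w \<in> T \<Longrightarrow> cmod (crd i (X z) - crd i (X w)) \<le> \<Lambda> * nrm1 (z - w)" by (rule lip)
  qed
  obtain \<Psi> where \<Psi>: "adm \<Psi>" "\<And>i. holomorphic3_on (\<lambda>z. crd i (\<Psi> z)) S"
    "\<And>i z. z \<in> S \<Longrightarrow> crd i (\<Psi> z) = crd i (fst z, y0, snd (snd z)) + yint y0 (\<lambda>z. crd i (X (\<Psi> z)) / V z) z"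
    using pic.fixpoint by blast
  show ?thesis
  proof (rule that[OF \<Psi>(1,2)])
    fix i z assume zS: "z \<in> S"
    obtain x y q where z: "z = (x, y, q)" by (metis prod_cases3)
    have yB: "y \<in> B" using zS z by auto
    have "((\<lambda>y. crd i (x, y0, q) + yint y0 (\<lambda>z. crd i (X (\<Psi> z)) / V z) (x, y, q)) has_field_derivative
        0 + crd i (X (\<Psi> (x, y, q))) / V (x, y, q)) (at y)"
      by (rule DERIV_add[OF DERIV_const yint_DERIV[OF Bprops(2-4) hol_rhs[OF \<Psi>(1,2)] zS[unfolded z]]])
    then have "((\<lambda>y. crd i (\<Psi> (x, y, q))) has_field_derivative 0 + crd i (X (\<Psi> (x, y, q))) / V (x, y, q)) (at y)"
      by (rule has_field_derivative_transform_within_open[OF _ Bprops(2) yB]) (use \<Psi>(3) zS z in simp)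
    then show "pd2 (\<lambda>z. crd i (\<Psi> z)) z = crd i (X (\<Psi> z)) / V z"
      by (simp add: pd2_def z DERIV_imp_deriv)
  qed
qed

text \<open>The angle gained along a characteristic of N between \<open>y0\<close> and y;
  subtracting it from the angle gives a first integral of N.\<close>

definition G :: "point \<Rightarrow> complex" where
  "G = yint y0 (\<lambda>(x, y, q). \<omega> (x, y) / v (x, y))"

lemma holF: "holomorphic3_on (\<lambda>(x, y, q). \<omega> (x, y) / v (x, y)) S"
  using hol3_divide[OF openS hol3_subset[OF hol\<omega> S_sub] V_S(1,2)] by (simp add: case_prod_unfold)

lemma holG: "holomorphic3_on G S"
  unfolding G_def by (rule yint_hol3[OF Bprops(1-5) holF])

lemma G_indep: "G (x, y, q) = G (x, y, q')"
  by (simp add: G_def yint_def)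

lemma pdG:
  assumes "(x, y, q) \<in> S"
  shows "pd2 G (x, y, q) = \<omega> (x, y) / v (x, y)" "pd3 G (x, y, q) = 0"
proof -
  show "pd2 G (x, y, q) = \<omega> (x, y) / v (x, y)"
    using yint_DERIV[OF Bprops(2-4) holF assms] by (simp add: pd2_def G_def DERIV_imp_deriv)
  have "(\<lambda>q. G (x, y, q)) = (\<lambda>q. G (x, y, 0))" using G_indep by blast
  then show "pd3 G (x, y, q) = 0" by (simp add: pd3_def)
qed

lemma G_bound:
  assumes "(x, y, q) \<in> S"
  shows "cmod (G (x, y, q)) \<le> t"
proof -
  have "cmod (G (x, y, q)) \<le> t / D * cmod (y - y0) - t / D * 0"
    unfolding G_def
  proof (rule yint_bound[OF Bprops(2-4) holF assms])
    show "((\<lambda>\<xi>. t / D * \<xi>) has_real_derivative t / D) (at \<xi>)" for \<xi> using D0 by (auto intro!: derivative_eq_intros)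
    fix \<eta> assume "\<eta> \<in> B"
    then have "(x, \<eta>, q) \<in> S" using assms by auto
    then show "cmod (case (x, \<eta>, q) of (x, y, q) \<Rightarrow> \<omega> (x, y) / v (x, y)) \<le> t / D" using \<omega>v[OF S_dom2] by simp
  qed
  also have "\<dots> \<le> t / D * D" using B_dist[of y] assms pos D0 by (simp add: mult_left_mono divide_right_mono del: times_divide_eq_left)
  finally show ?thesis using D0 by simp
qed

lemma G_real:
  assumes "(x, y, q) \<in> S" "x \<in> \<real>" "y \<in> \<real>"
  shows "G (x, y, q) \<in> \<real>"
  unfolding G_def
proof (rule yint_real)
  show "y0 \<in> \<real>" by (simp add: y0_def)
  fix \<eta> assume "\<eta> \<in> closed_segment y0 y" "\<eta> \<in> \<real>"
  moreover from this have "(x, \<eta>, q) \<in> S" using assms B_seg[of y] by auto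
  ultimately show "(case (x, \<eta>, q) of (x, y, q) \<Rightarrow> \<omega> (x, y) / v (x, y)) \<in> \<real>"
    using realN[OF S_dom2] assms by (auto intro: Reals_divide)
qed (rule assms)

definition shear :: "point \<Rightarrow> point" where
  "shear z = (fst z, fst (snd z), snd (snd z) - G z)"

lemma shear_S9: "z \<in> S10 \<Longrightarrow> shear z \<in> S9"
proof -
  assume z: "z \<in> S10"
  obtain x y q where xyq: "z = (x, y, q)" by (metis prod_cases3)
  have "(x, y, q) \<in> S" using z S10_sub S9_sub xyq by blast
  then have "cmod (q - G (x, y, q) - q) \<le> t" using G_bound by simp
  moreover have "q \<in> strip (s - 10 * t)" using z xyq by simp
  ultimately have "q - G (x, y, q) \<in> strip (s - 9 * t)" using strip_shift[of q "s - 10 * t" _ t] by simp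
  then show "shear z \<in> S9" using z by (simp add: shear_def xyq)
qed

lemma shear_shift: "shear (shift z) = shift (shear z)"
  using G_indep by (cases z) (auto simp: shear_def)

text \<open>Write Psi = id + \<phi> with |\<phi>_i| at most 3/2 of the i-th weight on
  \<open>S\<close>. Cauchy radii of seven weights make \<phi> a contraction in \<open>wn\<close>:
  equal images force z - w = -(\<phi> z - \<phi> w), and L h = 0 forces h = -D\<phi> h, so both
  differences vanish.\<close>

lemma injective_on_S9:
  assumes \<Psi>: "adm \<Psi>" "\<And>i. holomorphic3_on (\<lambda>z. crd i (\<Psi> z)) S"
  shows "inj_on \<Psi> S9" 
    and "\<And>z L. z \<in> S9 \<Longrightarrow> (\<Psi> has_derivative L) (at z) \<Longrightarrow> inj L"
proof -
  define \<phi> where "\<phi> = (\<lambda>i z. crd i (\<Psi> z) - crd i z)"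
  have crdh: "holomorphic3_on (crd i) S" for i
    by (rule all_crd[of "\<lambda>c. holomorphic3_on c S"]) (use hol3_coords[OF openS] in \<open>auto simp: crd_def[abs_def]\<close>)
  have hol: "holomorphic3_on (\<phi> i) (dom3 I Y (r - \<rho>, \<sigma> - exp s2 * \<tau>, s - 2 * t))" for i
    unfolding \<phi>_def S_eq[symmetric] by (rule hol3_diff[OF openS \<Psi>(2) crdh])
  have bd: "cmod (\<phi> i z) \<le> 3 / 2 * wt i" if "z \<in> dom3 I Y (r - \<rho>, \<sigma> - exp s2 * \<tau>, s - 2 * t)" for i z
  proof -
    have zS: "z \<in> S" using that by (simp only: S_eq)
    have "cmod (crd 2 (\<Psi> z) - crd 2 z) \<le> 3 / 2 * t" using \<Psi>(1) zS unfolding adm_def by blast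
    then show ?thesis using crd_cases[of i z] crd_cases[of i "\<Psi> z"] adm_crd0[OF \<Psi>(1) zS] adm_crd1[OF \<Psi>(1) zS] pos
      by (auto simp: \<phi>_def wt_def)
  qed
  \<comment> \<open>In y the available gap is 7 * exp s2 * \<tau>, of which only 7 * \<tau> is used
    so that all radii are seven weights.\<close>
  have R: "0 < 7 * \<rho>" "0 < 7 * \<tau>" "0 < 7 * t" "r - 8 * \<rho> + 7 * \<rho> \<le> r - \<rho>"
    "\<sigma> - 8 * exp s2 * \<tau> + 7 * \<tau> \<le> \<sigma> - exp s2 * \<tau>" "s - 9 * t + 7 * t \<le> s - 2 * t"
    using pos E\<tau> by auto
  show "inj_on \<Psi> S9"
  proof (rule inj_onI)
    fix z w assume zw: "z \<in> S9" "w \<in> S9" "\<Psi> z = \<Psi> w"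
    obtain x y q where z: "z = (x, y, q)" by (metis prod_cases3)
    obtain x' y' q' where w: "w = (x', y', q')" by (metis prod_cases3)
    have "z - w = 0"
    proof (rule wn_contraction)
      fix i
      have "cmod (crd i (z - w)) = cmod (\<phi> i z - \<phi> i w)" using zw(3) by (simp add: \<phi>_def norm_minus_commute)
      also have "\<dots> \<le> 3 / 2 * wt i * (cmod (x - x') / (7 * \<rho>) + cmod (y - y') / (7 * \<tau>) + cmod (q - q') / (7 * t))"
        unfolding z w by (rule dom3_lipschitz[OF conn hol bd R]) (use zw z w in auto)
      also have "\<dots> = 3 / 2 * wt i * (wn (z - w) / 7)" by (simp add: wn_def z w add_divide_distrib)
      finally show "cmod (crd i (z - w)) \<le> 3 / 2 * wt i * (wn (z - w) / 7)" .
    qed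
    then show "z = w" by simp
  qed
  fix z L assume z: "z \<in> S9" and L: "(\<Psi> has_derivative L) (at z)"
  obtain x y q where xyq: "z = (x, y, q)" by (metis prod_cases3)
  note pb = dom3_partial_bounds[OF hol bd R z]
  have z': "(x, y, q) \<in> dom3 I Y (r - \<rho>, \<sigma> - exp s2 * \<tau>, s - 2 * t)" using z S9_sub S_eq xyq by blast
  have crdL: "crd i (L h) = crd i h + (pd1 (\<phi> i) z * crd 0 h + pd2 (\<phi> i) z * crd 1 h + pd3 (\<phi> i) z * crd 2 h)" for i h
  proof -
    have lin: "bounded_linear (crd i)"
      by (rule all_crd) (auto simp: crd_def[abs_def] bounded_linear_fst
          bounded_linear_compose[OF bounded_linear_fst bounded_linear_snd] bounded_linear_compose[OF bounded_linear_snd bounded_linear_snd])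
    have "((\<lambda>z. crd i (\<Psi> z)) has_derivative (\<lambda>h. crd i (L h))) (at z)"
      by (rule bounded_linear.has_derivative[OF lin L])
    moreover have "((\<lambda>z. crd i z + \<phi> i z) has_derivative (\<lambda>h. crd i h + (\<lambda>(h, k, l). pd1 (\<phi> i) z * h + pd2 (\<phi> i) z * k + pd3 (\<phi> i) z * l) h)) (at z)"
      unfolding xyq by (rule has_derivative_add[OF bounded_linear.has_derivative[OF lin has_derivative_ident] hol3_has_derivative[OF hol z']])
    then have "((\<lambda>z. crd i (\<Psi> z)) has_derivative (\<lambda>h. crd i h + (\<lambda>(h, k, l). pd1 (\<phi> i) z * h + pd2 (\<phi> i) z * k + pd3 (\<phi> i) z * l) h)) (at z)"
      by (simp add: \<phi>_def)
    ultimately have "(\<lambda>h. crd i (L h)) = (\<lambda>h. crd i h + (\<lambda>(h, k, l). pd1 (\<phi> i) z * h + pd2 (\<phi> i) z * k + pd3 (\<phi> i) z * l) h)"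
      by (rule has_derivative_unique)
    from fun_cong[OF this, of h] show ?thesis by (simp add: case_prod_unfold)
  qed
  have "linear L" using L has_derivative_linear by blast
  moreover have "h = 0" if h: "L h = 0" for h
  proof (rule wn_contraction)
    fix i
    have "crd i h = - (pd1 (\<phi> i) z * crd 0 h + pd2 (\<phi> i) z * crd 1 h + pd3 (\<phi> i) z * crd 2 h)"
      using crdL[of i h] unfolding h by (simp add: crd_def add_eq_0_iff2 split: if_splits)
    then have "cmod (crd i h) = cmod (pd1 (\<phi> i) z * crd 0 h + pd2 (\<phi> i) z * crd 1 h + pd3 (\<phi> i) z * crd 2 h)"
      by (simp only: norm_minus_cancel)
    also have "\<dots> \<le> 3 / 2 * wt i / (7 * \<rho>) * cmod (crd 0 h) + 3 / 2 * wt i / (7 * \<tau>) * cmod (crd 1 h) + 3 / 2 * wt i / (7 * t) * cmod (crd 2 h)"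
      by (intro norm_triangle_le add_mono; simp only: norm_mult; intro mult_right_mono pb norm_ge_zero)
    also have "\<dots> = 3 / 2 * wt i * (wn h / 7)" by (simp add: wn_def algebra_simps add_divide_distrib)
    finally show "cmod (crd i h) \<le> 3 / 2 * wt i * (wn h / 7)" .
  qed
  ultimately show "inj L" by (simp add: linear_injective_0)
qed

text \<open>With Phi = Psi o shear, the derivative of the shear sends N to (0, v, 0), and that of
  Psi sends this vector to v times the y-derivative of Psi, which is X(Phi). The value of v is
  unaffected by the shear because v does not see the angle.\<close>

theorem coord_change:
  assumes Bx: "0 \<le> Bx"
  obtains \<Phi> where "real_analytic_coord_change \<Phi> S10 (dom3 I Y (r, \<sigma>, s))"
    "\<And>z. z \<in> S10 \<Longrightarrow> in_coords \<Phi> X z = driven_field v \<omega> z"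
proof -
  obtain \<Psi> where \<Psi>: "adm \<Psi>" "\<And>i. holomorphic3_on (\<lambda>z. crd i (\<Psi> z)) S"
    "\<And>i z. z \<in> S \<Longrightarrow> pd2 (\<lambda>z. crd i (\<Psi> z)) z = crd i (X (\<Psi> z)) / V z"
    using straightening[OF Bx] by blast
  define \<Phi> where "\<Phi> = (\<lambda>z. \<Psi> (shear z))"
  have op: "open S10" by (rule open_dom3)
  have sub: "S10 \<subseteq> S" using S10_sub S9_sub by blast
  have shS: "shear z \<in> S" if "z \<in> S10" for z using shear_S9[OF that] S9_sub by blast
  have holsh: "holomorphic3_on (\<lambda>z. snd (snd z) - G z) S10"
    by (intro hol3_diff[OF op] hol3_coords[OF op] hol3_subset[OF holG sub])
  have hol\<Phi>: "holomorphic3_on (\<lambda>z. crd i (\<Phi> z)) S10" for i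
    unfolding \<Phi>_def shear_def
    by (rule hol3_compose[OF \<Psi>(2) hol3_coords(1,2)[OF op] holsh]) (use shS in \<open>simp add: shear_def\<close>)
  have der: "\<exists>L. (\<Phi> has_derivative L) (at z) \<and> bij L \<and> L (driven_field v \<omega> z) = X (\<Phi> z)" if z: "z \<in> S10" for z
  proof -
    obtain x y q where xyq: "z = (x, y, q)" by (metis prod_cases3)
    have zS: "(x, y, q) \<in> S" using z sub xyq by blast
    define p where "p = q - G (x, y, q)"
    have shz: "shear z = (x, y, p)" by (simp add: shear_def xyq p_def)
    have pS: "(x, y, p) \<in> S" using shS[OF z] shz by simp
    define L1 :: "point \<Rightarrow> point" where "L1 = (\<lambda>(h, k, l). (h, k, l - (pd1 G z * h + pd2 G z * k + pd3 G z * l)))"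
    have L1: "(shear has_derivative L1) (at z)"
    proof -
      have Gd: "(G has_derivative (\<lambda>w. pd1 G z * fst w + pd2 G z * fst (snd w) + pd3 G z * snd (snd w))) (at z)"
        using hol3_has_derivative[OF holG zS] by (simp add: xyq case_prod_unfold)
      show ?thesis unfolding shear_def[abs_def] L1_def case_prod_unfold
        by (rule has_derivative_eq_rhs) (rule Gd derivative_intros refl)+
    qed
    define L2 :: "point \<Rightarrow> point" where "L2 = (\<lambda>h. let d = (\<lambda>i. pd1 (\<lambda>z. crd i (\<Psi> z)) (x, y, p) * crd 0 h + pd2 (\<lambda>z. crd i (\<Psi> z)) (x, y, p) * crd 1 h +
        pd3 (\<lambda>z. crd i (\<Psi> z)) (x, y, p) * crd 2 h) in (d 0, d 1, d 2))"
    have L2: "(\<Psi> has_derivative L2) (at (x, y, p))"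
    proof -
      have "((\<lambda>z. (crd 0 (\<Psi> z), crd 1 (\<Psi> z), crd 2 (\<Psi> z))) has_derivative L2) (at (x, y, p))"
        unfolding L2_def Let_def
        by (intro has_derivative_Pair has_derivative_eq_rhs[OF hol3_has_derivative[OF \<Psi>(2) pS]]) (auto simp: fun_eq_iff)
      then show ?thesis by simp
    qed
    have inj1: "inj L1"
    proof (rule injI)
      fix a b assume "L1 a = L1 b"
      then show "a = b" using pdG(2)[OF zS] by (cases a; cases b) (auto simp: L1_def xyq)
    qed
    have inj2: "inj L2" by (rule injective_on_S9(2)[OF \<Psi>(1,2) _ L2]) (use shear_S9[OF z] shz in simp)
    have L: "(\<Phi> has_derivative (\<lambda>h. L2 (L1 h))) (at z)"
      unfolding \<Phi>_def by (rule has_derivative_compose[OF L1]) (use L2 shz in simp)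
    have "inj (\<lambda>h. L2 (L1 h))" using inj_compose[OF inj2 inj1] by (simp add: comp_def)
    moreover have "linear (\<lambda>h. L2 (L1 h))" using L has_derivative_linear by blast
    \<comment> \<open>An injective linear endomorphism of a finite-dimensional space is
      onto.\<close>
    ultimately have "bij (\<lambda>h. L2 (L1 h))" using linear_injective_imp_surjective by (auto simp: bij_def)
    moreover have "L2 (L1 (driven_field v \<omega> z)) = X (\<Phi> z)"
    proof -
      have nz: "v (x, y) \<noteq> 0" using V_S(2)[OF zS] by simp
      have L1N: "L1 (driven_field v \<omega> z) = (0, v (x, y), 0)"
        using pdG[OF zS] nz by (simp add: L1_def driven_field_def xyq)
      have p2: "pd2 (\<lambda>z. crd i (\<Psi> z)) (x, y, p) * v (x, y) = crd i (X (\<Psi> (x, y, p)))" for i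
        using \<Psi>(3)[OF pS, of i] nz by simp
      show ?thesis unfolding L1N L2_def Let_def
        using p2[of 0] p2[of 1] p2[of 2] by (simp add: \<Phi>_def shz)
    qed
    ultimately show ?thesis using L by blast
  qed
  have fd: "bij (frechet_derivative \<Phi> (at z))" "in_coords \<Phi> X z = driven_field v \<omega> z" if z: "z \<in> S10" for z
  proof -
    obtain L where L: "(\<Phi> has_derivative L) (at z)" "bij L" "L (driven_field v \<omega> z) = X (\<Phi> z)" using der[OF z] by blast
    have e: "frechet_derivative \<Phi> (at z) = L" using frechet_derivative_at[OF L(1)] by simp
    show "bij (frechet_derivative \<Phi> (at z))" using L e by simp
    show "in_coords \<Phi> X z = driven_field v \<omega> z"
      unfolding in_coords_def e using L by (metis bij_is_inj inv_f_f)
  qed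
  show ?thesis
  proof (rule that)
    show "real_analytic_coord_change \<Phi> S10 (dom3 I Y (r, \<sigma>, s))"
      unfolding real_analytic_coord_change_def
    proof (intro conjI ballI)
      show "\<Phi> ` S10 \<subseteq> dom3 I Y (r, \<sigma>, s)"
        using adm_T[OF \<Psi>(1) shS] T_sub by (auto simp: \<Phi>_def simp del: dom3.simps)
      show "inj_on \<Phi> S10"
      proof (rule inj_onI)
        fix z w assume zw: "z \<in> S10" "w \<in> S10" "\<Phi> z = \<Phi> w"
        then have "shear z = shear w"
          using inj_onD[OF injective_on_S9(1)[OF \<Psi>(1,2)]] shear_S9 by (simp add: \<Phi>_def del: dom3.simps)
        \<comment> \<open>Equal shears have equal first two coordinates, and G depends on these
          alone.\<close>
        moreover from this have "G z = G w"
          by (cases z; cases w) (auto simp: shear_def intro: G_indep)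
        ultimately show "z = w" by (simp add: shear_def prod_eq_iff)
      qed
      show "holomorphic3_on (comp1 \<Phi>) S10" "holomorphic3_on (comp2 \<Phi>) S10" "holomorphic3_on (comp3 \<Phi>) S10"
        using hol\<Phi>[of 0] hol\<Phi>[of 1] hol\<Phi>[of 2] by (simp_all del: dom3.simps)
      show "bij (frechet_derivative \<Phi> (at z))" if "z \<in> S10" for z by (rule fd(1)[OF that])
      show "real_on_reals \<Phi> S10"
        unfolding real_on_reals_def
      proof
        fix z assume z: "z \<in> S10 \<inter> reals3"
        then have "shear z \<in> reals3" using G_real[of "fst z" "fst (snd z)" "snd (snd z)"] sub by (auto simp: shear_def simp del: dom3.simps)
        moreover have "shear z \<in> S" using z by (intro shS) blast
        from bspec[OF \<Psi>(1)[unfolded adm_def] this]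
        have "shear z \<in> reals3 \<longrightarrow> \<Psi> (shear z) \<in> reals3" by (elim conjE)
        ultimately show "\<Phi> z \<in> reals3" unfolding \<Phi>_def by (rule rev_mp)
      qed
      fix z assume z: "z \<in> S10"
      have "\<Phi> (shift z) = shift (\<Phi> z)"
        unfolding \<Phi>_def shear_shift using bspec[OF \<Psi>(1)[unfolded adm_def] shS[OF z]] by (elim conjE)
      then show "case z of (x, y, \<psi>) \<Rightarrow> \<Phi> (x, y, \<psi> + 2 * complex_of_real pi) = \<Phi> (x, y, \<psi>) + (0, 0, 2 * complex_of_real pi)"
        by (cases z) simp
    qed
  qed (rule fd(2))
qed

end

section \<open>Functions independent of the angle\<close>

lemma le_sup_norm: "bounded (g ` A) \<Longrightarrow> z \<in> A \<Longrightarrow> cmod (g z) \<le> sup_norm A g"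
  unfolding sup_norm_def by (rule cSUP_upper) (auto simp: bounded_iff bdd_above_def)

lemma fourier_coeff_indep:
  assumes "\<And>t::real. f (x, y, of_real t) = c"
  shows "fourier_coeff f k (x, y) = (if k = 0 then c else 0)"
proof -
  have "integral {0..2*pi} (\<lambda>t. exp (- \<i> * of_int k * of_real t)) = (if k = 0 then 2 * of_real pi else 0)"
    using integral_exp_int[of k 0] by simp
  then show ?thesis by (simp add: fourier_coeff_def assms)
qed

text \<open>Only the zeroth Fourier coefficient survives, and the coefficients involve only real
  angles, which lie in the strip. Hence it suffices that f agrees with g on the domain, whatever its
  values elsewhere.\<close>

lemma O_space_indep:
  assumes hol: "holomorphic3_on f (dom3 I Y (r, \<sigma>, s))" and s: "s > 0"
    and eq: "\<And>x y q. (x, y, q) \<in> dom3 I Y (r, \<sigma>, s) \<Longrightarrow> f (x, y, q) = g (x, y)"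
    and bd: "bounded (g ` dom2 I Y r \<sigma>)" and ne: "dom2 I Y r \<sigma> \<noteq> {}"
  shows "f \<in> O_space I Y (r, \<sigma>, s)"
proof -
  have fc: "fourier_coeff f k z = (if k = 0 then g z else 0)" if z: "z \<in> dom2 I Y r \<sigma>" for k z
  proof -
    obtain x y where xy: "z = (x, y)" by force
    have "f (x, y, of_real t) = g (x, y)" for t :: real
      by (rule eq) (use z s in \<open>simp add: xy dom2_def strip_def\<close>)
    then show ?thesis unfolding xy by (rule fourier_coeff_indep)
  qed
  \<comment> \<open>Non-emptiness matters: a supremum over the empty set would be an unspecified
    real number instead of 0.\<close>
  have sn: "sup_norm (dom2 I Y r \<sigma>) (fourier_coeff f k) = 0" if "k \<noteq> 0" for k
    unfolding sup_norm_def using ne that by (simp add: fc)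
  have bdf: "bounded (fourier_coeff f k ` dom2 I Y r \<sigma>)" for k
  proof -
    have "fourier_coeff f k ` dom2 I Y r \<sigma> = (\<lambda>z. if k = 0 then g z else 0) ` dom2 I Y r \<sigma>"
      by (rule image_cong) (auto simp: fc)
    then show ?thesis using bd by (cases "k = 0") (auto simp: image_constant_conv)
  qed
  have "(\<lambda>k. sup_norm (dom2 I Y r \<sigma>) (fourier_coeff f k) * exp (\<bar>real_of_int k\<bar> * s)) summable_on {0::int}" by simp
  then have "(\<lambda>k::int. sup_norm (dom2 I Y r \<sigma>) (fourier_coeff f k) * exp (\<bar>real_of_int k\<bar> * s)) summable_on UNIV"
    by (rule summable_on_cong_neutral[THEN iffD1, rotated -1]) (auto simp: sn)
  moreover have "periodic3_on f (dom3 I Y (r, \<sigma>, s))"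
    unfolding periodic3_on_def using eq by (auto simp: strip_def)
  ultimately show ?thesis using hol bdf by simp
qed

lemma norm_u_zero: "dom2 I Y r \<sigma> \<noteq> {} \<Longrightarrow> norm_u I Y (r, \<sigma>, s) (\<lambda>_. 0) = 0"
proof -
  assume ne: "dom2 I Y r \<sigma> \<noteq> {}"
  have "fourier_coeff (\<lambda>_. 0) k = (\<lambda>_. 0)" for k by (auto simp: fourier_coeff_def)
  then have "sup_norm (dom2 I Y r \<sigma>) (fourier_coeff (\<lambda>_. 0) k) = 0" for k using ne by (simp add: sup_norm_def)
  then show ?thesis by simp
qed

text \<open>Boundedness of Y makes the diameter a genuine bound on distances. The points y1 +
  \<sigma> / 2 and y1 - \<sigma> / 2 show \<sigma> \<le> D, so smallness of \<tau> against \<sigma>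
  turns into smallness against D.\<close>

lemma diameter_cnbhd:
  assumes "bounded Y" "y1 \<in> Y" "\<sigma> > 0"
  shows "\<And>y y'. y \<in> cnbhd Y \<sigma> \<Longrightarrow> y' \<in> cnbhd Y \<sigma> \<Longrightarrow> cmod (y - y') \<le> diameter (cnbhd Y \<sigma>)"
    and "\<sigma> \<le> diameter (cnbhd Y \<sigma>)"
proof -
  obtain b where b: "\<And>x. x \<in> Y \<Longrightarrow> \<bar>x\<bar> \<le> b" using assms(1) by (auto simp: bounded_iff)
  have "cmod z \<le> b + \<sigma>" if z: "z \<in> cnbhd Y \<sigma>" for z
  proof -
    obtain x where x: "x \<in> Y" "cmod (z - of_real x) < \<sigma>" using z by (auto simp: cnbhd_iff)
    then show ?thesis using b[OF x(1)] norm_triangle_ineq[of "z - of_real x" "of_real x"] by simp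
  qed
  then have bd: "bounded (cnbhd Y \<sigma>)" by (auto simp: bounded_iff)
  show *: "cmod (y - y') \<le> diameter (cnbhd Y \<sigma>)" if "y \<in> cnbhd Y \<sigma>" "y' \<in> cnbhd Y \<sigma>" for y y'
    using diameter_bounded_bound[OF bd that] by (simp add: dist_norm)
  have "of_real (y1 + \<sigma> / 2) \<in> cnbhd Y \<sigma>" "of_real (y1 - \<sigma> / 2) \<in> cnbhd Y \<sigma>"
    unfolding cnbhd_iff using assms by (auto intro!: bexI[of _ y1] simp flip: of_real_diff)
  from *[OF this] have "cmod (of_real (y1 + \<sigma> / 2) - of_real (y1 - \<sigma> / 2)) \<le> diameter (cnbhd Y \<sigma>)" .
  also have "complex_of_real (y1 + \<sigma> / 2) - of_real (y1 - \<sigma> / 2) = of_real \<sigma>" by (simp add: complex_eq_iff)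
  finally show "\<sigma> \<le> diameter (cnbhd Y \<sigma>)" using assms(3) by simp
qed

text \<open>The hypotheses are reduced to the sup bounds of \<open>driven_system\<close>, whose
  coordinate change turns X into N exactly. A strict inequality between norms is impossible when
  |||P||| = 0, whence the separate case in the conclusion.\<close>

theorem theorem2p1:
  fixes I Y :: "real set"
    and r \<sigma> s \<rho> \<tau> t s2 D Q chi \<theta>1 \<theta>2 \<theta>3 \<eta> :: real
    and u w us :: "real \<times> real \<times> real"
    and p :: nat
    and v \<omega> :: "complex \<times> complex \<Rightarrow> complex"
    and X N P :: vfield
  assumes I: "open I" "connected I" "I \<noteq> {}"
    and Y: "open Y" "connected Y" "Y \<noteq> {}" "bounded Y"
    and u: "u = (r, \<sigma>, s)" "r > 0" "\<sigma> > 0" "s > 0"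
    and w: "w = (\<rho>, \<tau>, t)"
    and N: "N = driven_field v \<omega>"
    and X: "X = (\<lambda>z. N z + P z)"
    and spaces: "X \<in> O3_space I Y u" "P \<in> O3_space I Y u"
    and real: "real_on_reals X (dom3 I Y u)" "real_on_reals N (dom3 I Y u)"
    and v_nonzero: "\<forall>z\<in>dom2 I Y r \<sigma>. v z \<noteq> 0"
    and finite_norms:
      "bounded ((\<lambda>z. 1 / v z) ` dom2 I Y r \<sigma>)"
      "bounded ((\<lambda>z. \<omega> z / v z) ` dom2 I Y r \<sigma>)"
      "bounded ((\<lambda>z. dy v z / v z) ` dom2 I Y r \<sigma>)"
      "bounded ((\<lambda>z. dy \<omega> z / v z) ` dom2 I Y r \<sigma>)"
      "bounded ((\<lambda>z. dI v z / v z) ` dom2 I Y r \<sigma>)"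
      "bounded ((\<lambda>z. dI \<omega> z / v z) ` dom2 I Y r \<sigma>)"
    and D: "D = diameter (cnbhd Y \<sigma>)"
    and Q: "Q = 3 * D * sup_norm (dom2 I Y r \<sigma>) (\<lambda>z. 1 / v z)"
    and p: "p \<ge> 1" and s2: "s2 > 0"
    and \<rho>: "0 < \<rho>" "\<rho> < r / 8"
    and \<tau>: "0 < \<tau>" "\<tau> < exp (- s2) * (\<sigma> / 8)"
    and t: "0 < t" "t < s / 10"
    and chi: "chi = D / s2 * sup_norm (dom2 I Y r \<sigma>) (\<lambda>z. dy v z / v z)" "chi \<le> 1"
    and \<theta>1: "\<theta>1 = 2 * exp s2 * D * sup_norm (dom2 I Y r \<sigma>) (\<lambda>z. dy \<omega> z / v z) * (\<tau> / t)" "\<theta>1 \<le> 1"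
    and \<theta>2: "\<theta>2 = 4 * D * sup_norm (dom2 I Y r \<sigma>) (\<lambda>z. dI v z / v z) * (\<rho> / \<tau>)" "\<theta>2 \<le> 1"
    and \<theta>3: "\<theta>3 = 8 * D * sup_norm (dom2 I Y r \<sigma>) (\<lambda>z. dI \<omega> z / v z) * (\<rho> / t)" "\<theta>3 \<le> 1"
    and \<eta>: "\<eta>\<^sup>2 = max (D / t * sup_norm (dom2 I Y r \<sigma>) (\<lambda>z. \<omega> z / v z))
                      (2 ^ 7 * exp (2 * s2) * Q\<^sup>2 * (wnorm I Y w u P)\<^sup>2)"
           "\<eta>\<^sup>2 < 1 / real p"
    and us: "us = (r - 8 * \<rho>, \<sigma> - 8 * exp s2 * \<tau>, s - 10 * t)"
  shows "\<exists>\<Phi> Xs Ps.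
           real_analytic_coord_change \<Phi> (dom3 I Y us) (dom3 I Y u) \<and>
           Xs = in_coords \<Phi> X \<and>
           Xs \<in> O3_space I Y us \<and> Ps \<in> O3_space I Y us \<and>
           (\<forall>z\<in>dom3 I Y us. Xs z = N z + Ps z) \<and>
           (if wnorm I Y w u P = 0 then wnorm I Y w us Ps = 0
            else wnorm I Y w us Ps < (1 / 2) ^ (p + 1) * wnorm I Y w u P)"
proof -
  obtain y1 where y1: "y1 \<in> Y" using Y(3) by blast
  define M where "M = sup_norm (dom2 I Y r \<sigma>) (\<lambda>z. 1 / v z)"
  define W where "W = wnorm I Y w u P"
  define Bx where "Bx = norm_u I Y u (comp1 X) + norm_u I Y u (comp2 X) + norm_u I Y u (comp3 X)"
  have room: "8 * \<rho> < r" "8 * exp s2 * \<tau> < \<sigma>" "10 * t < s"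
    using \<rho> t \<tau> by (auto simp: exp_minus field_simps)
  have ne: "dom2 I Y r' \<sigma>' \<noteq> {}" if pos': "r' > 0" "\<sigma>' > 0" for r' \<sigma>'
    using I(3) Y(3) of_real_in_cnbhd[OF _ pos'(1)] of_real_in_cnbhd[OF _ pos'(2)] by (fastforce simp: dom2_def)
  obtain d0 where d0: "d0 \<in> dom2 I Y r \<sigma>" using ne[OF u(2,3)] by blast
  then have z0: "(fst d0, snd d0, 0) \<in> dom3 I Y (r, \<sigma>, s)" using u(4) by (auto simp: dom2_def strip_def)
  have Xc: "comp1 X \<in> O_space I Y u" "comp2 X \<in> O_space I Y u" "comp3 X \<in> O_space I Y u"
    and Pc: "comp1 P \<in> O_space I Y u" "comp2 P \<in> O_space I Y u" "comp3 P \<in> O_space I Y u"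
    using spaces by (auto simp: O3_space_def)
  have nu: "cmod (f z) \<le> norm_u I Y u f" if "f \<in> O_space I Y u" "z \<in> dom3 I Y (r, \<sigma>, s)" for f z
    using norm_le_norm_u[of f I Y r \<sigma> s z] that u by simp
  have nu0: "0 \<le> norm_u I Y u f" if "f \<in> O_space I Y u" for f
    using nu[OF that z0] norm_ge_zero order_trans by blast
  have holO: "holomorphic3_on f (dom3 I Y (r, \<sigma>, s))" if "f \<in> O_space I Y u" for f using that u by simp
  have perO: "f (x, y, q + 2 * of_real pi) = f (x, y, q)" if "f \<in> O_space I Y u" "(x, y, q) \<in> dom3 I Y (r, \<sigma>, s)" for f x y q
    using that unfolding u(1) O_space.simps periodic3_on_def by blast
  have W_eq: "W = norm_u I Y u (comp1 P) / \<rho> + norm_u I Y u (comp2 P) / \<tau> + norm_u I Y u (comp3 P) / t"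
    by (simp add: W_def w divide_inverse mult.commute)
  have Wparts: "0 \<le> norm_u I Y u (comp1 P) / \<rho>" "0 \<le> norm_u I Y u (comp2 P) / \<tau>" "0 \<le> norm_u I Y u (comp3 P) / t"
    using nu0[OF Pc(1)] nu0[OF Pc(2)] nu0[OF Pc(3)] \<rho> \<tau> t by auto
  have W0: "0 \<le> W" using Wparts by (simp add: W_eq)
  have "norm_u I Y u (comp1 P) / \<rho> \<le> W" "norm_u I Y u (comp2 P) / \<tau> \<le> W" "norm_u I Y u (comp3 P) / t \<le> W"
    using Wparts unfolding W_eq by linarith+
  then have PW: "norm_u I Y u (comp1 P) \<le> \<rho> * W" "norm_u I Y u (comp2 P) \<le> \<tau> * W" "norm_u I Y u (comp3 P) \<le> t * W"
    using \<rho> \<tau> t by (simp_all add: field_simps)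
  have Nc: "comp1 X z = comp1 P z" "comp2 X z = v (fst z, fst (snd z)) + comp2 P z" "comp3 X z = \<omega> (fst z, fst (snd z)) + comp3 P z" for z
    by (simp_all add: X N driven_field_def case_prod_unfold)
  \<comment> \<open>Only X and P are given as elements of the function space; v and \<omega> inherit
    holomorphy, and later boundedness, as differences of their components.\<close>
  have holv: "holomorphic3_on (\<lambda>(x, y, q). v (x, y)) (dom3 I Y (r, \<sigma>, s))"
    by (rule hol3_cong[OF hol3_diff[OF open_dom3 holO[OF Xc(2)] holO[OF Pc(2)]] open_dom3])
      (simp add: Nc case_prod_unfold)
  have hol\<omega>: "holomorphic3_on (\<lambda>(x, y, q). \<omega> (x, y)) (dom3 I Y (r, \<sigma>, s))"
    by (rule hol3_cong[OF hol3_diff[OF open_dom3 holO[OF Xc(3)] holO[OF Pc(3)]] open_dom3])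
      (simp add: Nc case_prod_unfold)
  have Dd: "cmod (y - y') \<le> D" if "y \<in> cnbhd Y \<sigma>" "y' \<in> cnbhd Y \<sigma>" for y y'
    unfolding D by (rule diameter_cnbhd(1)[OF Y(4) y1 u(3) that])
  have D\<sigma>: "\<sigma> \<le> D" unfolding D by (rule diameter_cnbhd(2)[OF Y(4) y1 u(3)])
  then have D0: "0 < D" using u(3) by linarith
  note sn = le_sup_norm[where A = "dom2 I Y r \<sigma>"]
  have p1: "1 / real p \<le> 1" using p by simp
  \<comment> \<open>Since p \<ge> 1, both entries of the maximum \<eta>^2 lie below 1.\<close>
  have max1: "D / t * sup_norm (dom2 I Y r \<sigma>) (\<lambda>z. \<omega> z / v z) \<le> 1"
    and max2: "2 ^ 7 * exp (2 * s2) * Q\<^sup>2 * (wnorm I Y w u P)\<^sup>2 < 1"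
    using \<eta> p1 by linarith+
  have M0: "0 \<le> M" unfolding M_def using order_trans[OF norm_ge_zero sn[OF finite_norms(1) d0]] .
  have small: "exp s2 * (D * M * W) \<le> 1 / 32"
  proof (rule power2_le_imp_le)
    \<comment> \<open>The factor 3 in Q gives 2^7 * 9 = 1152, which exceeds 32^2 = 1024.\<close>
    have "2 ^ 7 * exp (2 * s2) * Q\<^sup>2 * (wnorm I Y w u P)\<^sup>2 = 1152 * (exp s2 * (D * M * W))\<^sup>2"
      by (simp add: Q M_def W_def power_mult_distrib exp_double)
    then have "(exp s2 * (D * M * W))\<^sup>2 \<le> 1 / 1024" using max2 zero_le_power2[of "exp s2 * (D * M * W)"] by linarith
    then show "(exp s2 * (D * M * W))\<^sup>2 \<le> (1 / 32)\<^sup>2" by (simp add: power_divide)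
  qed simp
  interpret driven_system I Y r \<sigma> s \<rho> \<tau> t s2 D M W y1 Bx v \<omega> X P
  proof
    show "connected I" "connected Y" "y1 \<in> Y" by (fact I(2) Y(2) y1)+
    show "\<rho> > 0" "\<tau> > 0" "t > 0" "s2 > 0" "M \<ge> 0" "W \<ge> 0" by (fact \<rho> \<tau> t s2 M0 W0)+
    show "8 * \<rho> < r" "8 * exp s2 * \<tau> < \<sigma>" "10 * t < s" by (fact room)+
    show "8 * exp s2 * \<tau> < D" using room(2) D\<sigma> by linarith
    show "holomorphic3_on (\<lambda>z. crd i (X z)) (dom3 I Y (r, \<sigma>, s))" for i
      by (rule all_crd[of "\<lambda>c. holomorphic3_on (\<lambda>z. c (X z)) (dom3 I Y (r, \<sigma>, s))"])
        (use holO[OF Xc(1)] holO[OF Xc(2)] holO[OF Xc(3)] in \<open>auto simp del: dom3.simps\<close>)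
    show "X = (\<lambda>z. driven_field v \<omega> z + P z)" using X N by simp
    fix z assume z: "z \<in> dom3 I Y (r, \<sigma>, s)"
    show "cmod (crd 0 (P z)) \<le> \<rho> * W" "cmod (crd 1 (P z)) \<le> \<tau> * W" "cmod (crd 2 (P z)) \<le> t * W"
      using nu[OF Pc(1) z] nu[OF Pc(2) z] nu[OF Pc(3) z] PW by auto
    show "cmod (crd i (X z)) \<le> Bx" for i
      by (rule all_crd[of "\<lambda>c. cmod (c (X z)) \<le> Bx"])
        (use nu[OF Xc(1) z] nu[OF Xc(2) z] nu[OF Xc(3) z] nu0[OF Xc(1)] nu0[OF Xc(2)] nu0[OF Xc(3)] in \<open>auto simp: Bx_def\<close>)
    obtain x y q where xyq: "z = (x, y, q)" by (metis prod_cases3)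
    show "X (shift z) = X z"
      using perO[OF Xc(1) z[unfolded xyq]] perO[OF Xc(2) z[unfolded xyq]] perO[OF Xc(3) z[unfolded xyq]]
      by (simp add: xyq prod_eq_iff)
    show "X z \<in> reals3" if "z \<in> reals3"
      using real(1) z that unfolding u(1) real_on_reals_def by blast
  next
    fix x y assume xy: "(x, y) \<in> dom2 I Y r \<sigma>" "x \<in> \<real>" "y \<in> \<real>"
    \<comment> \<open>The field N does not depend on the angle, so its reality at angle 0 gives the
      reality of v and \<omega>.\<close>
    have "(x, y, 0) \<in> dom3 I Y u \<inter> reals3" using xy u by (auto simp: dom2_def strip_def)
    then have "N (x, y, 0) \<in> reals3" using real(2) unfolding real_on_reals_def by blast
    then show "v (x, y) \<in> \<real> \<and> \<omega> (x, y) \<in> \<real>" by (simp add: N driven_field_def)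
  next
    fix z assume z: "z \<in> dom2 I Y r \<sigma>"
    show "v z \<noteq> 0" using v_nonzero z by blast
    show "1 / cmod (v z) \<le> M" using sn[OF finite_norms(1) z] by (simp add: M_def norm_divide)
    show "cmod (dy v z / v z) \<le> s2 / D"
    proof -
      have "D / s2 * sup_norm (dom2 I Y r \<sigma>) (\<lambda>z. dy v z / v z) \<le> 1" using chi by simp
      then have "sup_norm (dom2 I Y r \<sigma>) (\<lambda>z. dy v z / v z) \<le> s2 / D"
        using s2 D0 by (simp add: field_simps)
      then show ?thesis using sn[OF finite_norms(3) z] by linarith
    qed
    show "cmod (dI v z / v z) \<le> \<tau> / (4 * D * \<rho>)"
    proof -
      have "4 * D * sup_norm (dom2 I Y r \<sigma>) (\<lambda>z. dI v z / v z) * (\<rho> / \<tau>) \<le> 1" using \<theta>2 by simp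
      then have "sup_norm (dom2 I Y r \<sigma>) (\<lambda>z. dI v z / v z) \<le> \<tau> / (4 * D * \<rho>)"
        using \<rho>(1) \<tau>(1) D0 by (simp add: field_simps)
      then show ?thesis using sn[OF finite_norms(5) z] by linarith
    qed
    show "cmod (\<omega> z / v z) \<le> t / D"
    proof -
      have "sup_norm (dom2 I Y r \<sigma>) (\<lambda>z. \<omega> z / v z) \<le> t / D"
        using max1 t(1) D0 by (simp add: field_simps)
      then show ?thesis using sn[OF finite_norms(2) z] by linarith
    qed
  qed (fact holv hol\<omega> Dd small)+
  have Bx0: "0 \<le> Bx" using nu0[OF Xc(1)] nu0[OF Xc(2)] nu0[OF Xc(3)] by (simp add: Bx_def)
  obtain \<Phi> where \<Phi>: "real_analytic_coord_change \<Phi> (dom3 I Y us) (dom3 I Y u)"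
    "\<And>z. z \<in> dom3 I Y us \<Longrightarrow> in_coords \<Phi> X z = driven_field v \<omega> z"
    using coord_change[OF Bx0] unfolding us u(1) by blast
  define Xs where "Xs = in_coords \<Phi> X"
  \<comment> \<open>The transformed field equals N on the new domain, so the zero field is a valid
    remainder.\<close>
  define Ps :: vfield where "Ps = (\<lambda>_. 0)"
  have us_pos: "r - 8 * \<rho> > 0" "\<sigma> - 8 * exp s2 * \<tau> > 0" "s - 10 * t > 0" using room by auto
  note ne' = ne[OF us_pos(1,2)]
  have sub: "dom3 I Y us \<subseteq> dom3 I Y (r, \<sigma>, s)"
    unfolding us by (rule dom3_mono) (use \<rho> \<tau> t in auto)
  have bd: "bounded (g ` dom2 I Y (r - 8 * \<rho>) (\<sigma> - 8 * exp s2 * \<tau>))"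
    if g: "\<And>x y q. cmod (g (x, y)) \<le> cmod (f (x, y, q)) + cmod (f' (x, y, q))" "f \<in> O_space I Y u" "f' \<in> O_space I Y u" for f f' g
    unfolding bounded_iff
  proof (intro exI ballI)
    fix w assume "w \<in> g ` dom2 I Y (r - 8 * \<rho>) (\<sigma> - 8 * exp s2 * \<tau>)"
    then obtain x y where xy: "(x, y) \<in> dom2 I Y (r - 8 * \<rho>) (\<sigma> - 8 * exp s2 * \<tau>)" "w = g (x, y)" by auto
    then have "(x, y, 0) \<in> dom3 I Y us" using us_pos unfolding us by (simp add: dom2_def strip_def)
    then have z: "(x, y, 0) \<in> dom3 I Y (r, \<sigma>, s)" using sub by blast
    show "norm w \<le> norm_u I Y u f + norm_u I Y u f'"
      using g(1)[of x y 0] nu[OF g(2) z] nu[OF g(3) z] xy(2) by simp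
  qed
  have ops: "open (dom3 I Y us)" unfolding us by (rule open_dom3)
  \<comment> \<open>Off the new domain nothing is known about \<open>Xs\<close>, so membership is
    obtained from its agreement there with a bounded function of (x, y).\<close>
  have in_O: "(\<lambda>z. f (Xs z)) \<in> O_space I Y us"
    if f: "\<And>x y q. f (driven_field v \<omega> (x, y, q)) = g (x, y)" "holomorphic3_on (\<lambda>(x, y, q). g (x, y)) (dom3 I Y us)"
      "bounded (g ` dom2 I Y (r - 8 * \<rho>) (\<sigma> - 8 * exp s2 * \<tau>))" for f g
    unfolding us
  proof (rule O_space_indep[OF _ us_pos(3) _ f(3) ne'])
    show *: "f (Xs (x, y, q)) = g (x, y)" if "(x, y, q) \<in> dom3 I Y (r - 8 * \<rho>, \<sigma> - 8 * exp s2 * \<tau>, s - 10 * t)" for x y q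
      using \<Phi>(2)[of "(x, y, q)"] that f(1) unfolding us Xs_def by simp
    show "holomorphic3_on (\<lambda>z. f (Xs z)) (dom3 I Y (r - 8 * \<rho>, \<sigma> - 8 * exp s2 * \<tau>, s - 10 * t))"
      by (rule hol3_cong[OF f(2)[unfolded us] open_dom3]) (use * in \<open>auto simp del: dom3.simps\<close>)
  qed
  have "Xs \<in> O3_space I Y us"
    unfolding O3_space_def
  proof (intro CollectI conjI)
    show "comp1 Xs \<in> O_space I Y us"
    proof (rule in_O[where g = "\<lambda>_. 0"])
      show "holomorphic3_on (\<lambda>(x, y, q). 0) (dom3 I Y us)" using hol3_const[OF ops, of 0] by (simp add: case_prod_unfold)
    qed (auto simp: driven_field_def image_constant_conv)
    show "comp2 Xs \<in> O_space I Y us"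
    proof (rule in_O[where g = v])
      show "bounded (v ` dom2 I Y (r - 8 * \<rho>) (\<sigma> - 8 * exp s2 * \<tau>))"
      proof (rule bd[OF _ Xc(2) Pc(2)])
        show "cmod (v (x, y)) \<le> cmod (comp2 X (x, y, q)) + cmod (comp2 P (x, y, q))" for x y q
          using norm_triangle_ineq4[of "comp2 X (x, y, q)" "comp2 P (x, y, q)"] by (simp add: Nc)
      qed
    qed (auto simp: driven_field_def intro: hol3_subset[OF holv sub])
    show "comp3 Xs \<in> O_space I Y us"
    proof (rule in_O[where g = \<omega>])
      show "bounded (\<omega> ` dom2 I Y (r - 8 * \<rho>) (\<sigma> - 8 * exp s2 * \<tau>))"
      proof (rule bd[OF _ Xc(3) Pc(3)])
        show "cmod (\<omega> (x, y)) \<le> cmod (comp3 X (x, y, q)) + cmod (comp3 P (x, y, q))" for x y q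
          using norm_triangle_ineq4[of "comp3 X (x, y, q)" "comp3 P (x, y, q)"] by (simp add: Nc)
      qed
    qed (auto simp: driven_field_def intro: hol3_subset[OF hol\<omega> sub])
  qed
  moreover have "(\<lambda>_. 0) \<in> O_space I Y us"
    unfolding us
    by (rule O_space_indep[where g = "\<lambda>_. 0", OF hol3_const[OF open_dom3] us_pos(3) _ _ ne']) (auto simp: image_constant_conv)
  then have "Ps \<in> O3_space I Y us" by (simp add: O3_space_def Ps_def)
  moreover have "\<forall>z\<in>dom3 I Y us. Xs z = N z + Ps z"
    using \<Phi>(2) by (simp add: Xs_def N Ps_def del: dom3.simps)
  moreover have "wnorm I Y w us Ps = 0"
    using norm_u_zero[OF ne', of "s - 10 * t"] by (simp add: w us Ps_def del: norm_u.simps)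
  then have "if wnorm I Y w u P = 0 then wnorm I Y w us Ps = 0
            else wnorm I Y w us Ps < (1 / 2) ^ (p + 1) * wnorm I Y w u P"
    using W0 by (simp add: W_def)
  ultimately show ?thesis using \<Phi>(1) Xs_def by blast
qed

end
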